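(* In the heat-conduction setting described in the context (with operators $A$, $B(t)$ on $X=H_0^1(\Omega)\times L^2(\Omega)$, constants $M,\gamma>0$, exponents $p,q>1$ with $1/p+1/q=1$, and resolvent operator $R(t)$ with $\|R(t)\|\le Me^{-\gamma t/q}$), let $a\in AAA(\mathbb{R}^+;\mathbb{R})$, let $b:H_0^1(\Omega)\to L^2(\Omega)$, let $f(t,u)=\begin{bmatrix}0\\ a(t)b(\theta)\end{bmatrix}$ for $u=\begin{bmatrix}\theta\\ \eta\end{bmatrix}\in X$, let $u_0\in X$, and let $h(u)=\begin{bmatrix}h_1(\xi)\\ h_2(\eta)\end{bmatrix}$ for $u=\begin{bmatrix}\xi\\ \eta\end{bmatrix}$, where $h_1:C(\mathbb{R}^+;H_0^1(\Omega))\to H_0^1(\Omega)$ and $h_2:C(\mathbb{R}^+;L^2(\Omega))\to L^2(\Omega)$. Put $$y_0(t)=R(t)(u_0+h(0))+\int_0^tR(t-s)f(s,0)\,ds .$$ Let $\rho>0$ be a real number such that $$\rho\ge M\Big(\|u_0\|+\|h(0)\|+\frac{q}{\gamma}\|a\|\,\|b(0)\|\Big).$$ Suppose that $h_1$ and $h_2$ are Lipschitz with the same Lipschitz constant $\dfrac{\rho}{pM(\rho+\|y_0\|_\infty)}$ and that $b$ is Lipschitz with Lipschitz constant $\dfrac{\gamma\rho}{qM\|a\|(\rho+\|y_0\|_\infty)}$. Then the problem $$u'(t)=Au(t)+\int_0^tB(t-s)u(s)\,ds+f(t,u(t)),\ t\in\mathbb{R}^+,\qquad u(0)=u_0+h(u),$$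 has a unique mild solution $y\in AAA(\mathbb{R}^+;X)$ such that $\|y-y_0\|_\infty\le\rho$.
   Context: $\mathbb{R}^+=[0,+\infty)$, $\|\cdot\|_\infty$ is the supremum norm. For a Banach space $Z$, $AA(\mathbb{R};Z)$ is the set of bounded continuous $f:\mathbb{R}\to Z$ such that every real sequence has a subsequence $(s_n)$ and a function $\tilde f$ with $\lim_nf(t+s_n)=\tilde f(t)$ and $\lim_n\tilde f(t-s_n)=f(t)$ for each $t$; $C_0(\mathbb{R}^+;Z)$ is the set of continuous $\phi$ with $\|\phi(t)\|\to0$ as $t\to+\infty$; $AAA(\mathbb{R}^+;Z)=AA(\mathbb{R};Z)\oplus C_0(\mathbb{R}^+;Z)$ (asymptotically almost automorphic functions), with norm $\|f+\phi\|=\sup_{t\in\mathbb{R}}\|f(t)\|+\sup_{t\in\mathbb{R}^+}\|\phi(t)\|$. Setting: $\Omega\subset\mathbb{R}^3$ is open, connected and bounded with $C^\infty$ boundary; $\alpha,\beta\in C^2([0,+\infty);\mathbb{R})$ with $\alpha(0),\beta(0)>0$; $\Delta$ is the Laplacian on $\Omega$. On $X=H_0^1(\Omega)\times L^2(\Omega)$ let $$A=\begin{bmatrix}0&I\\ \alpha(0)\Delta&-\beta(0)I\end{bmatrix},\qquad B(t)=\begin{bmatrix}0&0\\ \alpha'(t)\Delta&-\beta'(t)I\end{bmatrix},$$ $D(A)=(H^2(\Omega)\cap H_0^1(\Omega))\times H_0^1(\Omega)$. $A$ generates a semigroup $\{T(t)\}_{t\ge0}$ with $\|T(t)\|\le Me^{-\gamma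 t}$, $t\ge0$, for positive constants $M,\gamma$. Write $B(t)=F(t)A$ with $$F(t)=\begin{bmatrix}0&0\\ -\beta'(t)I+\beta(0)\frac{\alpha'(t)}{\alpha(0)}I&\frac{\alpha'(t)}{\alpha(0)}I\end{bmatrix},$$ with entries $F_{ij}$. Standing assumptions: (R1) $\alpha'(t)e^{\gamma t},\alpha''(t)e^{\gamma t},\beta'(t)e^{\gamma t},\beta''(t)e^{\gamma t}$ are bounded and uniformly continuous; (R2) $p,q>1$, $1/p+1/q=1$, and for all $t\ge0$, $\max\{\|F_{21}(t)\|,\|F_{22}(t)\|\}\le\frac{\gamma e^{-\gamma t}}{pM}$ and $\max\{\|F_{21}'(t)\|,\|F_{22}'(t)\|\}\le\frac{\gamma^2e^{-\gamma t}}{(pM)^2}$. Under (R1), (R2), by a result of R. C. Grimmer, the linear equation $u'(t)=Au(t)+\int_0^tB(t-s)u(s)ds$ has a resolvent operator $\{R(t)\}_{t\ge0}$ with $\|R(t)\|\le Me^{-\gamma t/q}$ for all $t\ge0$. Resolvent operator: continuous linear operators $R(t)$ on $X$ with $R(0)=I$; $t\mapsto R(t)x$ continuous on $[0,\infty)$ for each $x\in X$; and, with $Y=D(A)$ under the graph norm, $R(t)$ is continuous on $Y$ and for $y\in Y$ the map $t\mapsto R(t)y$ belongs to $C([0,\infty);Y)\cap C^1([0,\infty);X)$ and satisfies $\frac{d}{dt}R(t)y=AR(t)y+\int_0^tB(t-s)R(s)y\,ds=R(t)Ay+\int_0^tR(t-s)B(s)y\,ds$, $t\ge0$. Mild solution: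 $u\in C(\mathbb{R}^+;X)$ with $u(t)=R(t)(u_0+h(u))+\int_0^tR(t-s)f(s,u(s))\,ds$, $t\ge0$. *)

theory Defs
  imports "HOL-Analysis.Analysis"
begin

section \<open>The Hilbert space of square-integrable functions modulo null sets\<close>

definition square_integrable :: "('a::euclidean_space \<Rightarrow> real) \<Rightarrow> bool" where
  "square_integrable f \<longleftrightarrow> f \<in> borel_measurable lborel \<and> integrable lborel (\<lambda>x. (f x)\<^sup>2)"

lemma square_integrable_mult:
  assumes "square_integrable f" "square_integrable g"
  shows "integrable lborel (\<lambda>x. f x * g x)"
proof (rule Bochner_Integration.integrable_bound)
  show "integrable lborel (\<lambda>x. (f x)\<^sup>2 + (g x)\<^sup>2)"
    using assms by (simp add: square_integrable_def)
  show "(\<lambda>x. f x * g x) \<in> borel_measurable lborel"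
    using assms by (auto simp: square_integrable_def intro!: borel_measurable_times)
  have "\<bar>u * v\<bar> \<le> u\<^sup>2 + v\<^sup>2" for u v :: real
  proof -
    have "2 * \<bar>u * v\<bar> \<le> u\<^sup>2 + v\<^sup>2"
      using sum_squares_bound[of "\<bar>u\<bar>" "\<bar>v\<bar>"] by (simp add: abs_mult)
    then show ?thesis by linarith
  qed
  then show "AE x in lborel. norm (f x * g x) \<le> norm ((f x)\<^sup>2 + (g x)\<^sup>2)"
    by auto
qed

lemma square_integrable_add:
  assumes "square_integrable f" "square_integrable g"
  shows "square_integrable (\<lambda>x. f x + g x)"
proof -
  have "integrable lborel (\<lambda>x. (f x)\<^sup>2 + (g x)\<^sup>2 + 2 * (f x * g x))"
    using assms square_integrable_mult[OF assms] by (simp add: square_integrable_def)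
  then show ?thesis
    using assms by (auto simp: square_integrable_def power2_sum mult.assoc intro!: borel_measurable_add)
qed

lemma square_integrable_scale:
  "square_integrable f \<Longrightarrow> square_integrable (\<lambda>x. c * f x)"
  by (auto simp: square_integrable_def power_mult_distrib intro!: borel_measurable_times)

lemma square_integrable_uminus:
  "square_integrable f \<Longrightarrow> square_integrable (\<lambda>x. - f x)"
  using square_integrable_scale[of f "-1"] by simp

lemma square_integrable_diff:
  "square_integrable f \<Longrightarrow> square_integrable g \<Longrightarrow> square_integrable (\<lambda>x. f x - g x)"
  using square_integrable_add[OF _ square_integrable_uminus, of f g] by simp

definition l2_rel :: "('a::euclidean_space \<Rightarrow> real) \<Rightarrow> ('a \<Rightarrow> real) \<Rightarrow> bool" where
  "l2_rel f g \<longleftrightarrow> square_integrable f \<and> square_integrable g \<and> (AE x in lborel. f x = g x)"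

quotient_type (overloaded) 'a l2 = "'a::euclidean_space \<Rightarrow> real" / partial: l2_rel
proof (rule part_equivpI)
  show "\<exists>f::'a \<Rightarrow> real. l2_rel f f"
    by (rule exI[of _ "\<lambda>_. 0"]) (simp add: l2_rel_def square_integrable_def)
  show "symp (l2_rel :: ('a \<Rightarrow> real) \<Rightarrow> _)"
    by (auto simp: symp_def l2_rel_def)
  show "transp (l2_rel :: ('a \<Rightarrow> real) \<Rightarrow> _)"
    by (auto simp: transp_def l2_rel_def)
qed

instantiation l2 :: (euclidean_space) real_inner
begin

lift_definition zero_l2 :: "'a l2" is "\<lambda>_. 0"
  by (simp add: l2_rel_def square_integrable_def)

lift_definition plus_l2 :: "'a l2 \<Rightarrow> 'a l2 \<Rightarrow> 'a l2" is "\<lambda>f g x. f x + g x"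
  by (auto simp: l2_rel_def intro: square_integrable_add)

lift_definition scaleR_l2 :: "real \<Rightarrow> 'a l2 \<Rightarrow> 'a l2" is "\<lambda>c f x. c * f x"
  by (auto simp: l2_rel_def intro: square_integrable_scale)

lift_definition inner_l2 :: "'a l2 \<Rightarrow> 'a l2 \<Rightarrow> real" is "\<lambda>f g. \<integral>x. f x * g x \<partial>lborel"
  by (rule integral_cong_AE) (auto simp: l2_rel_def square_integrable_def)

lift_definition uminus_l2 :: "'a l2 \<Rightarrow> 'a l2" is "\<lambda>f x. - f x"
  by (auto simp: l2_rel_def intro: square_integrable_uminus)

lift_definition minus_l2 :: "'a l2 \<Rightarrow> 'a l2 \<Rightarrow> 'a l2" is "\<lambda>f g x. f x - g x"
  by (auto simp: l2_rel_def intro: square_integrable_diff)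

definition norm_l2 :: "'a l2 \<Rightarrow> real" where "norm u = sqrt (inner u (u :: 'a l2))"

definition sgn_l2 :: "'a l2 \<Rightarrow> 'a l2" where "sgn u = inverse (norm u) *\<^sub>R (u :: 'a l2)"

definition dist_l2 :: "'a l2 \<Rightarrow> 'a l2 \<Rightarrow> real" where "dist u v = norm (u - (v :: 'a l2))"

definition uniformity_l2 :: "('a l2 \<times> 'a l2) filter" where
  "uniformity = (INF e\<in>{0<..}. principal {(u, v). dist u (v :: 'a l2) < e})"

definition open_l2 :: "'a l2 set \<Rightarrow> bool" where
  "open U = (\<forall>u\<in>U. \<forall>\<^sub>F (u', v) in uniformity. u' = u \<longrightarrow> v \<in> (U :: 'a l2 set))"

instance
proof
  fix u v w :: "'a l2" and c d :: real
  show "u + v + w = u + (v + w)"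
    by transfer (auto simp: l2_rel_def add.assoc intro!: square_integrable_add)
  show "u + v = v + u"
    by transfer (auto simp: l2_rel_def add.commute intro!: square_integrable_add)
  show "0 + u = u"
    by transfer (auto simp: l2_rel_def)
  show "- u + u = 0"
    by transfer (auto simp: l2_rel_def square_integrable_def)
  show "u - v = u + - v"
    by transfer (auto simp: l2_rel_def intro!: square_integrable_diff)
  show "c *\<^sub>R (u + v) = c *\<^sub>R u + c *\<^sub>R v"
    by transfer (auto simp: l2_rel_def algebra_simps
        intro!: square_integrable_add square_integrable_scale)
  show "(c + d) *\<^sub>R u = c *\<^sub>R u + d *\<^sub>R u"
    by transfer (auto simp: l2_rel_def algebra_simps
        intro!: square_integrable_add square_integrable_scale)
  show "c *\<^sub>R d *\<^sub>R u = (c * d) *\<^sub>R u"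
    by transfer (auto simp: l2_rel_def mult.assoc intro!: square_integrable_scale)
  show "1 *\<^sub>R u = u"
    by transfer (auto simp: l2_rel_def)
  show "sgn u = inverse (norm u) *\<^sub>R u" by (rule sgn_l2_def)
  show "(uniformity :: ('a l2 \<times> 'a l2) filter) = (INF e\<in>{0<..}. principal {(u, v). dist u v < e})"
    by (rule uniformity_l2_def)
  show "open U \<longleftrightarrow> (\<forall>u\<in>U. \<forall>\<^sub>F (u', v) in uniformity. u' = u \<longrightarrow> v \<in> U)" for U :: "'a l2 set"
    by (rule open_l2_def)
  show "dist u v = norm (u - v)" by (rule dist_l2_def)
  show "norm u = sqrt (inner u u)" by (rule norm_l2_def)
  show "inner u v = inner v u"
    by transfer (simp add: mult.commute)
  show "inner (u + v) w = inner u w + inner v w"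
    by transfer (simp add: l2_rel_def square_integrable_mult distrib_right)
  show "inner (c *\<^sub>R u) v = c * inner u v"
    by transfer (simp add: mult.assoc)
  show "0 \<le> inner u u"
    by transfer simp
  show "inner u u = 0 \<longleftrightarrow> u = 0"
  proof (transfer, clarsimp simp: l2_rel_def)
    fix f :: "'a \<Rightarrow> real" assume f: "square_integrable f"
    then have "(\<integral>x. f x * f x \<partial>lborel) = 0 \<longleftrightarrow> (AE x in lborel. f x * f x = 0)"
      by (intro integral_nonneg_eq_0_iff_AE square_integrable_mult) auto
    moreover have "square_integrable (\<lambda>_::'a. 0)"
      by (simp add: square_integrable_def)
    ultimately show "(\<integral>x. f x * f x \<partial>lborel) = 0
        \<longleftrightarrow> square_integrable (\<lambda>_::'a. 0) \<and> (AE x in lborel. f x = 0)"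
      by simp
  qed
qed

end

lift_definition vanishes_outside :: "'a::euclidean_space set \<Rightarrow> 'a l2 \<Rightarrow> bool"
  is "\<lambda>S f. AE x in lborel. x \<notin> S \<longrightarrow> f x = 0"
  by (auto simp: l2_rel_def)

text \<open>Functions on \<open>\<Omega>\<close> are identified with their extensions by zero.\<close>

definition L2 :: "'a::euclidean_space set \<Rightarrow> 'a l2 set" where
  "L2 \<Omega> = {v. vanishes_outside \<Omega> v}"


section \<open>Smooth functions, smooth domains, Sobolev spaces\<close>

primrec Ck :: "nat \<Rightarrow> ('a::euclidean_space \<Rightarrow> real) \<Rightarrow> bool" where
  "Ck 0 f \<longleftrightarrow> continuous_on UNIV f"
| "Ck (Suc k) f \<longleftrightarrow> (\<forall>x. f differentiable (at x)) \<and> (\<forall>v. Ck k (\<lambda>x. frechet_derivative f (at x) v))"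

definition smooth :: "('a::euclidean_space \<Rightarrow> real) \<Rightarrow> bool" where
  "smooth f \<longleftrightarrow> (\<forall>k. Ck k f)"

text \<open>Near each boundary point, \<open>\<Omega>\<close> is, in suitable orthogonal coordinates, the region
  strictly above the graph of a smooth function.\<close>

definition smooth_boundary :: "(real^3) set \<Rightarrow> bool" where
  "smooth_boundary \<Omega> \<longleftrightarrow> (\<forall>z\<in>frontier \<Omega>. \<exists>r>0. \<exists>Q::real^3 \<Rightarrow> real^3. \<exists>g::real^2 \<Rightarrow> real.
     orthogonal_transformation Q \<and> smooth g \<and>
     \<Omega> \<inter> ball z r = {x \<in> ball z r. g (vector [Q x $ 1, Q x $ 2]) < Q x $ 3})"

definition partial_deriv :: "'n \<Rightarrow> (real^'n \<Rightarrow> real) \<Rightarrow> real^'n \<Rightarrow> real" where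
  "partial_deriv i \<phi> x = frechet_derivative \<phi> (at x) (axis i 1)"

definition test_functions :: "(real^'n) set \<Rightarrow> (real^'n \<Rightarrow> real) set" where
  "test_functions \<Omega> = {\<phi>. smooth \<phi> \<and> compact (closure {x. \<phi> x \<noteq> 0}) \<and> closure {x. \<phi> x \<noteq> 0} \<subseteq> \<Omega>}"

text \<open>A Sobolev function is represented by the pair of itself and its weak gradient (which it
  determines), so that the norm of the product type is the \<open>H\<^sup>1\<close> norm
  \<open>(\<parallel>u\<parallel>\<^sup>2 + \<Sum>\<^sub>i \<parallel>\<partial>\<^sub>i u\<parallel>\<^sup>2)\<^sup>1\<^sup>/\<^sup>2\<close>, and \<open>H\<^sub>0\<^sup>1(\<Omega>)\<close> is the closure of the test functions in this norm.\<close>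

type_synonym l2r3 = "(real^3) l2"
type_synonym h1r3 = "l2r3 \<times> (l2r3^3)"

definition H01 :: "(real^3) set \<Rightarrow> h1r3 set" where
  "H01 \<Omega> = closure {(abs_l2 \<phi>, \<chi> i. abs_l2 (partial_deriv i \<phi>)) | \<phi>. \<phi> \<in> test_functions \<Omega>}"

definition has_weak_deriv :: "(real^3) set \<Rightarrow> 3 \<Rightarrow> l2r3 \<Rightarrow> l2r3 \<Rightarrow> bool" where
  "has_weak_deriv \<Omega> i v w \<longleftrightarrow> w \<in> L2 \<Omega> \<and>
     (\<forall>\<phi>\<in>test_functions \<Omega>. inner v (abs_l2 (partial_deriv i \<phi>)) = - inner w (abs_l2 \<phi>))"

definition weak_deriv :: "(real^3) set \<Rightarrow> 3 \<Rightarrow> l2r3 \<Rightarrow> l2r3" where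
  "weak_deriv \<Omega> i v = (THE w. has_weak_deriv \<Omega> i v w)"

text \<open>\<open>H\<^sup>2(\<Omega>) \<inter> H\<^sub>0\<^sup>1(\<Omega>)\<close>: the first-order weak derivatives \<open>snd \<theta>\<close> have weak derivatives
  in \<open>L\<^sup>2(\<Omega>)\<close>.\<close>

definition H2_H01 :: "(real^3) set \<Rightarrow> h1r3 set" where
  "H2_H01 \<Omega> = {\<theta> \<in> H01 \<Omega>. \<forall>i j. \<exists>w. has_weak_deriv \<Omega> j (snd \<theta> $ i) w}"

definition laplacian :: "(real^3) set \<Rightarrow> h1r3 \<Rightarrow> l2r3" where
  "laplacian \<Omega> \<theta> = (\<Sum>i\<in>UNIV. weak_deriv \<Omega> i (snd \<theta> $ i))"

text \<open>The element of \<open>H\<^sub>0\<^sup>1(\<Omega>)\<close> whose underlying \<open>L\<^sup>2\<close> function is \<open>\<eta>\<close>.\<close>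

definition as_H01 :: "(real^3) set \<Rightarrow> l2r3 \<Rightarrow> h1r3" where
  "as_H01 \<Omega> \<eta> = (THE \<theta>. \<theta> \<in> H01 \<Omega> \<and> fst \<theta> = \<eta>)"


section \<open>The wave operators\<close>

type_synonym state = "h1r3 \<times> l2r3"

definition state_space :: "(real^3) set \<Rightarrow> state set" where
  "state_space \<Omega> = H01 \<Omega> \<times> L2 \<Omega>"

text \<open>The state space carries the maximum norm of its two components. It is equivalent to the
  norm of the product type, which is therefore used below for continuity, limits, integrals
  and boundedness. For the maximum norm a componentwise map inherits the
  common Lipschitz constant of its components.\<close>

definition state_norm :: "state \<Rightarrow> real" where
  "state_norm u = max (norm (fst u)) (norm (snd u))"

definition sup_norm :: "(real \<Rightarrow> state) \<Rightarrow> real" where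
  "sup_norm u = (SUP t\<in>{0..}. state_norm (u t))"

definition wave_dom :: "(real^3) set \<Rightarrow> state set" where
  "wave_dom \<Omega> = H2_H01 \<Omega> \<times> (fst ` H01 \<Omega>)"

definition wave_A :: "(real^3) set \<Rightarrow> real \<Rightarrow> real \<Rightarrow> state \<Rightarrow> state" where
  "wave_A \<Omega> \<alpha>0 \<beta>0 = (\<lambda>(\<theta>, \<eta>). (as_H01 \<Omega> \<eta>, \<alpha>0 *\<^sub>R laplacian \<Omega> \<theta> - \<beta>0 *\<^sub>R \<eta>))"

definition wave_B :: "(real^3) set \<Rightarrow> (real \<Rightarrow> real) \<Rightarrow> (real \<Rightarrow> real) \<Rightarrow> real \<Rightarrow> state \<Rightarrow> state" where
  "wave_B \<Omega> \<alpha>' \<beta>' t = (\<lambda>(\<theta>, \<eta>). (0, \<alpha>' t *\<^sub>R laplacian \<Omega> \<theta> - \<beta>' t *\<^sub>R \<eta>))"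

text \<open>The nonzero entries of \<open>F(t)\<close>; the arguments \<open>a, b\<close> stand for \<open>\<alpha>'(t), \<beta>'(t)\<close>, and replacing
  these by \<open>\<alpha>''(t), \<beta>''(t)\<close> gives the entries of \<open>F'(t)\<close>. As an operator from \<open>H\<^sub>0\<^sup>1(\<Omega>)\<close> to
  \<open>L\<^sup>2(\<Omega>)\<close>, the identity in \<open>F\<^sub>2\<^sub>1\<close> is the inclusion \<open>fst\<close>.\<close>

definition F21 :: "real \<Rightarrow> real \<Rightarrow> real \<Rightarrow> real \<Rightarrow> h1r3 \<Rightarrow> l2r3" where
  "F21 \<alpha>0 \<beta>0 a b \<theta> = (- b + \<beta>0 * a / \<alpha>0) *\<^sub>R fst \<theta>"

definition F22 :: "real \<Rightarrow> real \<Rightarrow> l2r3 \<Rightarrow> l2r3" where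
  "F22 \<alpha>0 a \<eta> = (a / \<alpha>0) *\<^sub>R \<eta>"


section \<open>Operators on a subspace, semigroups, resolvent operators\<close>

definition bounded_linear_on :: "'a::real_normed_vector set \<Rightarrow> ('a \<Rightarrow> 'b::real_normed_vector) \<Rightarrow> bool" where
  "bounded_linear_on S f \<longleftrightarrow>
     (\<forall>x\<in>S. \<forall>y\<in>S. f (x + y) = f x + f y) \<and> (\<forall>c. \<forall>x\<in>S. f (c *\<^sub>R x) = c *\<^sub>R f x) \<and>
     (\<exists>K. \<forall>x\<in>S. norm (f x) \<le> K * norm x)"

text \<open>As \<^const>\<open>onorm\<close>, but for an operator on the subspace \<open>S\<close>, with norm \<open>N\<close> on its domain
  and norm \<open>N'\<close> on its codomain.\<close>

definition onorm_on :: "('a \<Rightarrow> real) \<Rightarrow> ('b \<Rightarrow> real) \<Rightarrow> 'a set \<Rightarrow> ('a \<Rightarrow> 'b) \<Rightarrow> real" where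
  "onorm_on N N' S f = (SUP x\<in>S. N' (f x) / N x)"

definition C0_semigroup :: "'x::real_normed_vector set \<Rightarrow> (real \<Rightarrow> 'x \<Rightarrow> 'x) \<Rightarrow> bool" where
  "C0_semigroup X T \<longleftrightarrow>
     (\<forall>t\<ge>0. T t ` X \<subseteq> X \<and> bounded_linear_on X (T t)) \<and>
     (\<forall>x\<in>X. T 0 x = x) \<and>
     (\<forall>s\<ge>0. \<forall>t\<ge>0. \<forall>x\<in>X. T (s + t) x = T s (T t x)) \<and>
     (\<forall>x\<in>X. continuous_on {0..} (\<lambda>t. T t x))"

definition is_generator :: "'x::real_normed_vector set \<Rightarrow> (real \<Rightarrow> 'x \<Rightarrow> 'x) \<Rightarrow> 'x set \<Rightarrow> ('x \<Rightarrow> 'x) \<Rightarrow> bool" where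
  "is_generator X T D A \<longleftrightarrow>
     D = {x \<in> X. \<exists>y\<in>X. ((\<lambda>h. (T h x - x) /\<^sub>R h) \<longlongrightarrow> y) (at_right 0)} \<and>
     (\<forall>x\<in>D. ((\<lambda>h. (T h x - x) /\<^sub>R h) \<longlongrightarrow> A x) (at_right 0))"

text \<open>The resolvent operator of \<open>u'(t) = A u(t) + \<integral>\<^sub>0\<^sup>t B(t - s) u(s) ds\<close> on \<open>X\<close>, where \<open>D\<close> is the domain of \<open>A\<close>;
  continuity into \<open>D\<close> with the graph norm means continuity both of the map and of its
  composition with \<open>A\<close>.\<close>

definition resolvent_operator :: "'x::real_normed_vector set \<Rightarrow> 'x set \<Rightarrow> ('x \<Rightarrow> 'x) \<Rightarrow>
    (real \<Rightarrow> 'x \<Rightarrow> 'x) \<Rightarrow> (real \<Rightarrow> 'x \<Rightarrow> 'x) \<Rightarrow> bool" where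
  "resolvent_operator X D A B R \<longleftrightarrow>
     (\<forall>t\<ge>0. R t ` X \<subseteq> X \<and> bounded_linear_on X (R t)) \<and>
     (\<forall>x\<in>X. R 0 x = x) \<and>
     (\<forall>x\<in>X. continuous_on {0..} (\<lambda>t. R t x)) \<and>
     (\<forall>t\<ge>0. R t ` D \<subseteq> D \<and>
        (\<exists>K. \<forall>y\<in>D. norm (R t y) + norm (A (R t y)) \<le> K * (norm y + norm (A y)))) \<and>
     (\<forall>y\<in>D. continuous_on {0..} (\<lambda>t. A (R t y)) \<and>
        (\<exists>R'. continuous_on {0..} R' \<and>
          (\<forall>t\<ge>0. ((\<lambda>s. R s y) has_vector_derivative R' t) (at t within {0..}) \<and>
             R' t = A (R t y) + integral {0..t} (\<lambda>s. B (t - s) (R s y)) \<and>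
             R' t = R t (A y) + integral {0..t} (\<lambda>s. R (t - s) (B s y)))))"


section \<open>Function spaces on the half-line and mild solutions\<close>

definition C_half_line :: "'z::real_normed_vector set \<Rightarrow> (real \<Rightarrow> 'z) set" where
  "C_half_line Z = {u. continuous_on {0..} u \<and> (\<forall>t\<ge>0. u t \<in> Z)}"

definition C0_half_line :: "'z::real_normed_vector set \<Rightarrow> (real \<Rightarrow> 'z) set" where
  "C0_half_line Z = {\<phi> \<in> C_half_line Z. ((\<lambda>t. norm (\<phi> t)) \<longlongrightarrow> 0) at_top}"

definition AA :: "'z::real_normed_vector set \<Rightarrow> (real \<Rightarrow> 'z) set" where
  "AA Z = {f. (\<forall>t. f t \<in> Z) \<and> continuous_on UNIV f \<and> bounded (range f) \<and>
     (\<forall>\<sigma>::nat \<Rightarrow> real. \<exists>r. strict_mono r \<and>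
        (\<exists>g. (\<forall>t. g t \<in> Z) \<and>
             (\<forall>t. (\<lambda>n. f (t + \<sigma> (r n))) \<longlonglongrightarrow> g t) \<and>
             (\<forall>t. (\<lambda>n. g (t - \<sigma> (r n))) \<longlonglongrightarrow> f t)))}"

definition AAA :: "'z::real_normed_vector set \<Rightarrow> (real \<Rightarrow> 'z) set" where
  "AAA Z = {u. \<exists>f\<in>AA Z. \<exists>\<phi>\<in>C0_half_line Z. \<forall>t\<ge>0. u t = f t + \<phi> t}"

text \<open>The decomposition is unique (on the relevant domains), hence so is the value \<open>r\<close>.\<close>

definition AAA_norm :: "'z::real_normed_vector set \<Rightarrow> (real \<Rightarrow> 'z) \<Rightarrow> real" where
  "AAA_norm Z u = (THE r. \<exists>f\<in>AA Z. \<exists>\<phi>\<in>C0_half_line Z.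
     (\<forall>t\<ge>0. u t = f t + \<phi> t) \<and> r = (SUP t. norm (f t)) + (SUP t\<in>{0..}. norm (\<phi> t)))"

text \<open>Lipschitz continuity on all continuous functions on \<open>[0, \<infinity>)\<close> with respect to the supremum
  norm; if \<open>u - v\<close> is unbounded, its supremum norm is infinite and nothing is required. In
  particular \<open>g u\<close> only depends on the values of \<open>u\<close> on \<open>[0, \<infinity>)\<close>.\<close>

definition sup_lipschitz_on :: "real \<Rightarrow> 'z::real_normed_vector set \<Rightarrow> ((real \<Rightarrow> 'z) \<Rightarrow> 'z) \<Rightarrow> bool" where
  "sup_lipschitz_on L Z g \<longleftrightarrow> 0 \<le> L \<and>
     (\<forall>u\<in>C_half_line Z. \<forall>v\<in>C_half_line Z. bounded ((\<lambda>t. u t - v t) ` {0..}) \<longrightarrow>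
        norm (g u - g v) \<le> L * (SUP t\<in>{0..}. norm (u t - v t)))"

definition mild_solution :: "'x::real_normed_vector set \<Rightarrow> (real \<Rightarrow> 'x \<Rightarrow> 'x) \<Rightarrow> 'x \<Rightarrow>
    ((real \<Rightarrow> 'x) \<Rightarrow> 'x) \<Rightarrow> (real \<Rightarrow> 'x \<Rightarrow> 'x) \<Rightarrow> (real \<Rightarrow> 'x) \<Rightarrow> bool" where
  "mild_solution X R u0 h f u \<longleftrightarrow> u \<in> C_half_line X \<and>
     (\<forall>t\<ge>0. u t = R t (u0 + h u) + integral {0..t} (\<lambda>s. R (t - s) (f s (u s))))"

end

theory Submission
  imports Defs "HOL-Library.Diagonal_Subsequence"
begin

text \<open>Since \<open>R\<close> decays exponentially, convolution with \<open>R\<close> preserves asymptotic almost automorphy: the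
  almost automorphic part of \<open>\<integral>\<^sub>0\<^sup>t R(t - s) u(s) ds\<close> is \<open>\<integral>\<^bsub>-\<infinity>\<^esub>\<^sup>t R(t - s) f(s) ds\<close>, where \<open>f\<close> is that of \<open>u\<close>.
  So the right-hand side \<open>\<Phi>\<close> of the mild equation acts on \<open>AAA\<close>, which is complete in the supremum norm.
  With \<open>k = \<rho> / (\<rho> + \<parallel>y\<^sub>0\<parallel>)\<close>, \<open>\<omega> = \<gamma> / q\<close> and \<open>d = \<parallel>y - z\<parallel>\<close> the Lipschitz constants give
  \<open>\<parallel>\<Phi> y (t) - \<Phi> z (t)\<parallel> \<le> k (exp (-\<omega> t) d / p + (1 - exp (-\<omega> t)) sup\<^bsub>s \<le> t\<^esub> \<parallel>y (s) - z (s)\<parallel>)\<close>, in particular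
  a Lipschitz constant \<open>k\<close> for \<open>\<Phi>\<close>. If \<open>y\<^sub>0 \<noteq> 0\<close> then \<open>k < 1\<close>, so \<open>\<Phi>\<close> has a fixed point \<open>y\<close>, and
  \<open>\<parallel>y - y\<^sub>0\<parallel> = \<parallel>\<Phi> y - \<Phi> 0\<parallel> \<le> k (\<parallel>y - y\<^sub>0\<parallel> + \<parallel>y\<^sub>0\<parallel>)\<close> says \<open>\<parallel>y - y\<^sub>0\<parallel> \<le> \<rho>\<close>. If \<open>y\<^sub>0 = 0\<close> then \<open>k = 1\<close>, but
  \<open>y\<^sub>0 = \<Phi> 0\<close> is itself a fixed point. Uniqueness holds even for \<open>k = 1\<close>: evaluating the estimate where
  \<open>\<parallel>y - z\<parallel>\<close> is maximal on \<open>[0, t]\<close> yields \<open>d \<le> d / p\<close>.\<close>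

section \<open>Completeness of the space of square-integrable functions\<close>

text \<open>The state space is a subset of a type, not a type. Integrals and uniform limits are
  therefore formed in the ambient product of copies of \<open>l2\<close>, which requires
  \<open>l2\<close> to be complete, and they stay inside because the state space is a closed linear
  subspace. Two norms are in play. The Lipschitz constants leave no room for a lost factor in the
  maximum norm \<open>state_norm\<close>, whereas limits and integrals belong to the product norm.
  Since \<open>state_norm u \<le> norm u \<le> 2 * state_norm u\<close>, the qualitative facts about
  convolution can be proved in the product norm with the constant 2 M, and only the contraction
  estimate is carried out in \<open>state_norm\<close>. In that estimate M times the Lipschitz
  constant of h is k / p, while M \<parallel>a\<parallel> times that of b is at most k \<omega>, and
  this \<omega> cancels against the integral of exp (-\<omega> s). At a maximum point r of [0, t]
  the inequality carries the factor exp (-\<omega> r) on both sides; cancelling it gives a bound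
  independent of t, so it does not matter whether the supremum over the half-line is
  attained.\<close>

lemma l2_rel_refl: "l2_rel f f \<longleftrightarrow> square_integrable f"
  by (simp add: l2_rel_def)

lemma square_integrable_rep_l2: "square_integrable (rep_l2 u)"
  using Quotient_rep_reflp[OF Quotient_l2] l2_rel_refl by blast

lemma abs_rep_l2: "abs_l2 (rep_l2 u) = u"
  by (rule Quotient_abs_rep[OF Quotient_l2])

text \<open>Moves norms into nonnegative integrals, where series and Fatou's lemma can be used
  before integrability is known.\<close>

lemma nn_integral_abs_l2:
  assumes "square_integrable f"
  shows "(\<integral>\<^sup>+x. ennreal ((f x)\<^sup>2) \<partial>lborel) = ennreal ((norm (abs_l2 f))\<^sup>2)"
proof -
  have "(norm (abs_l2 f))\<^sup>2 = inner (abs_l2 f) (abs_l2 f)"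
    by (simp add: power2_norm_eq_inner)
  also have "\<dots> = (\<integral>x. (f x)\<^sup>2 \<partial>lborel)"
    using assms by (simp add: inner_l2.abs_eq l2_rel_refl power2_eq_square)
  finally show ?thesis
    using assms by (simp add: nn_integral_eq_integral square_integrable_def)
qed

lemma diff_abs_l2:
  "square_integrable f \<Longrightarrow> square_integrable g \<Longrightarrow> abs_l2 f - abs_l2 g = abs_l2 (\<lambda>x. f x - g x)"
  by (simp add: minus_l2.abs_eq l2_rel_refl)

lemma nn_integral_rep_l2_diff:
  "(\<integral>\<^sup>+x. ennreal ((rep_l2 u x - rep_l2 v x)\<^sup>2) \<partial>lborel) = ennreal ((norm (u - v))\<^sup>2)"
proof -
  have "abs_l2 (\<lambda>x. rep_l2 u x - rep_l2 v x) = u - v"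
    by (simp flip: diff_abs_l2 add: square_integrable_rep_l2 abs_rep_l2)
  then show ?thesis
    using nn_integral_abs_l2[OF square_integrable_diff[OF square_integrable_rep_l2 square_integrable_rep_l2], of u v]
    by simp
qed

text \<open>The core of the Riesz-Fischer theorem: representatives converge almost everywhere
  because a weighted series of squared increments has finite integral, and Fatou's lemma carries the
  norm bounds to the pointwise limit.\<close>

lemma l2_geometric_Cauchy_limit:
  fixes Y :: "nat \<Rightarrow> 'a::euclidean_space l2"
  assumes Y: "\<And>m n. n \<le> m \<Longrightarrow> norm (Y m - Y n) \<le> (1/4)^n"
  shows "\<exists>u. \<forall>n. norm (u - Y n) \<le> (1/4)^n"
proof -
  define \<phi> where "\<phi> n = rep_l2 (Y n)" for n
  define d where "d n x = \<phi> (Suc n) x - \<phi> n x" for n x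
  define f where "f x = lim (\<lambda>n. \<phi> n x)" for x
  have \<phi>: "square_integrable (\<phi> n)" for n
    by (simp add: \<phi>_def square_integrable_rep_l2)
  then have meas [measurable]: "\<phi> n \<in> borel_measurable borel" for n
    by (simp add: square_integrable_def)
  have [measurable]: "d n \<in> borel_measurable borel" for n
    unfolding d_def[abs_def] by measurable
  have [measurable]: "f \<in> borel_measurable borel"
    unfolding f_def[abs_def] by (rule borel_measurable_lim_metric) simp
  have int_diff: "(\<integral>\<^sup>+x. ennreal ((\<phi> m x - \<phi> n x)\<^sup>2) \<partial>lborel) \<le> ennreal (((1/4)^n)\<^sup>2)"
    if "n \<le> m" for m n
    unfolding \<phi>_def nn_integral_rep_l2_diff using Y[OF that]
    by (intro ennreal_leI power_mono) auto
  \<comment> \<open>The weight 4^n balances two needs: the squared increments integrate to at most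
    (1/16)^n, so the weighted series still has finite integral, and 4^n d^2 < 1 still forces |d|
    below (1/2)^n.\<close>
  have "(\<integral>\<^sup>+x. (\<Sum>n. ennreal (4^n * (d n x)\<^sup>2)) \<partial>lborel)
      = (\<Sum>n. (\<integral>\<^sup>+x. ennreal (4^n * (d n x)\<^sup>2) \<partial>lborel))"
    by (rule nn_integral_suminf) measurable
  also have "\<dots> \<le> (\<Sum>n. ennreal ((1/4)^n))"
  proof (intro suminf_le)
    fix n
    have "(\<integral>\<^sup>+x. ennreal (4^n * (d n x)\<^sup>2) \<partial>lborel)
        = ennreal (4^n) * (\<integral>\<^sup>+x. ennreal ((d n x)\<^sup>2) \<partial>lborel)"
      by (subst nn_integral_cmult[symmetric]) (auto simp: ennreal_mult)
    also have "\<dots> \<le> ennreal (4^n) * ennreal (((1/4)^n)\<^sup>2)"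
      using int_diff[of n "Suc n"] by (intro mult_left_mono) (auto simp: d_def)
    also have "\<dots> = ennreal ((1/4)^n)"
      by (simp flip: ennreal_mult add: power2_eq_square power_one_over field_simps)
    finally show "(\<integral>\<^sup>+x. ennreal (4^n * (d n x)\<^sup>2) \<partial>lborel) \<le> ennreal ((1/4)^n)" .
  qed auto
  also have "\<dots> < \<infinity>"
    by (simp add: suminf_ennreal2 summable_geometric)
  finally have "AE x in lborel. (\<Sum>n. ennreal (4^n * (d n x)\<^sup>2)) \<noteq> \<infinity>"
    by (intro nn_integral_PInf_AE) auto
  then have conv: "AE x in lborel. (\<lambda>n. \<phi> n x) \<longlonglongrightarrow> f x"
  proof eventually_elim
    case (elim x)
    have "summable (\<lambda>n. 4^n * (d n x)\<^sup>2)"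
      by (rule summable_suminf_not_top) (use elim in auto)
    then have "(\<lambda>n. 4^n * (d n x)\<^sup>2) \<longlonglongrightarrow> 0"
      by (rule summable_LIMSEQ_zero)
    then have "\<forall>\<^sub>F n in sequentially. 4^n * (d n x)\<^sup>2 < 1"
      by (rule order_tendstoD) simp
    then have "\<forall>\<^sub>F n in sequentially. norm (d n x) \<le> (1/2)^n"
    proof eventually_elim
      case (elim n)
      moreover have "(2^n)\<^sup>2 = (4::real)^n"
        by (simp add: power2_eq_square flip: power_mult_distrib)
      ultimately have "(2^n * \<bar>d n x\<bar>)\<^sup>2 < 1"
        by (simp add: power_mult_distrib)
      then have "(2^n * \<bar>d n x\<bar>)\<^sup>2 \<le> 1\<^sup>2"
        by (simp only: one_power2 less_imp_le)
      then have "\<bar>d n x\<bar> * 2^n \<le> 1"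
        using power2_le_imp_le[OF _ zero_le_one] by (simp only: mult.commute)
      then have "\<bar>d n x\<bar> \<le> 1 / 2^n"
        by (simp only: pos_le_divide_eq zero_less_power zero_less_numeral)
      then show ?case
        by (simp only: power_one_over real_norm_def)
    qed
    then have "summable (\<lambda>n. d n x)"
      by (rule summable_comparison_test_ev) (simp add: summable_geometric)
    then have "convergent (\<lambda>n. \<Sum>i<n. d i x)"
      by (simp add: summable_iff_convergent)
    then have "convergent (\<lambda>n. \<phi> 0 x + (\<Sum>i<n. d i x))"
      by (intro convergent_add convergent_const)
    moreover have "\<phi> 0 x + (\<Sum>i<n. d i x) = \<phi> n x" for n
      using sum_lessThan_telescope[of "\<lambda>i. \<phi> i x" n] by (simp add: d_def)
    ultimately show ?case
      by (simp add: f_def convergent_LIMSEQ_iff)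
  qed
  have bound: "(\<integral>\<^sup>+x. ennreal ((f x - \<phi> n x)\<^sup>2) \<partial>lborel) \<le> ennreal (((1/4)^n)\<^sup>2)" for n
  proof -
    have "(\<integral>\<^sup>+x. ennreal ((f x - \<phi> n x)\<^sup>2) \<partial>lborel)
        = (\<integral>\<^sup>+x. liminf (\<lambda>m. ennreal ((\<phi> m x - \<phi> n x)\<^sup>2)) \<partial>lborel)"
    proof (rule nn_integral_cong_AE)
      show "AE x in lborel. ennreal ((f x - \<phi> n x)\<^sup>2) = liminf (\<lambda>m. ennreal ((\<phi> m x - \<phi> n x)\<^sup>2))"
        using conv
      proof eventually_elim
        case (elim x)
        have "(\<lambda>m. ennreal ((\<phi> m x - \<phi> n x)\<^sup>2)) \<longlonglongrightarrow> ennreal ((f x - \<phi> n x)\<^sup>2)"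
          using elim by (intro tendsto_ennrealI tendsto_intros)
        then show ?case
          by (rule lim_imp_Liminf[OF trivial_limit_sequentially, symmetric])
      qed
    qed
    also have "\<dots> \<le> liminf (\<lambda>m. \<integral>\<^sup>+x. ennreal ((\<phi> m x - \<phi> n x)\<^sup>2) \<partial>lborel)"
      by (rule nn_integral_liminf) measurable
    also have "\<dots> \<le> ennreal (((1/4)^n)\<^sup>2)"
    proof (rule Liminf_le)
      show "\<forall>\<^sub>F m in sequentially. (\<integral>\<^sup>+x. ennreal ((\<phi> m x - \<phi> n x)\<^sup>2) \<partial>lborel) \<le> ennreal (((1/4)^n)\<^sup>2)"
        using eventually_ge_at_top[of n] by eventually_elim (rule int_diff)
    qed simp
    finally show ?thesis .
  qed
  have sq: "square_integrable (\<lambda>x. f x - \<phi> n x)" for n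
    unfolding square_integrable_def
  proof
    show "integrable lborel (\<lambda>x. (f x - \<phi> n x)\<^sup>2)"
    proof (rule integrableI_nonneg)
      show "(\<integral>\<^sup>+x. ennreal ((f x - \<phi> n x)\<^sup>2) \<partial>lborel) < \<infinity>"
        using bound[of n] by (rule le_less_trans) simp
    qed auto
  qed measurable
  \<comment> \<open>Fatou's lemma controls only differences from the limit, so f is recovered from
    one of them.\<close>
  have "square_integrable (\<lambda>x. (f x - \<phi> 0 x) + \<phi> 0 x)"
    by (rule square_integrable_add[OF sq \<phi>])
  then have f: "square_integrable f" by simp
  have "norm (abs_l2 f - Y n) \<le> (1/4)^n" for n
  proof -
    have "abs_l2 f - Y n = abs_l2 (\<lambda>x. f x - \<phi> n x)"
      using diff_abs_l2[OF f \<phi>[of n]] by (simp add: \<phi>_def abs_rep_l2)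
    then have "ennreal ((norm (abs_l2 f - Y n))\<^sup>2) \<le> ennreal (((1/4)^n)\<^sup>2)"
      using bound[of n] nn_integral_abs_l2[OF sq[of n]] by simp
    then have "(norm (abs_l2 f - Y n))\<^sup>2 \<le> ((1/4)^n)\<^sup>2"
      by (simp add: ennreal_le_iff)
    then show ?thesis
      by (rule power2_le_imp_le) simp
  qed
  then show ?thesis by blast
qed

instance l2 :: (euclidean_space) banach
proof
  fix X :: "nat \<Rightarrow> 'a l2"
  assume X: "Cauchy X"
  have "\<forall>n. \<exists>N. \<forall>k\<ge>N. \<forall>m\<ge>N. norm (X k - X m) < (1/4)^n"
    using CauchyD[OF X] by simp
  then obtain N where N: "\<And>n k m. k \<ge> N n \<Longrightarrow> m \<ge> N n \<Longrightarrow> norm (X k - X m) < (1/4)^n"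
    by metis
  \<comment> \<open>N need not be monotone; its partial sums dominate \<open>N n\<close> at every
    index from n on.\<close>
  define r where "r n = (\<Sum>i\<le>n. N i)" for n
  have rN: "N n \<le> r m" if "n \<le> m" for n m
    unfolding r_def using that by (intro member_le_sum) auto
  have "\<exists>u. \<forall>n. norm (u - X (r n)) \<le> (1/4)^n"
    by (rule l2_geometric_Cauchy_limit) (auto intro!: less_imp_le[OF N] rN)
  then obtain u where u: "\<And>n. norm (u - X (r n)) \<le> (1/4)^n" by blast
  have "X \<longlonglongrightarrow> u"
  proof (rule LIMSEQ_I)
    fix e :: real assume "e > 0"
    have "(\<lambda>n. (1/4::real)^n) \<longlonglongrightarrow> 0" by (rule LIMSEQ_power_zero) simp
    then have "\<forall>\<^sub>F n in sequentially. (1/4::real)^n < e/2"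
      using \<open>e > 0\<close> by (intro order_tendstoD) auto
    then obtain n where n: "(1/4::real)^n < e/2"
      by (auto simp: eventually_sequentially)
    have "norm (X m - u) < e" if "m \<ge> r n" for m
    proof -
      have "norm (X m - X (r n)) < (1/4)^n"
        using that rN[of n n] by (intro N) auto
      moreover have "norm (X m - u) \<le> norm (X m - X (r n)) + norm (u - X (r n))"
        using norm_triangle_ineq[of "X m - X (r n)" "X (r n) - u"] by (simp add: norm_minus_commute)
      ultimately show ?thesis using u[of n] n by linarith
    qed
    then show "\<exists>no. \<forall>m\<ge>no. norm (X m - u) < e" by blast
  qed
  then show "convergent X" by (rule convergentI)
qed

section \<open>Closed subspaces\<close>

lemma L2_iff: "u \<in> L2 \<Omega> \<longleftrightarrow> (AE x in lborel. x \<notin> \<Omega> \<longrightarrow> rep_l2 u x = 0)"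
  by (simp add: L2_def vanishes_outside.rep_eq)

lemma abs_l2_in_L2_iff:
  "square_integrable f \<Longrightarrow> abs_l2 f \<in> L2 \<Omega> \<longleftrightarrow> (AE x in lborel. x \<notin> \<Omega> \<longrightarrow> f x = 0)"
  by (simp add: L2_def vanishes_outside.abs_eq l2_rel_refl)

lemma subspace_L2: "subspace (L2 \<Omega>)"
proof (rule subspaceI)
  show "0 \<in> L2 \<Omega>"
    unfolding zero_l2_def by (subst abs_l2_in_L2_iff) (auto simp: square_integrable_def)
next
  fix u v assume "u \<in> L2 \<Omega>" "v \<in> L2 \<Omega>"
  then have "AE x in lborel. x \<notin> \<Omega> \<longrightarrow> rep_l2 u x + rep_l2 v x = 0"
    unfolding L2_iff by eventually_elim simp
  then have "abs_l2 (\<lambda>x. rep_l2 u x + rep_l2 v x) \<in> L2 \<Omega>"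
    by (simp add: abs_l2_in_L2_iff square_integrable_add square_integrable_rep_l2)
  moreover have "abs_l2 (\<lambda>x. rep_l2 u x + rep_l2 v x) = u + v"
    by (simp add: l2_rel_refl square_integrable_rep_l2 abs_rep_l2 flip: plus_l2.abs_eq)
  ultimately show "u + v \<in> L2 \<Omega>" by simp
next
  fix c :: real and u assume "u \<in> L2 \<Omega>"
  then have "AE x in lborel. x \<notin> \<Omega> \<longrightarrow> c * rep_l2 u x = 0"
    unfolding L2_iff by eventually_elim simp
  then have "abs_l2 (\<lambda>x. c * rep_l2 u x) \<in> L2 \<Omega>"
    by (simp add: abs_l2_in_L2_iff square_integrable_scale square_integrable_rep_l2)
  moreover have "abs_l2 (\<lambda>x. c * rep_l2 u x) = c *\<^sub>R u"
    by (simp add: l2_rel_refl square_integrable_rep_l2 abs_rep_l2 flip: scaleR_l2.abs_eq)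
  ultimately show "c *\<^sub>R u \<in> L2 \<Omega>" by simp
qed

text \<open>Exhibits \<open>L2 \<Omega>\<close> as an intersection of kernels of continuous
  functionals, hence closed. For the harder inclusion u is tested against its own restriction to the
  complement of \<Omega>, which makes the inner product the integral of a square; measurability of
  \<Omega> keeps that restriction in the space.\<close>

lemma L2_eq_orthogonal_complement:
  assumes "\<Omega> \<in> sets borel"
  shows "L2 \<Omega> = {u. \<forall>v\<in>L2 (- \<Omega>). inner u v = 0}"
proof (intro equalityI subsetI CollectI ballI)
  fix u v assume u: "u \<in> L2 \<Omega>" and v: "v \<in> L2 (- \<Omega>)"
  have "AE x in lborel. rep_l2 u x * rep_l2 v x = 0"
    using u v unfolding L2_iff by eventually_elim auto
  then show "inner u v = 0"
    unfolding inner_l2.rep_eq by (rule integral_eq_zero_AE)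
next
  fix u assume "u \<in> {u. \<forall>v\<in>L2 (- \<Omega>). inner u v = 0}"
  then have u: "\<And>v. v \<in> L2 (- \<Omega>) \<Longrightarrow> inner u v = 0" by blast
  define g where "g x = indicator (- \<Omega>) x * rep_l2 u x" for x
  have rep: "square_integrable (rep_l2 u)" by (rule square_integrable_rep_l2)
  then have [measurable]: "rep_l2 u \<in> borel_measurable borel" by (simp add: square_integrable_def)
  have [measurable]: "\<Omega> \<in> sets borel" by fact
  have g: "square_integrable g"
    unfolding square_integrable_def
  proof
    show "integrable lborel (\<lambda>x. (g x)\<^sup>2)"
    proof (rule Bochner_Integration.integrable_bound)
      show "integrable lborel (\<lambda>x. (rep_l2 u x)\<^sup>2)" using rep by (simp add: square_integrable_def)
    qed (auto simp: g_def indicator_def)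
  qed (simp add: g_def[abs_def])
  have "abs_l2 g \<in> L2 (- \<Omega>)"
    by (subst abs_l2_in_L2_iff[OF g]) (simp add: g_def)
  then have "inner u (abs_l2 g) = 0" by (rule u)
  then have "(\<integral>x. rep_l2 u x * g x \<partial>lborel) = 0"
    using inner_l2.abs_eq[of "rep_l2 u" g] rep g by (simp add: l2_rel_refl abs_rep_l2)
  then have "AE x in lborel. rep_l2 u x * g x = 0"
    using integral_nonneg_eq_0_iff_AE[OF square_integrable_mult[OF rep g]]
    by (simp add: g_def indicator_def)
  then have "AE x in lborel. x \<notin> \<Omega> \<longrightarrow> rep_l2 u x = 0"
    by eventually_elim (auto simp: g_def)
  then show "u \<in> L2 \<Omega>" by (simp add: L2_iff)
qed

lemma closed_L2:
  assumes "\<Omega> \<in> sets borel"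
  shows "closed (L2 \<Omega>)"
proof -
  have "L2 \<Omega> = (\<Inter>v\<in>L2 (- \<Omega>). {u. inner u v = 0})"
    unfolding L2_eq_orthogonal_complement[OF assms] by blast
  moreover have "closed {u. inner u v = 0}" for v :: "'a l2"
    by (intro closed_Collect_eq continuous_intros)
  ultimately show ?thesis by auto
qed

section \<open>Smooth functions, test functions and the linear structure of
  \<open>H01\<close>\<close>

lemma frechet_derivative_add:
  assumes "f differentiable (at x)" "g differentiable (at x)"
  shows "frechet_derivative (\<lambda>x. f x + g x) (at x) = (\<lambda>v. frechet_derivative f (at x) v + frechet_derivative g (at x) v)"
  using assms by (intro frechet_derivative_at[symmetric] has_derivative_add) (simp_all flip: frechet_derivative_works)

lemma frechet_derivative_cmult:
  fixes f :: "'a::real_normed_vector \<Rightarrow> real"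
  assumes "f differentiable (at x)"
  shows "frechet_derivative (\<lambda>x. c * f x) (at x) = (\<lambda>v. c * frechet_derivative f (at x) v)"
  using assms by (intro frechet_derivative_at[symmetric] has_derivative_mult_right) (simp_all flip: frechet_derivative_works)

lemma Ck_add: "Ck k f \<Longrightarrow> Ck k g \<Longrightarrow> Ck k (\<lambda>x. f x + g x)"
  by (induction k arbitrary: f g) (auto simp: frechet_derivative_add intro: continuous_on_add)

lemma Ck_cmult: "Ck k f \<Longrightarrow> Ck k (\<lambda>x. c * f x)"
  by (induction k arbitrary: f) (auto simp: frechet_derivative_cmult intro: continuous_on_mult_left)

lemma smooth_differentiable: "smooth f \<Longrightarrow> f differentiable (at x)"
  unfolding smooth_def using Ck.simps(2)[of 0 f] by blast

lemma smooth_continuous_frechet_derivative: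
  "smooth f \<Longrightarrow> continuous_on UNIV (\<lambda>x. frechet_derivative f (at x) v)"
  unfolding smooth_def using Ck.simps(2)[of 0 f] by auto

lemma smooth_continuous: "smooth f \<Longrightarrow> continuous_on UNIV f"
  unfolding smooth_def using Ck.simps(1)[of f] by blast

lemma square_integrable_compact_support:
  fixes f :: "'a::euclidean_space \<Rightarrow> real"
  assumes "continuous_on UNIV f" "compact K" "\<And>x. x \<notin> K \<Longrightarrow> f x = 0"
  shows "square_integrable f"
  unfolding square_integrable_def
proof
  show "f \<in> borel_measurable lborel"
    using assms(1) by (simp add: borel_measurable_continuous_onI)
  have "integrable lborel (\<lambda>x. indicator K x *\<^sub>R (f x)\<^sup>2)"
    using assms by (intro borel_integrable_compact continuous_intros) (auto intro: continuous_on_subset)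
  moreover have "(\<lambda>x. indicator K x *\<^sub>R (f x)\<^sup>2) = (\<lambda>x. (f x)\<^sup>2)"
    using assms(3) by (force simp: fun_eq_iff indicator_def)
  ultimately show "integrable lborel (\<lambda>x. (f x)\<^sup>2)" by simp
qed

text \<open>The complement of the closed support is open, so f vanishes in a whole neighbourhood of
  x.\<close>

lemma frechet_derivative_outside_support:
  fixes f :: "'a::real_normed_vector \<Rightarrow> real"
  assumes "x \<notin> closure {x. f x \<noteq> 0}"
  shows "frechet_derivative f (at x) = (\<lambda>_. 0)"
proof -
  have "(f has_derivative (\<lambda>_. 0)) (at x)"
  proof (rule has_derivative_transform_within_open)
    show "((\<lambda>_. 0) has_derivative (\<lambda>_. 0)) (at x)" by simp
    show "open (- closure {x. f x \<noteq> 0})" by blast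
    show "0 = f y" if "y \<in> - closure {x. f x \<noteq> 0}" for y
      using that closure_subset[of "{x. f x \<noteq> 0}"] by auto
  qed (use assms in auto)
  then show ?thesis by (rule frechet_derivative_at[symmetric])
qed

text \<open>\<open>abs_l2\<close> commutes with the vector operations only on square-integrable
  functions; this licenses computing with representatives in \<open>H01\<close>.\<close>

lemma test_functions_square_integrable:
  assumes "\<phi> \<in> test_functions \<Omega>"
  shows "square_integrable \<phi>" "square_integrable (partial_deriv i \<phi>)"
proof -
  have \<phi>: "smooth \<phi>" "compact (closure {x. \<phi> x \<noteq> 0})"
    using assms by (auto simp: test_functions_def)
  show "square_integrable \<phi>"
    using smooth_continuous[OF \<phi>(1)] \<phi>(2)
    by (rule square_integrable_compact_support) (use closure_subset[of "{x. \<phi> x \<noteq> 0}"] in auto)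
  have "continuous_on UNIV (partial_deriv i \<phi>)"
    unfolding partial_deriv_def[abs_def] by (rule smooth_continuous_frechet_derivative[OF \<phi>(1)])
  then show "square_integrable (partial_deriv i \<phi>)"
    using \<phi>(2) by (rule square_integrable_compact_support)
      (simp add: partial_deriv_def frechet_derivative_outside_support)
qed

lemma test_functions_add:
  assumes "\<phi> \<in> test_functions \<Omega>" "\<psi> \<in> test_functions \<Omega>"
  shows "(\<lambda>x. \<phi> x + \<psi> x) \<in> test_functions \<Omega>"
proof -
  have "{x. \<phi> x + \<psi> x \<noteq> 0} \<subseteq> {x. \<phi> x \<noteq> 0} \<union> {x. \<psi> x \<noteq> 0}" by auto
  then have sub: "closure {x. \<phi> x + \<psi> x \<noteq> 0} \<subseteq> closure {x. \<phi> x \<noteq> 0} \<union> closure {x. \<psi> x \<noteq> 0}"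
    using closure_mono[of _ "{x. \<phi> x \<noteq> 0} \<union> {x. \<psi> x \<noteq> 0}"] by (simp only: closure_Un)
  have "bounded (closure {x. \<phi> x \<noteq> 0} \<union> closure {x. \<psi> x \<noteq> 0})"
    using assms by (auto simp: test_functions_def compact_imp_bounded)
  then have "compact (closure {x. \<phi> x + \<psi> x \<noteq> 0})"
    using bounded_subset[OF _ sub] by (auto simp: compact_eq_bounded_closed)
  then show ?thesis
    using assms sub by (auto simp: test_functions_def smooth_def Ck_add)
qed

lemma zero_test_functions: "(\<lambda>_. 0) \<in> test_functions \<Omega>"
proof -
  have "Ck k (\<lambda>_::real^'a. 0)" for k
    by (induction k) auto
  then show ?thesis by (auto simp: test_functions_def smooth_def)
qed

lemma test_functions_cmult:
  assumes "\<phi> \<in> test_functions \<Omega>"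
  shows "(\<lambda>x. c * \<phi> x) \<in> test_functions \<Omega>"
\<comment> \<open>For nonzero c both functions have the same support; for c = 0 the support
  collapses to the empty set.\<close>
proof (cases "c = 0")
  case True
  then show ?thesis by (simp add: zero_test_functions)
next
  case False
  then show ?thesis
    using assms by (auto simp: test_functions_def smooth_def Ck_cmult)
qed

lemma subspace_closure:
  fixes S :: "'a::real_normed_vector set"
  assumes "subspace S"
  shows "subspace (closure S)"
proof (rule subspaceI)
  show "0 \<in> closure S"
    using subspace_0[OF assms] closure_subset by blast
next
  fix x y assume "x \<in> closure S" "y \<in> closure S"
  then obtain f g where "\<And>n::nat. f n \<in> S" "f \<longlonglongrightarrow> x" "\<And>n::nat. g n \<in> S" "g \<longlonglongrightarrow> y"
    unfolding closure_sequential by blast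
  then show "x + y \<in> closure S"
    unfolding closure_sequential using subspace_add[OF assms]
    by (intro exI[of _ "\<lambda>n. f n + g n"]) (auto intro: tendsto_add)
next
  fix c x assume "x \<in> closure S"
  then obtain f where "\<And>n::nat. f n \<in> S" "f \<longlonglongrightarrow> x"
    unfolding closure_sequential by blast
  then show "c *\<^sub>R x \<in> closure S"
    unfolding closure_sequential using subspace_scale[OF assms]
    by (intro exI[of _ "\<lambda>n. c *\<^sub>R f n"]) (auto intro: tendsto_scaleR)
qed

text \<open>Taking the pair of a test function and its gradient is linear on test functions, so the
  set being closed up is already a subspace.\<close>

lemma subspace_H01: "subspace (H01 \<Omega>)"
  unfolding H01_def
proof (rule subspace_closure)
  let ?J = "\<lambda>\<phi>. (abs_l2 \<phi>, \<chi> i. abs_l2 (partial_deriv i \<phi>)) :: h1r3"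
  have add: "?J (\<lambda>x. \<phi> x + \<psi> x) = ?J \<phi> + ?J \<psi>"
    if "\<phi> \<in> test_functions \<Omega>" "\<psi> \<in> test_functions \<Omega>" for \<phi> \<psi>
  proof -
    have "partial_deriv i (\<lambda>x. \<phi> x + \<psi> x) = (\<lambda>x. partial_deriv i \<phi> x + partial_deriv i \<psi> x)" for i
      using that by (auto simp: partial_deriv_def fun_eq_iff frechet_derivative_add smooth_differentiable test_functions_def)
    then show ?thesis
      using that by (auto simp: vec_eq_iff plus_l2.abs_eq l2_rel_refl test_functions_square_integrable)
  qed
  have scale: "?J (\<lambda>x. c * \<phi> x) = c *\<^sub>R ?J \<phi>" if "\<phi> \<in> test_functions \<Omega>" for c \<phi>
  proof -
    have "partial_deriv i (\<lambda>x. c * \<phi> x) = (\<lambda>x. c * partial_deriv i \<phi> x)" for i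
      using that by (auto simp: partial_deriv_def fun_eq_iff frechet_derivative_cmult smooth_differentiable test_functions_def)
    then show ?thesis
      using that by (auto simp: vec_eq_iff scaleR_l2.abs_eq l2_rel_refl test_functions_square_integrable)
  qed
  have "subspace (?J ` test_functions \<Omega>)"
  proof (rule subspaceI)
    \<comment> \<open>Homogeneity at the scalar 0 spares a computation of the gradient of the zero
      function.\<close>
    have "0 = 0 *\<^sub>R ?J (\<lambda>_. 0)" by (simp add: zero_prod_def)
    also have "\<dots> = ?J (\<lambda>_. 0)" using scale[OF zero_test_functions, of 0] by simp
    also have "\<dots> \<in> ?J ` test_functions \<Omega>" by (rule imageI[OF zero_test_functions])
    finally show "0 \<in> ?J ` test_functions \<Omega>" .
  next
    fix u v assume "u \<in> ?J ` test_functions \<Omega>" "v \<in> ?J ` test_functions \<Omega>"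
    then obtain \<phi> \<psi> where uv: "u = ?J \<phi>" "v = ?J \<psi>" and "\<phi> \<in> test_functions \<Omega>" "\<psi> \<in> test_functions \<Omega>"
      by (elim imageE)
    then show "u + v \<in> ?J ` test_functions \<Omega>"
      unfolding uv by (subst add[symmetric]) (auto intro: imageI test_functions_add)
  next
    fix c :: real and u assume "u \<in> ?J ` test_functions \<Omega>"
    then obtain \<phi> where u: "u = ?J \<phi>" and "\<phi> \<in> test_functions \<Omega>"
      by (elim imageE)
    then show "c *\<^sub>R u \<in> ?J ` test_functions \<Omega>"
      unfolding u by (subst scale[symmetric]) (auto intro: imageI test_functions_cmult)
  qed
  then show "subspace {?J \<phi> | \<phi>. \<phi> \<in> test_functions \<Omega>}"
    by (simp only: Setcompr_eq_image)
qed

lemma closed_H01: "closed (H01 \<Omega>)"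
  by (simp add: H01_def)

lemma subspace_state_space: "subspace (state_space \<Omega>)"
  unfolding state_space_def by (intro subspace_Times subspace_H01 subspace_L2)

lemma closed_state_space: "open \<Omega> \<Longrightarrow> closed (state_space \<Omega>)"
  unfolding state_space_def by (intro closed_Times closed_H01 closed_L2) simp

section \<open>Asymptotically almost automorphic functions\<close>

text \<open>A compromise between two classes. Continuity is too weak, as F (f + \<phi>) - F f must
  vanish at infinity along values of f that need not lie in a compact set given in advance. A global
  Lipschitz condition is too strong, as it excludes products such as a b(\<theta>).\<close>

definition locally_lipschitz :: "'a::real_normed_vector set \<Rightarrow> ('a \<Rightarrow> 'b::real_normed_vector) \<Rightarrow> bool" where
  "locally_lipschitz Z F \<longleftrightarrow> (\<forall>r. \<exists>L. L-lipschitz_on (Z \<inter> cball 0 r) F)"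

lemma locally_lipschitzE:
  assumes "locally_lipschitz Z F"
  obtains L where "L \<ge> 0" "\<And>x y. x \<in> Z \<Longrightarrow> y \<in> Z \<Longrightarrow> norm x \<le> r \<Longrightarrow> norm y \<le> r \<Longrightarrow>
    norm (F x - F y) \<le> L * norm (x - y)"
proof -
  obtain L where L: "L-lipschitz_on (Z \<inter> cball 0 r) F"
    using assms unfolding locally_lipschitz_def by blast
  then show thesis
    by (intro that[of L] lipschitz_on_normD[OF L] lipschitz_on_nonneg[OF L]) auto
qed

lemma locally_lipschitzI:
  assumes "\<And>r. \<exists>L\<ge>0. \<forall>x\<in>Z. \<forall>y\<in>Z. norm x \<le> r \<longrightarrow> norm y \<le> r \<longrightarrow> norm (F x - F y) \<le> L * norm (x - y)"
  shows "locally_lipschitz Z F"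
  unfolding locally_lipschitz_def
proof
  fix r
  obtain L where "L \<ge> 0"
    "\<And>x y. x \<in> Z \<Longrightarrow> y \<in> Z \<Longrightarrow> norm x \<le> r \<Longrightarrow> norm y \<le> r \<Longrightarrow> norm (F x - F y) \<le> L * norm (x - y)"
    using assms[of r] by blast
  then show "\<exists>L. L-lipschitz_on (Z \<inter> cball 0 r) F"
    by (intro exI[of _ L] lipschitz_onI) (auto simp: dist_norm)
qed

text \<open>Lets sums and differences be treated as compositions of a pair with a linear
  map.\<close>

lemma bounded_linear_locally_lipschitz:
  assumes "bounded_linear F"
  shows "locally_lipschitz Z F"
proof (rule locally_lipschitzI)
  obtain K where "K > 0" "\<And>x. norm (F x) \<le> norm x * K"
    using bounded_linear.pos_bounded[OF assms] by blast
  then show "\<exists>L\<ge>0. \<forall>x\<in>Z. \<forall>y\<in>Z. norm x \<le> r \<longrightarrow> norm y \<le> r \<longrightarrow> norm (F x - F y) \<le> L * norm (x - y)" for r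
    by (intro exI[of _ K]) (auto simp: mult.commute simp flip: linear_diff[OF bounded_linear.linear[OF assms]])
qed

lemma locally_lipschitz_continuous_on:
  assumes "locally_lipschitz Z F"
  shows "continuous_on Z F"
  unfolding continuous_on_iff
proof (intro ballI allI impI)
  fix x and e :: real assume "x \<in> Z" "e > 0"
  obtain L where L: "L \<ge> 0" "\<And>x' y. x' \<in> Z \<Longrightarrow> y \<in> Z \<Longrightarrow> norm x' \<le> norm x + 1 \<Longrightarrow> norm y \<le> norm x + 1 \<Longrightarrow>
    norm (F x' - F y) \<le> L * norm (x' - y)"
    using locally_lipschitzE[OF assms] by metis
  have "dist (F y) (F x) < e" if "y \<in> Z" "dist y x < min 1 (e / (L + 1))" for y
  proof -
    have "norm y \<le> norm x + 1"
      using that(2) norm_triangle_sub[of y x] by (simp add: dist_norm)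
    then have "dist (F y) (F x) \<le> L * dist y x"
      using L(2)[OF that(1) \<open>x \<in> Z\<close>] by (simp add: dist_norm)
    also have "\<dots> \<le> (L + 1) * dist y x" by (simp add: algebra_simps)
    also have "\<dots> < e" using that(2) L(1) by (simp add: field_simps)
    finally show ?thesis .
  qed
  then show "\<exists>d>0. \<forall>x'\<in>Z. dist x' x < d \<longrightarrow> dist (F x') (F x) < e"
    using \<open>e > 0\<close> L(1) by (intro exI[of _ "min 1 (e / (L + 1))"]) auto
qed

lemma locally_lipschitz_bounded:
  assumes F: "locally_lipschitz Z F" and B: "B \<subseteq> Z" "bounded B"
  shows "bounded (F ` B)"
proof (cases "B = {}")
  case False
  then obtain x where x: "x \<in> B" by blast
  obtain r where r: "\<And>x. x \<in> B \<Longrightarrow> norm x \<le> r"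
    using B(2) unfolding bounded_iff by blast
  obtain L where L: "L \<ge> 0" "\<And>x' y. x' \<in> Z \<Longrightarrow> y \<in> Z \<Longrightarrow> norm x' \<le> r \<Longrightarrow> norm y \<le> r \<Longrightarrow>
    norm (F x' - F y) \<le> L * norm (x' - y)"
    using locally_lipschitzE[OF F] by metis
  have "norm (F y) \<le> norm (F x) + L * (r + r)" if "y \<in> B" for y
  proof -
    have "norm (F y) \<le> norm (F x) + norm (F y - F x)" by (rule norm_triangle_sub)
    also have "norm (F y - F x) \<le> L * norm (y - x)" using that x B(1) r by (intro L(2)) auto
    also have "norm (y - x) \<le> r + r"
      using norm_triangle_ineq4[of y x] r[OF that] r[OF x] by linarith
    finally show ?thesis using L(1) by (simp add: mult_left_mono)
  qed
  then show ?thesis unfolding bounded_iff by blast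
qed simp

section \<open>Almost automorphic functions and functions vanishing at infinity\<close>

lemma C_half_lineD: "u \<in> C_half_line Z \<Longrightarrow> continuous_on {0..} u" "u \<in> C_half_line Z \<Longrightarrow> t \<ge> 0 \<Longrightarrow> u t \<in> Z"
  by (auto simp: C_half_line_def)

lemma C0_half_lineD:
  assumes "\<phi> \<in> C0_half_line Z"
  shows "continuous_on {0..} \<phi>" "t \<ge> 0 \<Longrightarrow> \<phi> t \<in> Z" "(\<phi> \<longlongrightarrow> 0) at_top"
  using assms by (auto simp: C_half_line_def C0_half_line_def tendsto_norm_zero_iff)

lemma C0_half_lineI:
  assumes "continuous_on {0..} \<phi>" "\<And>t. t \<ge> 0 \<Longrightarrow> \<phi> t \<in> Z" "(\<phi> \<longlongrightarrow> 0) at_top"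
  shows "\<phi> \<in> C0_half_line Z"
  using assms by (auto simp: C_half_line_def C0_half_line_def tendsto_norm_zero_iff)

lemma C0_half_line_bounded:
  assumes "\<phi> \<in> C0_half_line Z"
  shows "bounded (\<phi> ` {0..})"
proof -
  have "\<forall>\<^sub>F t in at_top. norm (\<phi> t) < 1"
    using order_tendstoD(2)[OF tendsto_norm_zero[OF C0_half_lineD(3)[OF assms]], of 1] by simp
  then obtain N where N: "\<And>t. t \<ge> N \<Longrightarrow> norm (\<phi> t) < 1"
    by (auto simp: eventually_at_top_linorder)
  have "compact (\<phi> ` {0..N})"
    using C0_half_lineD(1)[OF assms] by (intro compact_continuous_image) (auto intro: continuous_on_subset)
  then obtain c where c: "\<And>t. t \<in> {0..N} \<Longrightarrow> norm (\<phi> t) \<le> c"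
    using compact_imp_bounded[of "\<phi> ` {0..N}"] unfolding bounded_iff by (metis imageI)
  have "norm (\<phi> t) \<le> max 1 c" if "t \<ge> 0" for t
    using N[of t] c[of t] that by (cases "t \<ge> N") auto
  then show ?thesis unfolding bounded_iff by auto
qed

lemma AAD:
  assumes "f \<in> AA Z"
  shows "f t \<in> Z" "continuous_on UNIV f" "bounded (range f)"
  using assms by (auto simp: AA_def)

lemma AA_subseqE:
  fixes \<sigma> :: "nat \<Rightarrow> real"
  assumes "f \<in> AA Z"
  obtains r g where "strict_mono r" "\<And>t. g t \<in> Z" "\<And>t. (\<lambda>n. f (t + \<sigma> (r n))) \<longlonglongrightarrow> g t"
    "\<And>t. (\<lambda>n. g (t - \<sigma> (r n))) \<longlonglongrightarrow> f t"
proof -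
  have "\<exists>r. strict_mono r \<and> (\<exists>g. (\<forall>t. g t \<in> Z) \<and> (\<forall>t. (\<lambda>n. f (t + \<sigma> (r n))) \<longlonglongrightarrow> g t) \<and>
             (\<forall>t. (\<lambda>n. g (t - \<sigma> (r n))) \<longlonglongrightarrow> f t))"
    using assms by (simp add: AA_def)
  then show thesis using that by blast
qed

lemma AAI:
  assumes "\<And>t. f t \<in> Z" "continuous_on UNIV f" "bounded (range f)"
    "\<And>\<sigma>::nat \<Rightarrow> real. \<exists>r g. strict_mono r \<and> (\<forall>t. g t \<in> Z) \<and> (\<forall>t. (\<lambda>n. f (t + \<sigma> (r n))) \<longlonglongrightarrow> g t) \<and>
             (\<forall>t. (\<lambda>n. g (t - \<sigma> (r n))) \<longlonglongrightarrow> f t)"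
  shows "f \<in> AA Z"
  unfolding AA_def using assms by simp

text \<open>The subsequence chosen for f also serves F composed with f. Both limits pass through F
  because the limit function takes its values in Z as well, where F is continuous.\<close>

lemma AA_compose:
  assumes f: "f \<in> AA Z" and F: "locally_lipschitz Z F" "F ` Z \<subseteq> W"
  shows "(\<lambda>t. F (f t)) \<in> AA W"
proof (rule AAI)
  have cont: "continuous_on Z F" by (rule locally_lipschitz_continuous_on[OF F(1)])
  show "F (f t) \<in> W" for t using AAD(1)[OF f] F(2) by blast
  show "continuous_on UNIV (\<lambda>t. F (f t))"
    by (rule continuous_on_compose2[OF cont AAD(2)[OF f]]) (use AAD(1)[OF f] in auto)
  have "bounded (F ` range f)"
    by (rule locally_lipschitz_bounded[OF F(1) _ AAD(3)[OF f]]) (use AAD(1)[OF f] in auto)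
  then show "bounded (range (\<lambda>t. F (f t)))" by (simp add: image_image)
  fix \<sigma> :: "nat \<Rightarrow> real"
  obtain r g where r: "strict_mono r" and g: "\<And>t. g t \<in> Z"
    and lim: "\<And>t. (\<lambda>n. f (t + \<sigma> (r n))) \<longlonglongrightarrow> g t" "\<And>t. (\<lambda>n. g (t - \<sigma> (r n))) \<longlonglongrightarrow> f t"
    using AA_subseqE[OF f] by metis
  have "(\<lambda>n. F (f (t + \<sigma> (r n)))) \<longlonglongrightarrow> F (g t)" for t
    by (rule continuous_on_tendsto_compose[OF cont lim(1) g]) (simp add: AAD(1)[OF f])
  moreover have "(\<lambda>n. F (g (t - \<sigma> (r n)))) \<longlonglongrightarrow> F (f t)" for t
    by (rule continuous_on_tendsto_compose[OF cont lim(2) AAD(1)[OF f]]) (simp add: g)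
  moreover have "F (g t) \<in> W" for t using g F(2) by blast
  ultimately show "\<exists>r g. strict_mono r \<and> (\<forall>t. g t \<in> W) \<and> (\<forall>t. (\<lambda>n. F (f (t + \<sigma> (r n)))) \<longlonglongrightarrow> g t) \<and>
             (\<forall>t. (\<lambda>n. g (t - \<sigma> (r n))) \<longlonglongrightarrow> F (f t))"
    using r by (intro exI[of _ r] exI[of _ "\<lambda>t. F (g t)"]) simp
qed

text \<open>A common subsequence arises by thinning twice: the one for g is extracted from the one
  for f, whose limits survive.\<close>

lemma AA_Pair:
  assumes f: "f \<in> AA Z" and g: "g \<in> AA W"
  shows "(\<lambda>t. (f t, g t)) \<in> AA (Z \<times> W)"
proof (rule AAI)
  show "(f t, g t) \<in> Z \<times> W" for t using AAD(1)[OF f] AAD(1)[OF g] by blast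
  show "continuous_on UNIV (\<lambda>t. (f t, g t))" using AAD(2)[OF f] AAD(2)[OF g] by (rule continuous_on_Pair)
  have "bounded (range f \<times> range g)" using AAD(3)[OF f] AAD(3)[OF g] by (rule bounded_Times)
  then show "bounded (range (\<lambda>t. (f t, g t)))" by (rule bounded_subset) auto
  fix \<sigma> :: "nat \<Rightarrow> real"
  obtain r f' where r: "strict_mono r" and f': "\<And>t. f' t \<in> Z"
    and lim: "\<And>t. (\<lambda>n. f (t + \<sigma> (r n))) \<longlonglongrightarrow> f' t" "\<And>t. (\<lambda>n. f' (t - \<sigma> (r n))) \<longlonglongrightarrow> f t"
    using AA_subseqE[OF f] by metis
  obtain s g' where s: "strict_mono s" and g': "\<And>t. g' t \<in> W"
    and lim': "\<And>t. (\<lambda>n. g (t + (\<sigma> \<circ> r) (s n))) \<longlonglongrightarrow> g' t" "\<And>t. (\<lambda>n. g' (t - (\<sigma> \<circ> r) (s n))) \<longlonglongrightarrow> g t"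
    using AA_subseqE[OF g] by metis
  have "(\<lambda>n. f (t + (\<sigma> \<circ> r) (s n))) \<longlonglongrightarrow> f' t" "(\<lambda>n. f' (t - (\<sigma> \<circ> r) (s n))) \<longlonglongrightarrow> f t" for t
    using LIMSEQ_subseq_LIMSEQ[OF lim(1) s, of t] LIMSEQ_subseq_LIMSEQ[OF lim(2) s, of t]
    by (simp_all add: o_def)
  then show "\<exists>r h. strict_mono r \<and> (\<forall>t. h t \<in> Z \<times> W) \<and> (\<forall>t. (\<lambda>n. (f (t + \<sigma> (r n)), g (t + \<sigma> (r n)))) \<longlonglongrightarrow> h t) \<and>
             (\<forall>t. (\<lambda>n. h (t - \<sigma> (r n))) \<longlonglongrightarrow> (f t, g t))"
    using strict_mono_o[OF r s] f' g' lim'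
    by (intro exI[of _ "r \<circ> s"] exI[of _ "\<lambda>t. (f' t, g' t)"]) (auto intro!: tendsto_Pair)
qed

lemma AA_diff:
  assumes "f \<in> AA Z" "g \<in> AA Z" "subspace Z"
  shows "(\<lambda>t. f t - g t) \<in> AA Z"
proof -
  have "(\<lambda>p. fst p - snd p) ` (Z \<times> Z) \<subseteq> Z"
    using subspace_diff[OF assms(3)] by auto
  from AA_compose[OF AA_Pair[OF assms(1,2)] bounded_linear_locally_lipschitz this]
  show ?thesis by (simp add: bounded_linear_sub bounded_linear_fst bounded_linear_snd)
qed

lemma zero_AA: "subspace Z \<Longrightarrow> (\<lambda>_. 0) \<in> AA Z"
proof (rule AAI)
  show "\<exists>r g. strict_mono r \<and> (\<forall>t. g t \<in> Z) \<and> (\<forall>t. (\<lambda>n. 0) \<longlonglongrightarrow> g t) \<and> (\<forall>t. (\<lambda>n. g (t - \<sigma> (r n))) \<longlonglongrightarrow> 0)"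
    if "subspace Z" for \<sigma> :: "nat \<Rightarrow> real"
    using subspace_0[OF that] by (intro exI[of _ id] exI[of _ "\<lambda>_. 0"]) (auto simp: strict_mono_id)
qed (simp_all add: subspace_0)

section \<open>Operations on asymptotically almost automorphic functions\<close>

lemma AAA_iff: "u \<in> AAA Z \<longleftrightarrow> (\<exists>f\<in>AA Z. \<exists>\<phi>\<in>C0_half_line Z. \<forall>t\<ge>0. u t = f t + \<phi> t)"
  by (simp add: AAA_def)

lemma AAA_E:
  assumes "u \<in> AAA Z"
  obtains f \<phi> where "f \<in> AA Z" "\<phi> \<in> C0_half_line Z" "\<And>t. t \<ge> 0 \<Longrightarrow> u t = f t + \<phi> t"
  using assms unfolding AAA_iff by blast

lemma C0_half_line_subset_AAA:
  assumes "\<phi> \<in> C0_half_line Z" "subspace Z"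
  shows "\<phi> \<in> AAA Z"
  unfolding AAA_iff using zero_AA[OF assms(2)] assms(1) by force

lemma AAA_C_half_line:
  assumes "u \<in> AAA Z" "subspace Z"
  shows "u \<in> C_half_line Z"
proof -
  obtain f \<phi> where f: "f \<in> AA Z" and \<phi>: "\<phi> \<in> C0_half_line Z" and u: "\<And>t. t \<ge> 0 \<Longrightarrow> u t = f t + \<phi> t"
    using AAA_E[OF assms(1)] by metis
  have "continuous_on {0..} (\<lambda>t. f t + \<phi> t)"
    using AAD(2)[OF f] C0_half_lineD(1)[OF \<phi>] by (intro continuous_on_add) (auto intro: continuous_on_subset)
  then have "continuous_on {0..} u" by (rule continuous_on_eq) (simp add: u)
  then show ?thesis
    using u AAD(1)[OF f] C0_half_lineD(2)[OF \<phi>] subspace_add[OF assms(2)] by (auto simp: C_half_line_def)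
qed

lemma AAA_bounded:
  assumes "u \<in> AAA Z"
  shows "bounded (u ` {0..})"
proof -
  obtain f \<phi> where f: "f \<in> AA Z" and \<phi>: "\<phi> \<in> C0_half_line Z" and u: "\<And>t. t \<ge> 0 \<Longrightarrow> u t = f t + \<phi> t"
    using AAA_E[OF assms(1)] by metis
  have "bounded (f ` {0..})" by (rule bounded_subset[OF AAD(3)[OF f]]) auto
  then have "bounded ((\<lambda>t. f t + \<phi> t) ` {0..})"
    using C0_half_line_bounded[OF \<phi>] by (rule bounded_plus_comp)
  moreover have "(\<lambda>t. f t + \<phi> t) ` {0..} = u ` {0..}"
    by (rule image_cong) (simp_all add: u)
  ultimately show ?thesis by simp
qed

lemma AAA_cong:
  assumes "u \<in> AAA Z" "\<And>t. t \<ge> 0 \<Longrightarrow> v t = u t"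
  shows "v \<in> AAA Z"
  using assms by (simp add: AAA_iff)

text \<open>The decomposition is F f + (F u - F f). As u and f are bounded, one Lipschitz constant L
  of F serves both, and the second summand is at most L times the norm of \<phi>.\<close>

lemma AAA_compose:
  assumes u: "u \<in> AAA Z" and F: "locally_lipschitz Z F" "F ` Z \<subseteq> W" and Z: "subspace Z" and W: "subspace W"
  shows "(\<lambda>t. F (u t)) \<in> AAA W"
proof -
  obtain f \<phi> where f: "f \<in> AA Z" and \<phi>: "\<phi> \<in> C0_half_line Z" and u': "\<And>t. t \<ge> 0 \<Longrightarrow> u t = f t + \<phi> t"
    using AAA_E[OF u] by metis
  have uC: "continuous_on {0..} u" "\<And>t. t \<ge> 0 \<Longrightarrow> u t \<in> Z"
    using C_half_lineD[OF AAA_C_half_line[OF u Z]] by auto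
  have cont: "continuous_on Z F" by (rule locally_lipschitz_continuous_on[OF F(1)])
  have Ff: "(\<lambda>t. F (f t)) \<in> AA W" by (rule AA_compose[OF f F])
  define \<psi> where "\<psi> t = F (u t) - F (f t)" for t
  obtain r1 where r1: "\<And>t. norm (f t) \<le> r1"
    using AAD(3)[OF f] unfolding bounded_iff by auto
  obtain r2 where r2: "\<And>t. t \<ge> 0 \<Longrightarrow> norm (u t) \<le> r2"
    using AAA_bounded[OF u] unfolding bounded_iff by auto
  obtain L where L: "L \<ge> 0" "\<And>x y. x \<in> Z \<Longrightarrow> y \<in> Z \<Longrightarrow> norm x \<le> max r1 r2 \<Longrightarrow> norm y \<le> max r1 r2 \<Longrightarrow>
    norm (F x - F y) \<le> L * norm (x - y)"
    using locally_lipschitzE[OF F(1)] by metis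
  have bound: "norm (\<psi> t) \<le> L * norm (\<phi> t)" if "t \<ge> 0" for t
    using L(2)[OF uC(2)[OF that] AAD(1)[OF f, of t]] r1[of t] r2[OF that] u'[OF that]
    by (simp add: \<psi>_def le_max_iff_disj)
  have "\<psi> \<in> C0_half_line W"
  proof (rule C0_half_lineI)
    have "continuous_on {0..} (\<lambda>t. F (u t))"
      by (rule continuous_on_compose2[OF cont uC(1)]) (use uC(2) in auto)
    then show "continuous_on {0..} \<psi>"
      unfolding \<psi>_def by (intro continuous_on_diff continuous_on_subset[OF AAD(2)[OF Ff]]) auto
    show "\<psi> t \<in> W" if "t \<ge> 0" for t
      unfolding \<psi>_def using that uC(2) AAD(1)[OF f] F(2) by (intro subspace_diff[OF W]) auto
    show "(\<psi> \<longlongrightarrow> 0) at_top"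
    proof (rule Lim_null_comparison)
      show "\<forall>\<^sub>F t in at_top. norm (\<psi> t) \<le> L * norm (\<phi> t)"
        using eventually_ge_at_top[of 0] by eventually_elim (rule bound)
      show "((\<lambda>t. L * norm (\<phi> t)) \<longlongrightarrow> 0) at_top"
        by (intro tendsto_mult_right_zero tendsto_norm_zero C0_half_lineD(3)[OF \<phi>])
    qed
  qed
  then show ?thesis
    unfolding AAA_iff using Ff by (intro bexI[of _ "\<lambda>t. F (f t)"] bexI[of _ \<psi>]) (auto simp: \<psi>_def)
qed

lemma AAA_Pair:
  assumes u: "u \<in> AAA Z" and v: "v \<in> AAA W"
  shows "(\<lambda>t. (u t, v t)) \<in> AAA (Z \<times> W)"
proof -
  obtain f \<phi> where f: "f \<in> AA Z" and \<phi>: "\<phi> \<in> C0_half_line Z" and u': "\<And>t. t \<ge> 0 \<Longrightarrow> u t = f t + \<phi> t"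
    using AAA_E[OF u] by metis
  obtain g \<psi> where g: "g \<in> AA W" and \<psi>: "\<psi> \<in> C0_half_line W" and v': "\<And>t. t \<ge> 0 \<Longrightarrow> v t = g t + \<psi> t"
    using AAA_E[OF v] by metis
  have "(\<lambda>t. (\<phi> t, \<psi> t)) \<in> C0_half_line (Z \<times> W)"
    using C0_half_lineD[OF \<phi>] C0_half_lineD[OF \<psi>] tendsto_Pair[of \<phi> 0 at_top \<psi> 0]
    by (intro C0_half_lineI continuous_on_Pair) (auto simp: zero_prod_def)
  then show ?thesis
    unfolding AAA_iff using AA_Pair[OF f g] u' v'
    by (intro bexI[of _ "\<lambda>t. (f t, g t)"] bexI[of _ "\<lambda>t. (\<phi> t, \<psi> t)"]) auto
qed

lemma AAA_add:
  assumes "u \<in> AAA Z" "v \<in> AAA Z" "subspace Z"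
  shows "(\<lambda>t. u t + v t) \<in> AAA Z"
proof -
  have "(\<lambda>p. fst p + snd p) ` (Z \<times> Z) \<subseteq> Z"
    using subspace_add[OF assms(3)] by auto
  from AAA_compose[OF AAA_Pair[OF assms(1,2)] bounded_linear_locally_lipschitz this subspace_Times[OF assms(3,3)] assms(3)]
  show ?thesis by (simp add: bounded_linear_add bounded_linear_fst bounded_linear_snd)
qed

lemma AAA_diff:
  assumes "u \<in> AAA Z" "v \<in> AAA Z" "subspace Z"
  shows "(\<lambda>t. u t - v t) \<in> AAA Z"
proof -
  have "(\<lambda>p. fst p - snd p) ` (Z \<times> Z) \<subseteq> Z"
    using subspace_diff[OF assms(3)] by auto
  from AAA_compose[OF AAA_Pair[OF assms(1,2)] bounded_linear_locally_lipschitz this subspace_Times[OF assms(3,3)] assms(3)]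
  show ?thesis by (simp add: bounded_linear_sub bounded_linear_fst bounded_linear_snd)
qed

text \<open>Almost automorphic functions are recurrent, so a bound near \<open>\<infinity>\<close> holds everywhere.\<close>

lemma AA_norm_le_of_AAA:
  assumes f: "f \<in> AA Z" and \<phi>: "\<phi> \<in> C0_half_line Z" and c: "\<And>t. t \<ge> 0 \<Longrightarrow> norm (f t + \<phi> t) \<le> c"
  shows "norm (f t) \<le> c"
proof -
  \<comment> \<open>Translating by integers tending to infinity makes \<phi> negligible, so the
    limit g obeys the bound everywhere; translating back hands it to f.\<close>
  obtain r g where r: "strict_mono r"
    and lim: "\<And>t. (\<lambda>n. f (t + real (r n))) \<longlonglongrightarrow> g t" "\<And>t. (\<lambda>n. g (t - real (r n))) \<longlonglongrightarrow> f t"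
    using AA_subseqE[OF f, of real] by metis
  have g: "norm (g s) \<le> c" for s
  proof (rule LIMSEQ_le)
    show "(\<lambda>n. norm (f (s + real (r n)))) \<longlonglongrightarrow> norm (g s)" by (intro tendsto_norm lim)
    have top: "filterlim (\<lambda>n. s + real (r n)) at_top sequentially"
      by (intro filterlim_tendsto_add_at_top[OF tendsto_const]
          filterlim_compose[OF filterlim_real_sequentially filterlim_subseq[OF r]])
    then have "(\<lambda>n. c + norm (\<phi> (s + real (r n)))) \<longlonglongrightarrow> c + 0"
      by (intro tendsto_add tendsto_const tendsto_norm_zero filterlim_compose[OF C0_half_lineD(3)[OF \<phi>]])
    then show "(\<lambda>n. c + norm (\<phi> (s + real (r n)))) \<longlonglongrightarrow> c" by simp
    have "\<forall>\<^sub>F n in sequentially. s + real (r n) \<ge> 0"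
      using top by (simp add: filterlim_at_top)
    then obtain N where N: "\<And>n. n \<ge> N \<Longrightarrow> s + real (r n) \<ge> 0"
      by (auto simp: eventually_sequentially)
    have "norm (f (s + real (r n))) \<le> c + norm (\<phi> (s + real (r n)))" if "n \<ge> N" for n
      using c[OF N[OF that]] norm_triangle_ineq4[of "f (s + real (r n)) + \<phi> (s + real (r n))" "\<phi> (s + real (r n))"]
      by simp
    then show "\<exists>N. \<forall>n\<ge>N. norm (f (s + real (r n))) \<le> c + norm (\<phi> (s + real (r n)))" by blast
  qed
  show ?thesis
    by (rule Lim_norm_ubound[OF _ lim(2)]) (simp_all add: g)
qed

lemma C0_half_line_diff:
  assumes "\<phi> \<in> C0_half_line Z" "\<psi> \<in> C0_half_line Z" "subspace Z"
  shows "(\<lambda>t. \<phi> t - \<psi> t) \<in> C0_half_line Z"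
  using C0_half_lineD[OF assms(1)] C0_half_lineD[OF assms(2)] subspace_diff[OF assms(3)]
    tendsto_diff[of \<phi> 0 at_top \<psi> 0]
  by (intro C0_half_lineI continuous_on_diff) auto

text \<open>The recurrence bound with c = 0, applied to the differences of the two
  decompositions.\<close>

lemma AAA_decomposition_unique:
  assumes "f \<in> AA Z" "\<phi> \<in> C0_half_line Z" "g \<in> AA Z" "\<psi> \<in> C0_half_line Z" "subspace Z"
    and eq: "\<And>t. t \<ge> 0 \<Longrightarrow> f t + \<phi> t = g t + \<psi> t"
  shows "f = g" "t \<ge> 0 \<Longrightarrow> \<phi> t = \<psi> t"
proof -
  have "norm (f t - g t) \<le> 0" for t
  proof (rule AA_norm_le_of_AAA[where f = "\<lambda>t. f t - g t" and \<phi> = "\<lambda>t. \<phi> t - \<psi> t"])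
    show "norm (f t - g t + (\<phi> t - \<psi> t)) \<le> 0" if "t \<ge> 0" for t
      using eq[OF that] by (simp add: algebra_simps)
  qed (use assms in \<open>auto intro: AA_diff C0_half_line_diff\<close>)
  then show "f = g" by auto
  then show "t \<ge> 0 \<Longrightarrow> \<phi> t = \<psi> t" using eq[of t] by simp
qed

text \<open>Uniqueness of the decomposition turns the definite description in
  \<open>AAA_norm\<close> into an actual sum of suprema. This is how the norm of a in the Lipschitz
  constant of b controls the values of a.\<close>

lemma norm_le_AAA_norm:
  assumes u: "u \<in> AAA Z" and Z: "subspace Z" and t: "t \<ge> 0"
  shows "norm (u t) \<le> AAA_norm Z u"
proof -
  obtain f \<phi> where f: "f \<in> AA Z" and \<phi>: "\<phi> \<in> C0_half_line Z" and u': "\<And>t. t \<ge> 0 \<Longrightarrow> u t = f t + \<phi> t"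
    using AAA_E[OF u] by metis
  have norm_eq: "AAA_norm Z u = (SUP t. norm (f t)) + (SUP t\<in>{0..}. norm (\<phi> t))"
    unfolding AAA_norm_def
  proof (rule the_equality)
    show "\<exists>f'\<in>AA Z. \<exists>\<phi>'\<in>C0_half_line Z. (\<forall>t\<ge>0. u t = f' t + \<phi>' t) \<and>
      (SUP t. norm (f t)) + (SUP t\<in>{0..}. norm (\<phi> t)) = (SUP t. norm (f' t)) + (SUP t\<in>{0..}. norm (\<phi>' t))"
      using f \<phi> u' by blast
  next
    fix r assume "\<exists>f\<in>AA Z. \<exists>\<phi>\<in>C0_half_line Z. (\<forall>t\<ge>0. u t = f t + \<phi> t) \<and>
      r = (SUP t. norm (f t)) + (SUP t\<in>{0..}. norm (\<phi> t))"
    then obtain g \<psi> where g: "g \<in> AA Z" and \<psi>: "\<psi> \<in> C0_half_line Z" and u2: "\<And>t. t \<ge> 0 \<Longrightarrow> u t = g t + \<psi> t"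
      and r: "r = (SUP t. norm (g t)) + (SUP t\<in>{0..}. norm (\<psi> t))" by blast
    have eq: "g t + \<psi> t = f t + \<phi> t" if "t \<ge> 0" for t using u'[OF that] u2[OF that] by simp
    have "g = f" "\<And>t. t \<ge> 0 \<Longrightarrow> \<psi> t = \<phi> t"
      using AAA_decomposition_unique[OF g \<psi> f \<phi> Z eq] by auto
    then show "r = (SUP t. norm (f t)) + (SUP t\<in>{0..}. norm (\<phi> t))"
      unfolding r by (simp cong: SUP_cong_simp)
  qed
  have "norm (f t) \<le> (SUP t. norm (f t))"
    using AAD(3)[OF f] by (intro cSUP_upper bounded_imp_bdd_above) (auto simp: bounded_iff)
  moreover have "norm (\<phi> t) \<le> (SUP t\<in>{0..}. norm (\<phi> t))"
    using C0_half_line_bounded[OF \<phi>] t by (intro cSUP_upper bounded_imp_bdd_above) (auto simp: bounded_iff)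
  ultimately show ?thesis
    unfolding norm_eq u'[OF t] using norm_triangle_ineq[of "f t" "\<phi> t"] by linarith
qed

text \<open>The Moore-Osgood exchange of limits; both passages to the limit in the completeness of
  \<open>AA\<close> are instances.\<close>

lemma LIMSEQ_uniform_swap:
  fixes A :: "nat \<Rightarrow> nat \<Rightarrow> 'a::real_normed_vector"
  assumes unif: "uniform_limit UNIV A A' sequentially" and lim: "\<And>k. A k \<longlonglongrightarrow> B k" and B: "B \<longlonglongrightarrow> b"
  shows "A' \<longlonglongrightarrow> b"
proof (rule LIMSEQ_I)
  fix e :: real assume e: "e > 0"
  have "\<forall>\<^sub>F k in sequentially. \<forall>n\<in>UNIV. dist (A k n) (A' n) < e / 3"
    using e by (intro uniform_limitD[OF unif]) simp
  moreover have "\<forall>\<^sub>F k in sequentially. dist (B k) b < e / 3"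
    using e by (intro tendstoD[OF B]) simp
  ultimately have "\<forall>\<^sub>F k in sequentially. (\<forall>n. dist (A k n) (A' n) < e / 3) \<and> dist (B k) b < e / 3"
    by eventually_elim auto
  then obtain k where k: "\<And>n. dist (A k n) (A' n) < e / 3" "dist (B k) b < e / 3"
    by (auto simp: eventually_sequentially)
  have "\<forall>\<^sub>F n in sequentially. dist (A k n) (B k) < e / 3"
    using e by (intro tendstoD[OF lim]) simp
  then obtain N where N: "\<And>n. n \<ge> N \<Longrightarrow> dist (A k n) (B k) < e / 3"
    by (auto simp: eventually_sequentially)
  have "norm (A' n - b) < e" if "n \<ge> N" for n
    using N[OF that] k(1)[of n] k(2) dist_triangle[of "A' n" b "A k n"] dist_triangle[of "A k n" b "B k"]
    by (simp add: dist_commute flip: dist_norm)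
  then show "\<exists>no. \<forall>n\<ge>no. norm (A' n - b) < e" by blast
qed

text \<open>A diagonal sequence serves all \<open>F k\<close> at once. Along it the distance of the
  limit functions \<open>G m\<close> and \<open>G n\<close> is at most that of \<open>F m\<close>
  and \<open>F n\<close>, so they converge uniformly too, and the limits can be exchanged in both
  directions.\<close>

lemma AA_uniform_limit:
  fixes Z :: "'z::banach set"
  assumes F: "\<And>k. F k \<in> AA Z" and lim: "uniform_limit UNIV F f sequentially" and Z: "closed Z"
  shows "f \<in> AA Z"
proof (rule AAI)
  have pt: "(\<lambda>k. F k t) \<longlonglongrightarrow> f t" for t
    by (rule tendsto_uniform_limitI[OF lim]) simp
  show "f t \<in> Z" for t
    by (rule closed_sequentially[OF Z _ pt]) (rule AAD(1)[OF F])
  show "continuous_on UNIV f"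
    by (rule uniform_limit_theorem[OF _ lim]) (simp_all add: AAD(2)[OF F])
  show "bounded (range f)"
  proof -
    have "\<forall>\<^sub>F k in sequentially. \<forall>t\<in>UNIV. dist (F k t) (f t) < 1"
      by (rule uniform_limitD[OF lim]) simp
    then obtain k where k: "\<And>t. dist (F k t) (f t) < 1"
      by (auto simp: eventually_sequentially)
    obtain c where c: "\<And>t. norm (F k t) \<le> c"
      using AAD(3)[OF F[of k]] unfolding bounded_iff by auto
    have "norm (f t) \<le> c + 1" for t
      using k[of t] c[of t] norm_triangle_sub[of "f t" "F k t"] by (simp add: dist_norm norm_minus_commute)
    then show ?thesis unfolding bounded_iff by auto
  qed
  fix \<sigma> :: "nat \<Rightarrow> real"
  define P where "P k s \<longleftrightarrow> (\<exists>g. (\<forall>t. g t \<in> Z) \<and> (\<forall>t. (\<lambda>n. F k (t + \<sigma> (s n))) \<longlonglongrightarrow> g t) \<and>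
             (\<forall>t. (\<lambda>n. g (t - \<sigma> (s n))) \<longlonglongrightarrow> F k t))" for k and s :: "nat \<Rightarrow> nat"
  interpret subseqs P
  proof
    fix k and s :: "nat \<Rightarrow> nat"
    obtain r g where "strict_mono r" "\<And>t. g t \<in> Z" "\<And>t. (\<lambda>n. F k (t + (\<sigma> \<circ> s) (r n))) \<longlonglongrightarrow> g t"
      "\<And>t. (\<lambda>n. g (t - (\<sigma> \<circ> s) (r n))) \<longlonglongrightarrow> F k t"
      using AA_subseqE[OF F[of k], of "\<sigma> \<circ> s"] by metis
    then show "\<exists>r. strict_mono r \<and> P k (s \<circ> r)"
      unfolding P_def by (intro exI[of _ r] conjI exI[of _ g]) auto
  qed
  \<comment> \<open>Only from index k + 1 on is the diagonal sequence known to be a subsequence of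
    one that suits \<open>F k\<close>; the finitely many earlier terms are restored by
    \<open>shift\<close>.\<close>
  have "P k (diagseq \<circ> (+) (Suc k))" for k
  proof (rule diagseq_holds)
    fix r s :: "nat \<Rightarrow> nat" and n assume r: "strict_mono r" and "P n s"
    then obtain g where g: "\<And>t. g t \<in> Z" "\<And>t. (\<lambda>i. F n (t + \<sigma> (s i))) \<longlonglongrightarrow> g t"
             "\<And>t. (\<lambda>i. g (t - \<sigma> (s i))) \<longlonglongrightarrow> F n t"
      unfolding P_def by blast
    show "P n (s \<circ> r)"
      unfolding P_def using g(1) LIMSEQ_subseq_LIMSEQ[OF g(2) r] LIMSEQ_subseq_LIMSEQ[OF g(3) r]
      by (intro exI[of _ g]) (auto simp: o_def)
  qed
  then have "\<forall>k. \<exists>g. (\<forall>t. g t \<in> Z) \<and> (\<forall>t. (\<lambda>n. F k (t + \<sigma> (diagseq n))) \<longlonglongrightarrow> g t) \<and>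
             (\<forall>t. (\<lambda>n. g (t - \<sigma> (diagseq n))) \<longlonglongrightarrow> F k t)"
  proof -
    have shift: "X \<longlonglongrightarrow> l" if "(\<lambda>n. X (Suc k + n)) \<longlonglongrightarrow> l" for X :: "nat \<Rightarrow> 'z" and k l
      using that by (intro LIMSEQ_offset[of X "Suc k"]) (simp add: add.commute)
    fix k assume "\<And>k. P k (diagseq \<circ> (+) (Suc k))"
    show ?thesis
    proof
      fix k
      have "P k (diagseq \<circ> (+) (Suc k))" by fact
      then obtain g where g: "\<And>t. g t \<in> Z" "\<And>t. (\<lambda>n. F k (t + \<sigma> (diagseq (Suc k + n)))) \<longlonglongrightarrow> g t"
             "\<And>t. (\<lambda>n. g (t - \<sigma> (diagseq (Suc k + n)))) \<longlonglongrightarrow> F k t"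
        unfolding P_def o_def by blast
      show "\<exists>g. (\<forall>t. g t \<in> Z) \<and> (\<forall>t. (\<lambda>n. F k (t + \<sigma> (diagseq n))) \<longlonglongrightarrow> g t) \<and>
             (\<forall>t. (\<lambda>n. g (t - \<sigma> (diagseq n))) \<longlonglongrightarrow> F k t)"
        using g(1) shift[OF g(2)] shift[OF g(3)] by blast
    qed
  qed
  then obtain G where G: "\<And>k t. G k t \<in> Z" "\<And>k t. (\<lambda>n. F k (t + \<sigma> (diagseq n))) \<longlonglongrightarrow> G k t"
             "\<And>k t. (\<lambda>n. G k (t - \<sigma> (diagseq n))) \<longlonglongrightarrow> F k t"
    by metis
  have "uniformly_Cauchy_on UNIV G"
    unfolding uniformly_Cauchy_on_def
  proof (intro allI impI)
    fix e :: real assume e: "e > 0"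
    have "uniformly_Cauchy_on UNIV F"
      by (rule uniformly_convergent_Cauchy[OF uniformly_convergentI[OF lim]])
    then obtain N where N: "\<And>t m n. m \<ge> N \<Longrightarrow> n \<ge> N \<Longrightarrow> dist (F m t) (F n t) < e / 2"
      using e unfolding uniformly_Cauchy_on_def by (meson UNIV_I half_gt_zero)
    have "dist (G m t) (G n t) < e" if "m \<ge> N" "n \<ge> N" for m n t
    proof -
      have "norm (G m t - G n t) \<le> e / 2"
      proof (rule Lim_norm_ubound[OF _ tendsto_diff[OF G(2) G(2)]])
        show "\<forall>\<^sub>F i in sequentially. norm (F m (t + \<sigma> (diagseq i)) - F n (t + \<sigma> (diagseq i))) \<le> e / 2"
          using N[OF that] by (auto intro!: always_eventually less_imp_le simp flip: dist_norm)
      qed simp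
      then show ?thesis using e by (simp add: dist_norm)
    qed
    then show "\<exists>M. \<forall>x\<in>UNIV. \<forall>m\<ge>M. \<forall>n\<ge>M. dist (G m x) (G n x) < e" by blast
  qed
  then obtain g where g: "uniform_limit UNIV G g sequentially"
    using Cauchy_uniformly_convergent unfolding uniformly_convergent_on_def by blast
  have ptg: "(\<lambda>k. G k t) \<longlonglongrightarrow> g t" for t
    by (rule tendsto_uniform_limitI[OF g]) simp
  have "g t \<in> Z" for t
    by (rule closed_sequentially[OF Z _ ptg]) (rule G(1))
  moreover have "(\<lambda>n. f (t + \<sigma> (diagseq n))) \<longlonglongrightarrow> g t" for t
    by (rule LIMSEQ_uniform_swap[OF uniform_limit_compose'[OF lim, of "\<lambda>n. t + \<sigma> (diagseq n)"] G(2) ptg]) simp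
  moreover have "(\<lambda>n. g (t - \<sigma> (diagseq n))) \<longlonglongrightarrow> f t" for t
    by (rule LIMSEQ_uniform_swap[OF uniform_limit_compose'[OF g, of "\<lambda>n. t - \<sigma> (diagseq n)"] G(3) pt]) simp
  ultimately show "\<exists>r g. strict_mono r \<and> (\<forall>t. g t \<in> Z) \<and> (\<forall>t. (\<lambda>n. f (t + \<sigma> (r n))) \<longlonglongrightarrow> g t) \<and>
             (\<forall>t. (\<lambda>n. g (t - \<sigma> (r n))) \<longlonglongrightarrow> f t)"
    using subseq_diagseq by blast
qed

text \<open>Closeness of the sums on the half-line forces closeness of their almost automorphic
  parts on the whole line, by recurrence. So these parts converge by themselves, and the vanishing
  parts follow as differences.\<close>

lemma AAA_uniform_limit:
  fixes Z :: "'z::banach set"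
  assumes U: "\<And>k. U k \<in> AAA Z" and lim: "uniform_limit {0..} U u sequentially" and Z: "closed Z" "subspace Z"
  shows "u \<in> AAA Z"
proof -
  have "\<forall>k. \<exists>f \<phi>. f \<in> AA Z \<and> \<phi> \<in> C0_half_line Z \<and> (\<forall>t\<ge>0. U k t = f t + \<phi> t)"
    using U unfolding AAA_iff by blast
  then obtain F \<Phi> where F: "\<And>k. F k \<in> AA Z" and \<Phi>: "\<And>k. \<Phi> k \<in> C0_half_line Z"
    and U': "\<And>k t. t \<ge> 0 \<Longrightarrow> U k t = F k t + \<Phi> k t" by metis
  have "uniformly_Cauchy_on UNIV F"
    unfolding uniformly_Cauchy_on_def
  proof (intro allI impI)
    fix e :: real assume e: "e > 0"
    have "uniformly_Cauchy_on {0..} U"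
      by (rule uniformly_convergent_Cauchy[OF uniformly_convergentI[OF lim]])
    then obtain N where N: "\<And>t m n. t \<ge> 0 \<Longrightarrow> m \<ge> N \<Longrightarrow> n \<ge> N \<Longrightarrow> dist (U m t) (U n t) < e / 2"
      using e unfolding uniformly_Cauchy_on_def by (meson atLeast_iff half_gt_zero)
    have "dist (F m t) (F n t) < e" if "m \<ge> N" "n \<ge> N" for m n t
    proof -
      have "norm (F m t - F n t) \<le> e / 2"
      proof (rule AA_norm_le_of_AAA[where f = "\<lambda>t. F m t - F n t" and \<phi> = "\<lambda>t. \<Phi> m t - \<Phi> n t"])
        show "norm (F m t - F n t + (\<Phi> m t - \<Phi> n t)) \<le> e / 2" if "t \<ge> 0" for t
          using N[OF that \<open>m \<ge> N\<close> \<open>n \<ge> N\<close>] U'[OF that] by (simp add: dist_norm algebra_simps)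
      qed (use F \<Phi> Z in \<open>auto intro: AA_diff C0_half_line_diff\<close>)
      then show ?thesis using e by (simp add: dist_norm)
    qed
    then show "\<exists>M. \<forall>x\<in>UNIV. \<forall>m\<ge>M. \<forall>n\<ge>M. dist (F m x) (F n x) < e" by blast
  qed
  then obtain f where flim: "uniform_limit UNIV F f sequentially"
    using Cauchy_uniformly_convergent unfolding uniformly_convergent_on_def by blast
  have f: "f \<in> AA Z" by (rule AA_uniform_limit[OF F flim Z(1)])
  define \<phi> where "\<phi> t = u t - f t" for t
  have "uniform_limit {0..} (\<lambda>k t. U k t - F k t) \<phi> sequentially"
    unfolding \<phi>_def by (intro uniform_limit_intros lim uniform_limit_on_subset[OF flim]) auto
  then have \<phi>lim: "uniform_limit {0..} \<Phi> \<phi> sequentially"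
    by (rule uniform_limit_cong'[THEN iffD1, rotated 2]) (auto simp: U')
  have ptphi: "(\<lambda>k. \<Phi> k t) \<longlonglongrightarrow> \<phi> t" if "t \<ge> 0" for t
    by (rule tendsto_uniform_limitI[OF \<phi>lim]) (simp add: that)
  have "\<phi> \<in> C0_half_line Z"
  proof (rule C0_half_lineI)
    show "continuous_on {0..} \<phi>"
      by (rule uniform_limit_theorem[OF _ \<phi>lim]) (simp_all add: C0_half_lineD(1)[OF \<Phi>])
    show "\<phi> t \<in> Z" if "t \<ge> 0" for t
      by (rule closed_sequentially[OF Z(1) _ ptphi[OF that]]) (rule C0_half_lineD(2)[OF \<Phi> that])
    show "(\<phi> \<longlongrightarrow> 0) at_top"
      unfolding tendsto_iff
    proof (intro allI impI)
      fix e :: real assume e: "e > 0"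
      have "\<forall>\<^sub>F k in sequentially. \<forall>t\<in>{0..}. dist (\<Phi> k t) (\<phi> t) < e / 2"
        using e by (intro uniform_limitD[OF \<phi>lim]) simp
      then obtain k where k: "\<And>t. t \<ge> 0 \<Longrightarrow> dist (\<Phi> k t) (\<phi> t) < e / 2"
        by (auto simp: eventually_sequentially)
      have "\<forall>\<^sub>F t in at_top. dist (\<Phi> k t) 0 < e / 2"
        using e by (intro tendstoD[OF C0_half_lineD(3)[OF \<Phi>]]) simp
      then show "\<forall>\<^sub>F t in at_top. dist (\<phi> t) 0 < e"
        using eventually_ge_at_top[of 0]
      proof eventually_elim
        case (elim t)
        then show ?case
          using k[of t] dist_triangle[of "\<phi> t" 0 "\<Phi> k t"] by (simp add: dist_commute)
      qed
    qed
  qed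
  then show ?thesis
    unfolding AAA_iff using f by (intro bexI[of _ f] bexI[of _ \<phi>]) (auto simp: \<phi>_def)
qed

section \<open>Convolution with an exponentially stable family\<close>

lemma integral_in_closed_subspace:
  fixes f :: "real \<Rightarrow> 'a::banach"
  assumes X: "closed X" "subspace X" and int: "f integrable_on {a..b}"
    and f: "\<And>x. x \<in> {a..b} \<Longrightarrow> f x \<in> X"
  shows "integral {a..b} f \<in> X"
proof -
  have "integral {a..b} f \<in> closure X"
    unfolding closure_approachable
  proof (intro allI impI)
    fix e :: real assume "e > 0"
    then obtain \<gamma> where \<gamma>: "gauge \<gamma>"
      "\<And>\<D>. \<D> tagged_division_of {a..b} \<Longrightarrow> \<gamma> fine \<D> \<Longrightarrow>
        norm ((\<Sum>(x, k)\<in>\<D>. measure lborel k *\<^sub>R f x) - integral {a..b} f) < e"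
      using integrable_integral[OF int, unfolded has_integral_real, rule_format, OF \<open>e > 0\<close>] by auto
    obtain p where p: "p tagged_division_of {a..b}" "\<gamma> fine p"
      using fine_division_exists_real[OF \<gamma>(1)] by blast
    \<comment> \<open>Riemann sums are linear combinations of values of f; the integral is a limit
      of such sums.\<close>
    have "(\<Sum>(x, k)\<in>p. measure lborel k *\<^sub>R f x) \<in> X"
    proof (intro subspace_sum[OF X(2)], clarify)
      fix x k assume "(x, k) \<in> p"
      then have "x \<in> {a..b}"
        using tagged_division_ofD(2,3)[OF p(1)] by blast
      then show "measure lborel k *\<^sub>R f x \<in> X" by (intro subspace_scale[OF X(2)] f)
    qed
    then show "\<exists>y\<in>X. dist y (integral {a..b} f) < e"
      using \<gamma>(2)[OF p] by (auto simp: dist_norm)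
  qed
  then show ?thesis using X(1) by simp
qed

text \<open>Moves the dependence on t in the convolution from the kernel R to the function convolved
  with it.\<close>

lemma integral_reflect_interval:
  fixes f :: "real \<Rightarrow> 'a::banach"
  assumes "f integrable_on {0..t}"
  shows "integral {0..t} (\<lambda>s. f (t - s)) = integral {0..t} f"
proof -
  have "(f has_integral integral {0..t} f) (cbox 0 t)"
    using assms by (simp add: integrable_integral)
  from has_integral_affinity[OF this, of "-1" t]
  have "((\<lambda>s. f (t - s)) has_integral integral {0..t} f) ((\<lambda>x. t - x) ` {0..t})"
    by (simp add: algebra_simps)
  moreover have "(\<lambda>x. t - x) ` {0..t} = {0..t}"
    by (simp add: image_diff_atLeastAtMost)
  ultimately show ?thesis by (simp add: integral_unique)
qed

lemma has_integral_exp_shift: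
  assumes "\<omega> > 0" "t \<ge> (0::real)"
  shows "((\<lambda>s. exp (- \<omega> * (t - s))) has_integral (1 - exp (- \<omega> * t)) / \<omega>) {0..t}"
proof -
  have "((\<lambda>s. exp (- \<omega> * (t - s)) / \<omega>) has_vector_derivative exp (- \<omega> * (t - s))) (at s within {0..t})" for s
    using assms(1) by (auto intro!: derivative_eq_intros simp flip: has_real_derivative_iff_has_vector_derivative)
  from fundamental_theorem_of_calculus[OF assms(2) this]
  show ?thesis by (simp add: diff_divide_distrib)
qed

text \<open>A Lebesgue integral, in contrast to the integral defining the convolution, so that h
  need only be measurable and dominated convergence is at hand.\<close>

definition exp_weighted :: "real \<Rightarrow> (real \<Rightarrow> real) \<Rightarrow> real" where
  "exp_weighted \<omega> h = (\<integral>s. indicator {0..} s * exp (- \<omega> * s) * h s \<partial>lborel)"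

lemma exp_neg_mult_tendsto_0:
  assumes "\<omega> > (0::real)"
  shows "((\<lambda>t. exp (- \<omega> * t)) \<longlongrightarrow> 0) at_top"
proof -
  have "filterlim (\<lambda>t. - \<omega> * t) at_bot at_top"
    using assms by (intro filterlim_tendsto_neg_mult_at_bot[OF tendsto_const _ filterlim_ident]) simp
  then show ?thesis by (rule filterlim_compose[OF exp_at_bot])
qed

lemma integrable_exp_half_line:
  assumes "\<omega> > 0"
  shows "integrable lborel (\<lambda>s. indicator {0..} s * exp (- \<omega> * s) :: real)"
proof (rule integrableI_nonneg)
  have "((\<lambda>s. - exp (- \<omega> * s) / \<omega>) \<longlongrightarrow> - 0 / \<omega>) at_top"
    using assms by (intro tendsto_intros exp_neg_mult_tendsto_0) auto
  then have "((\<lambda>s. - exp (- \<omega> * s) / \<omega>) \<longlongrightarrow> 0) at_top" by simp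
  then have "(\<integral>\<^sup>+s. ennreal (exp (- \<omega> * s)) * indicator {0..} s \<partial>lborel) = ennreal (0 - - exp (- \<omega> * 0) / \<omega>)"
    using assms by (intro nn_integral_FTC_atLeast) (auto intro!: derivative_eq_intros)
  moreover have "ennreal (exp (- \<omega> * s)) * indicator {0..} s = ennreal (indicator {0..} s * exp (- \<omega> * s))" for s
    by (auto simp: indicator_def)
  ultimately show "(\<integral>\<^sup>+s. ennreal (indicator {0..} s * exp (- \<omega> * s)) \<partial>lborel) < \<infinity>"
    by simp
qed auto

text \<open>The weight turns the constant bound C into an integrable majorant.\<close>

lemma exp_weighted_tendsto:
  assumes \<omega>: "\<omega> > 0" and [measurable]: "\<And>n. h n \<in> borel_measurable borel" "h' \<in> borel_measurable borel"
    and bound: "\<And>n s. \<bar>h n s\<bar> \<le> C" and lim: "\<And>s. (\<lambda>n. h n s) \<longlonglongrightarrow> h' s"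
  shows "(\<lambda>n. exp_weighted \<omega> (h n)) \<longlonglongrightarrow> exp_weighted \<omega> h'"
  unfolding exp_weighted_def
proof (rule integral_dominated_convergence)
  show "integrable lborel (\<lambda>s. indicator {0..} s * exp (- \<omega> * s) * C)"
    by (intro integrable_mult_left integrable_exp_half_line \<omega>)
  show "AE s in lborel. (\<lambda>n. indicator {0..} s * exp (- \<omega> * s) * h n s) \<longlonglongrightarrow> indicator {0..} s * exp (- \<omega> * s) * h' s"
    by (intro always_eventually allI tendsto_mult tendsto_const lim)
  show "AE s in lborel. norm (indicator {0..} s * exp (- \<omega> * s) * h n s) \<le> indicator {0..} s * exp (- \<omega> * s) * C" for n
    using bound[of n] by (intro always_eventually allI) (auto simp: abs_mult intro!: mult_left_mono)
qed auto

lemma integrable_exp_weighted: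
  fixes h :: "real \<Rightarrow> real"
  assumes \<omega>: "\<omega> > 0" and [measurable]: "h \<in> borel_measurable borel" and bound: "\<And>s. \<bar>h s\<bar> \<le> C"
  shows "integrable lborel (\<lambda>s. indicator {0..} s * exp (- \<omega> * s) * h s)"
proof (rule Bochner_Integration.integrable_bound)
  show "integrable lborel (\<lambda>s. indicator {0..} s * exp (- \<omega> * s) * C)"
    by (intro integrable_mult_left integrable_exp_half_line \<omega>)
  have "\<bar>h s\<bar> \<le> \<bar>C\<bar>" for s using bound[of s] by linarith
  then show "AE s in lborel. norm (indicator {0..} s * exp (- \<omega> * s) * h s) \<le> norm (indicator {0..} s * exp (- \<omega> * s) * C)"
    by (intro always_eventually allI) (auto simp: abs_mult intro!: mult_left_mono)
qed auto

lemma exp_weighted_triangle: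
  assumes \<omega>: "\<omega> > 0" and [measurable]: "h \<in> borel_measurable borel" "h1 \<in> borel_measurable borel" "h2 \<in> borel_measurable borel"
    and nn: "\<And>s. 0 \<le> h s" "\<And>s. h s \<le> h1 s + h2 s" and bound: "\<And>s. \<bar>h1 s\<bar> \<le> C" "\<And>s. \<bar>h2 s\<bar> \<le> C"
  shows "exp_weighted \<omega> h \<le> exp_weighted \<omega> h1 + exp_weighted \<omega> h2"
proof -
  have "\<bar>h s\<bar> \<le> C + C" for s using nn[of s] bound[of s] by linarith
  then have int: "integrable lborel (\<lambda>s. indicator {0..} s * exp (- \<omega> * s) * h s)"
    by (intro integrable_exp_weighted[OF \<omega>]) auto
  have int1: "integrable lborel (\<lambda>s. indicator {0..} s * exp (- \<omega> * s) * h1 s)"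
   and int2: "integrable lborel (\<lambda>s. indicator {0..} s * exp (- \<omega> * s) * h2 s)"
    by (rule integrable_exp_weighted[OF \<omega> _ bound(1)], simp)
      (rule integrable_exp_weighted[OF \<omega> _ bound(2)], simp)
  have "exp_weighted \<omega> h \<le> (\<integral>s. indicator {0..} s * exp (- \<omega> * s) * h1 s + indicator {0..} s * exp (- \<omega> * s) * h2 s \<partial>lborel)"
    unfolding exp_weighted_def
    using nn(2) by (intro integral_mono int Bochner_Integration.integrable_add int1 int2)
      (auto simp: indicator_def simp flip: distrib_left)
  also have "\<dots> = exp_weighted \<omega> h1 + exp_weighted \<omega> h2"
    unfolding exp_weighted_def by (rule Bochner_Integration.integral_add[OF int1 int2])
  finally show ?thesis .
qed

text \<open>The passage from the integral over a bounded interval to the Lebesgue integral over the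
  half-line, with a bound free of n.\<close>

lemma integral_le_exp_weighted:
  assumes \<omega>: "\<omega> > 0" and h: "continuous_on UNIV h" "\<And>s. 0 \<le> h s" "\<And>s. h s \<le> C"
  shows "integral {0..n} (\<lambda>s. exp (- \<omega> * s) * h s) \<le> exp_weighted \<omega> h"
proof -
  have [measurable]: "h \<in> borel_measurable borel" by (rule borel_measurable_continuous_onI[OF h(1)])
  have int: "integrable lborel (\<lambda>s. indicator {0..} s * exp (- \<omega> * s) * h s)"
    using h by (intro integrable_exp_weighted[OF \<omega>, of h C]) auto
  have si: "set_integrable lborel {0..n} (\<lambda>s. exp (- \<omega> * s) * h s)"
    by (intro borel_integrable_atLeastAtMost' continuous_intros continuous_on_subset[OF h(1)]) auto
  have "integral {0..n} (\<lambda>s. exp (- \<omega> * s) * h s) = (LINT s:{0..n}|lborel. exp (- \<omega> * s) * h s)"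
    by (rule set_borel_integral_eq_integral(2)[OF si, symmetric])
  also have "\<dots> \<le> exp_weighted \<omega> h"
    unfolding exp_weighted_def set_lebesgue_integral_def
    using si h(2) unfolding set_integrable_def
    by (intro integral_mono int) (auto simp: indicator_def)
  finally show ?thesis .
qed

text \<open>The features of a resolvent operator on which convolution rests: strong continuity and
  exponential decay. Such a family need not be a semigroup. Its operators are constrained on X only,
  since they may be arbitrary elsewhere in the ambient type.\<close>

locale exp_stable_family =
  fixes X :: "'x::banach set" and R :: "real \<Rightarrow> 'x \<Rightarrow> 'x" and K \<omega> :: real
  assumes closed_X: "closed X" and subspace_X: "subspace X"
    and R_in: "t \<ge> 0 \<Longrightarrow> x \<in> X \<Longrightarrow> R t x \<in> X"
    and R_add: "t \<ge> 0 \<Longrightarrow> x \<in> X \<Longrightarrow> y \<in> X \<Longrightarrow> R t (x + y) = R t x + R t y"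
    and R_scale: "t \<ge> 0 \<Longrightarrow> x \<in> X \<Longrightarrow> R t (c *\<^sub>R x) = c *\<^sub>R R t x"
    and R_cont: "x \<in> X \<Longrightarrow> continuous_on {0..} (\<lambda>t. R t x)"
    and R_bound: "t \<ge> 0 \<Longrightarrow> x \<in> X \<Longrightarrow> norm (R t x) \<le> K * exp (- \<omega> * t) * norm x"
    and K_nonneg: "K \<ge> 0" and \<omega>_pos: "\<omega> > 0"
begin

lemma R_diff: 
  assumes "t \<ge> 0" "x \<in> X" "y \<in> X"
  shows "R t (x - y) = R t x - R t y"
proof -
  have "R t (x + (-1) *\<^sub>R y) = R t x + R t ((-1) *\<^sub>R y)"
    by (rule R_add[OF assms(1,2) subspace_scale[OF subspace_X assms(3)]])
  then show ?thesis unfolding R_scale[OF assms(1,3)] by simp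
qed

lemma R_bound':
  assumes "t \<ge> 0" "x \<in> X"
  shows "norm (R t x) \<le> K * norm x"
proof -
  have "exp (- \<omega> * t) \<le> 1" using assms(1) \<omega>_pos by simp
  then have "K * exp (- \<omega> * t) * norm x \<le> K * 1 * norm x"
    using K_nonneg by (intro mult_right_mono mult_left_mono) auto
  then show ?thesis using R_bound[OF assms] by simp
qed

text \<open>Strong continuity handles the change of time at a fixed vector, and the uniform bound on
  the operators handles the change of vector.\<close>

lemma continuous_on_R:
  fixes u :: "'t::topological_space \<Rightarrow> 'x"
  assumes \<tau>: "continuous_on S \<tau>" "\<And>s. s \<in> S \<Longrightarrow> \<tau> s \<ge> 0" and u: "continuous_on S u" "\<And>s. s \<in> S \<Longrightarrow> u s \<in> X"
  shows "continuous_on S (\<lambda>s. R (\<tau> s) (u s))"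
  unfolding continuous_on_def
proof
  fix s0 assume s0: "s0 \<in> S"
  let ?F = "at s0 within S"
  have ev: "\<forall>\<^sub>F s in ?F. s \<in> S" by (simp add: eventually_at_filter)
  have "((\<lambda>s. R (\<tau> s) (u s0)) \<longlongrightarrow> R (\<tau> s0) (u s0)) ?F"
  proof (rule continuous_on_tendsto_compose[OF R_cont[OF u(2)[OF s0]]])
    show "(\<tau> \<longlongrightarrow> \<tau> s0) ?F" using \<tau>(1) s0 by (simp add: continuous_on_def)
    show "\<tau> s0 \<in> {0..}" using \<tau>(2)[OF s0] by simp
    show "\<forall>\<^sub>F s in ?F. \<tau> s \<in> {0..}" using ev by eventually_elim (simp add: \<tau>(2))
  qed
  moreover have "((\<lambda>s. R (\<tau> s) (u s) - R (\<tau> s) (u s0)) \<longlongrightarrow> 0) ?F"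
  proof (rule Lim_null_comparison)
    show "\<forall>\<^sub>F s in ?F. norm (R (\<tau> s) (u s) - R (\<tau> s) (u s0)) \<le> K * norm (u s - u s0)"
      using ev
    proof eventually_elim
      case (elim s)
      then show ?case
        using R_bound'[OF \<tau>(2)[OF elim] subspace_diff[OF subspace_X u(2)[OF elim] u(2)[OF s0]]]
        by (simp add: R_diff \<tau>(2) u(2) s0)
    qed
    have "((\<lambda>s. u s - u s0) \<longlongrightarrow> 0) ?F"
      using u(1) s0 by (intro LIM_zero) (simp add: continuous_on_def)
    then show "((\<lambda>s. K * norm (u s - u s0)) \<longlongrightarrow> 0) ?F"
      by (intro tendsto_mult_right_zero tendsto_norm_zero)
  qed
  ultimately have "((\<lambda>s. R (\<tau> s) (u s0) + (R (\<tau> s) (u s) - R (\<tau> s) (u s0))) \<longlongrightarrow> R (\<tau> s0) (u s0) + 0) ?F"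
    by (rule tendsto_add)
  then show "((\<lambda>s. R (\<tau> s) (u s)) \<longlongrightarrow> R (\<tau> s0) (u s0)) ?F" by simp
qed

section \<open>Convolution on the half-line\<close>

definition conv :: "(real \<Rightarrow> 'x) \<Rightarrow> real \<Rightarrow> 'x" where
  "conv g t = integral {0..t} (\<lambda>s. R (t - s) (g s))"

lemma conv_cong: "(\<And>s. 0 \<le> s \<Longrightarrow> s \<le> t \<Longrightarrow> g s = h s) \<Longrightarrow> conv g t = conv h t"
  unfolding conv_def by (rule integral_cong) simp

lemma conv_continuous_integrand:
  assumes "g \<in> C_half_line X"
  shows "continuous_on {0..t} (\<lambda>s. R (t - s) (g s))"
  using C_half_lineD[OF assms]
  by (intro continuous_on_R continuous_intros) (auto intro: continuous_on_subset)

lemma conv_integrable: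
  assumes "g \<in> C_half_line X"
  shows "(\<lambda>s. R (t - s) (g s)) integrable_on {0..t}"
  by (rule integrable_continuous_interval[OF conv_continuous_integrand[OF assms]])

lemma conv_in:
  assumes "g \<in> C_half_line X"
  shows "conv g t \<in> X"
  unfolding conv_def
  using C_half_lineD(2)[OF assms]
  by (intro integral_in_closed_subspace[OF closed_X subspace_X conv_integrable[OF assms]] R_in) auto

lemma conv_add:
  assumes "g \<in> C_half_line X" "h \<in> C_half_line X"
  shows "conv (\<lambda>s. g s + h s) t = conv g t + conv h t"
proof -
  have "conv (\<lambda>s. g s + h s) t = integral {0..t} (\<lambda>s. R (t - s) (g s) + R (t - s) (h s))"
    unfolding conv_def using C_half_lineD(2)[OF assms(1)] C_half_lineD(2)[OF assms(2)]
    by (intro integral_cong R_add) auto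
  also have "\<dots> = conv g t + conv h t"
    unfolding conv_def by (intro Henstock_Kurzweil_Integration.integral_add conv_integrable assms)
  finally show ?thesis .
qed

lemma conv_diff:
  assumes "g \<in> C_half_line X" "h \<in> C_half_line X"
  shows "conv (\<lambda>s. g s - h s) t = conv g t - conv h t"
proof -
  have "conv (\<lambda>s. g s - h s) t = integral {0..t} (\<lambda>s. R (t - s) (g s) - R (t - s) (h s))"
    unfolding conv_def using C_half_lineD(2)[OF assms(1)] C_half_lineD(2)[OF assms(2)]
    by (intro integral_cong R_diff) auto
  also have "\<dots> = conv g t - conv h t"
    unfolding conv_def by (intro Henstock_Kurzweil_Integration.integral_diff conv_integrable assms)
  finally show ?thesis .
qed

text \<open>The substitution s = t \<sigma> moves t from the limit of integration into the
  integrand, so that continuity of parameter integrals over [0, 1] applies.\<close>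

lemma conv_continuous:
  assumes g: "g \<in> C_half_line X"
  shows "continuous_on {0..} (conv g)"
proof -
  have "continuous_on ({0..} \<times> cbox 0 1) (\<lambda>p::real \<times> real. R (fst p - fst p * snd p) (g (fst p * snd p)))"
  proof (rule continuous_on_R)
    show "continuous_on ({0..} \<times> cbox 0 1) (\<lambda>p::real \<times> real. g (fst p * snd p))"
      by (rule continuous_on_compose2[OF C_half_lineD(1)[OF g]]) (auto intro!: continuous_intros)
  qed (use C_half_lineD(2)[OF g] in \<open>auto intro!: continuous_intros mult_left_le\<close>)
  then have "continuous_on {0..} (\<lambda>t::real. integral (cbox 0 1) (\<lambda>\<sigma>. R (t - t * \<sigma>) (g (t * \<sigma>))))"
    by (intro integral_continuous_on_param) (simp add: case_prod_unfold)
  then have "continuous_on {0..} (\<lambda>t::real. t *\<^sub>R integral {0..1} (\<lambda>\<sigma>. R (t - t * \<sigma>) (g (t * \<sigma>))))"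
    by (intro continuous_intros) simp
  moreover have "t *\<^sub>R integral {0..1} (\<lambda>\<sigma>. R (t - t * \<sigma>) (g (t * \<sigma>))) = conv g t" if "t \<ge> 0" for t
  proof (cases "t = 0")
    case False
    then have "t > 0" using that by simp
    have "((\<lambda>s. R (t - s) (g s)) has_integral conv g t) (cbox 0 t)"
      unfolding conv_def using integrable_integral[OF conv_integrable[OF g]] by simp
    from has_integral_affinity'[OF this \<open>t > 0\<close>, of 0]
    have "((\<lambda>\<sigma>. R (t - t * \<sigma>) (g (t * \<sigma>))) has_integral (conv g t /\<^sub>R t)) {0..1}"
      using \<open>t > 0\<close> by simp
    then show ?thesis using \<open>t > 0\<close> by (simp add: integral_unique)
  qed (simp add: conv_def)
  ultimately show ?thesis by (rule continuous_on_eq) simp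
qed

lemma conv_C0:
  assumes \<phi>: "\<phi> \<in> C0_half_line X"
  shows "conv \<phi> \<in> C0_half_line X"
proof (rule C0_half_lineI)
  have C: "\<phi> \<in> C_half_line X" using \<phi> by (simp add: C0_half_line_def)
  show "continuous_on {0..} (conv \<phi>)" by (rule conv_continuous[OF C])
  show "conv \<phi> t \<in> X" for t by (rule conv_in[OF C])
  obtain c where c: "\<And>t. t \<ge> 0 \<Longrightarrow> norm (\<phi> t) \<le> c"
    using C0_half_line_bounded[OF \<phi>] unfolding bounded_iff by auto
  have "c \<ge> 0" using c[of 0] norm_ge_zero[of "\<phi> 0"] by linarith
  show "(conv \<phi> \<longlongrightarrow> 0) at_top"
    unfolding tendsto_iff
  proof (intro allI impI)
    fix e :: real assume e: "e > 0"
    \<comment> \<open>Makes K \<epsilon> / \<omega> at most e / 2; the 1 in K + 1 covers K =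
      0.\<close>
    define \<epsilon> where "\<epsilon> = e * \<omega> / (2 * (K + 1))"
    have "\<epsilon> > 0" using e \<omega>_pos K_nonneg by (simp add: \<epsilon>_def)
    have "\<forall>\<^sub>F t in at_top. dist (\<phi> t) 0 < \<epsilon>"
      by (rule tendstoD[OF C0_half_lineD(3)[OF \<phi>] \<open>\<epsilon> > 0\<close>])
    then obtain N where N: "\<And>t. t \<ge> N \<Longrightarrow> norm (\<phi> t) < \<epsilon>"
      by (auto simp: eventually_at_top_linorder)
    \<comment> \<open>A single bound replaces splitting the integral at N: before N the exponential
      is at least 1. Its rate matches the decay of R, so this part of the integrand is constant in s
      and contributes a multiple of t exp (-\<omega> t).\<close>
    have pt: "norm (\<phi> s) \<le> \<epsilon> + c * exp (\<omega> * (N - s))" if "s \<ge> 0" for s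
    proof (cases "s \<ge> N")
      case True
      then show ?thesis using N[of s] \<open>c \<ge> 0\<close> by (smt (verit) exp_ge_zero mult_nonneg_nonneg)
    next
      case False
      then have "1 \<le> exp (\<omega> * (N - s))" using \<omega>_pos by simp
      then have "c * 1 \<le> c * exp (\<omega> * (N - s))" using \<open>c \<ge> 0\<close> by (rule mult_left_mono)
      then show ?thesis using c[OF that] \<open>\<epsilon> > 0\<close> by linarith
    qed
    have bound: "norm (conv \<phi> t) \<le> K * \<epsilon> / \<omega> + K * c * exp (\<omega> * N) * (t * exp (- \<omega> * t))" if t: "t \<ge> 0" for t
    proof -
      have hi: "((\<lambda>s. K * \<epsilon> * exp (- \<omega> * (t - s)) + K * c * exp (\<omega> * N) * exp (- \<omega> * t)) has_integral
          (K * \<epsilon> * ((1 - exp (- \<omega> * t)) / \<omega>) + K * c * exp (\<omega> * N) * exp (- \<omega> * t) * t)) {0..t}"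
        using t by (intro has_integral_add has_integral_mult_right has_integral_exp_shift \<omega>_pos)
          (use has_integral_const_real[of "K * c * exp (\<omega> * N) * exp (- \<omega> * t)" 0 t] in \<open>simp_all add: mult.commute\<close>)
      have "norm (conv \<phi> t) \<le> integral {0..t} (\<lambda>s. K * \<epsilon> * exp (- \<omega> * (t - s)) + K * c * exp (\<omega> * N) * exp (- \<omega> * t))"
        unfolding conv_def
      proof (rule integral_norm_bound_integral[OF conv_integrable[OF C] has_integral_integrable[OF hi]])
        fix s assume s: "s \<in> {0..t}"
        have "norm (R (t - s) (\<phi> s)) \<le> K * exp (- \<omega> * (t - s)) * norm (\<phi> s)"
          using s C0_half_lineD(2)[OF \<phi>] by (intro R_bound) auto
        also have "\<dots> \<le> K * exp (- \<omega> * (t - s)) * (\<epsilon> + c * exp (\<omega> * (N - s)))"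
          using s K_nonneg by (intro mult_left_mono pt) auto
        also have "\<dots> = K * \<epsilon> * exp (- \<omega> * (t - s)) + K * c * (exp (- \<omega> * (t - s)) * exp (\<omega> * (N - s)))"
          by (simp add: algebra_simps)
        also have "exp (- \<omega> * (t - s)) * exp (\<omega> * (N - s)) = exp (\<omega> * N) * exp (- \<omega> * t)"
          by (simp add: algebra_simps flip: exp_add)
        finally show "norm (R (t - s) (\<phi> s)) \<le> K * \<epsilon> * exp (- \<omega> * (t - s)) + K * c * exp (\<omega> * N) * exp (- \<omega> * t)"
          by (simp add: mult.assoc)
      qed
      also have "\<dots> = K * \<epsilon> * ((1 - exp (- \<omega> * t)) / \<omega>) + K * c * exp (\<omega> * N) * exp (- \<omega> * t) * t"
        by (rule integral_unique[OF hi])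
      also have "K * \<epsilon> * ((1 - exp (- \<omega> * t)) / \<omega>) \<le> K * \<epsilon> * (1 / \<omega>)"
        using \<omega>_pos K_nonneg \<open>\<epsilon> > 0\<close> by (intro mult_left_mono divide_right_mono) auto
      finally show ?thesis by (simp add: algebra_simps)
    qed
    have "((\<lambda>t. t * exp (- \<omega> * t)) \<longlongrightarrow> 0) at_top"
    proof -
      have lim: "((\<lambda>x::real. x ^ 1 / exp x) \<longlongrightarrow> 0) at_top" by (rule tendsto_power_div_exp_0)
      have "filterlim (\<lambda>t. \<omega> * t) at_top at_top"
        by (rule filterlim_tendsto_pos_mult_at_top[OF tendsto_const \<omega>_pos filterlim_ident])
      from tendsto_mult_right_zero[OF filterlim_compose[OF lim this], of "1 / \<omega>"]
      have "((\<lambda>t. (1 / \<omega>) * (\<omega> * t / exp (\<omega> * t))) \<longlongrightarrow> 0) at_top"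
        by (simp only: power_one_right)
      then show ?thesis using \<omega>_pos by (simp add: exp_minus field_simps)
    qed
    then have "((\<lambda>t. K * c * exp (\<omega> * N) * (t * exp (- \<omega> * t))) \<longlongrightarrow> 0) at_top"
      by (rule tendsto_mult_right_zero)
    then have "\<forall>\<^sub>F t in at_top. K * c * exp (\<omega> * N) * (t * exp (- \<omega> * t)) < e / 2"
      using e by (intro order_tendstoD(2)) auto
    then show "\<forall>\<^sub>F t in at_top. dist (conv \<phi> t) 0 < e"
      using eventually_ge_at_top[of 0]
    proof eventually_elim
      case (elim t)
      have "K * \<epsilon> / \<omega> = (e / 2) * (K / (K + 1))"
        using \<omega>_pos K_nonneg by (simp add: \<epsilon>_def mult.commute)
      also have "\<dots> \<le> (e / 2) * 1"
        using e K_nonneg by (intro mult_left_mono) auto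
      finally have "norm (conv \<phi> t) < e" using bound[OF elim(2)] elim(1) by linarith
      then show ?case by simp
    qed
  qed
qed

lemma R_C0:
  assumes "x \<in> X"
  shows "(\<lambda>t. R t x) \<in> C0_half_line X"
proof (rule C0_half_lineI[OF R_cont[OF assms]])
  show "R t x \<in> X" if "t \<ge> 0" for t by (rule R_in[OF that assms])
  show "((\<lambda>t. R t x) \<longlongrightarrow> 0) at_top"
  proof (rule Lim_null_comparison)
    show "\<forall>\<^sub>F t in at_top. norm (R t x) \<le> K * exp (- \<omega> * t) * norm x"
      using eventually_ge_at_top[of 0] by eventually_elim (rule R_bound[OF _ assms])
    show "((\<lambda>t. K * exp (- \<omega> * t) * norm x) \<longlongrightarrow> 0) at_top"
      by (intro tendsto_mult_left_zero tendsto_mult_right_zero exp_neg_mult_tendsto_0 \<omega>_pos)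
  qed
qed

section \<open>Convolution over the whole past\<close>

lemma translate_integrand_continuous:
  assumes "g \<in> AA X" "a \<ge> 0"
  shows "continuous_on {a..b} (\<lambda>s. R s (g (t - s)))"
proof (rule continuous_on_R)
  show "continuous_on {a..b} (\<lambda>s. g (t - s))"
    by (rule continuous_on_compose2[OF AAD(2)[OF assms(1)]]) (auto intro!: continuous_intros)
qed (use assms AAD(1)[OF assms(1)] in \<open>auto intro: continuous_intros\<close>)

lemma translate_integrable:
  "g \<in> AA X \<Longrightarrow> a \<ge> 0 \<Longrightarrow> (\<lambda>s. R s (g (t - s))) integrable_on {a..b}"
  by (rule integrable_continuous_interval[OF translate_integrand_continuous])

text \<open>Here s is the delay, so translating g leaves the kernel alone. The cutoff N is real
  because N = t recovers \<open>conv g t\<close>.\<close>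

definition partial_conv :: "(real \<Rightarrow> 'x) \<Rightarrow> real \<Rightarrow> real \<Rightarrow> 'x" where
  "partial_conv g N t = integral {0..N} (\<lambda>s. R s (g (t - s)))"

text \<open>Substituting \<open>t - s\<close> for \<open>s\<close>, this is \<open>\<integral>\<^bsub>-\<infinity>\<^esub>\<^sup>t R(t - s) g(s) ds\<close>.\<close>

definition full_conv :: "(real \<Rightarrow> 'x) \<Rightarrow> real \<Rightarrow> 'x" where
  "full_conv g t = lim (\<lambda>n. partial_conv g (real n) t)"

lemma partial_conv_tail:
  assumes g: "g \<in> AA X" and c: "\<And>t. norm (g t) \<le> c" and N: "0 \<le> N" "N \<le> N'"
  shows "norm (partial_conv g N' t - partial_conv g N t) \<le> K * c / \<omega> * exp (- \<omega> * N)"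
proof -
  have "c \<ge> 0" using c[of 0] norm_ge_zero[of "g 0"] by linarith
  have hi: "((\<lambda>s. K * exp (- \<omega> * s) * c) has_integral K * (- exp (- \<omega> * N') / \<omega> - - exp (- \<omega> * N) / \<omega>) * c) {N..N'}"
    using \<omega>_pos N
    by (intro has_integral_mult_left has_integral_mult_right fundamental_theorem_of_calculus)
       (auto intro!: derivative_eq_intros simp flip: has_real_derivative_iff_has_vector_derivative)
  have "partial_conv g N' t = partial_conv g N t + integral {N..N'} (\<lambda>s. R s (g (t - s)))"
    unfolding partial_conv_def
    by (rule Henstock_Kurzweil_Integration.integral_combine[symmetric]) (use N translate_integrable[OF g] in auto)
  then have "norm (partial_conv g N' t - partial_conv g N t) = norm (integral {N..N'} (\<lambda>s. R s (g (t - s))))"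
    by simp
  also have "\<dots> \<le> integral {N..N'} (\<lambda>s. K * exp (- \<omega> * s) * c)"
  proof (rule integral_norm_bound_integral[OF translate_integrable[OF g N(1)] has_integral_integrable[OF hi]])
    fix s assume s: "s \<in> {N..N'}"
    have "norm (R s (g (t - s))) \<le> K * exp (- \<omega> * s) * norm (g (t - s))"
      using s N AAD(1)[OF g] by (intro R_bound) auto
    also have "\<dots> \<le> K * exp (- \<omega> * s) * c"
      using K_nonneg by (intro mult_left_mono c) auto
    finally show "norm (R s (g (t - s))) \<le> K * exp (- \<omega> * s) * c" .
  qed
  also have "\<dots> = K * c * (exp (- \<omega> * N) / \<omega> - exp (- \<omega> * N') / \<omega>)"
    unfolding integral_unique[OF hi] by (simp add: algebra_simps)
  also have "\<dots> \<le> K * c * (exp (- \<omega> * N) / \<omega>)"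
    using K_nonneg \<open>c \<ge> 0\<close> \<omega>_pos by (intro mult_left_mono) auto
  finally show ?thesis by simp
qed

lemma partial_conv_LIMSEQ:
  assumes g: "g \<in> AA X"
  shows "(\<lambda>n. partial_conv g (real n) t) \<longlonglongrightarrow> full_conv g t"
proof -
  obtain c where c: "\<And>t. norm (g t) \<le> c"
    using AAD(3)[OF g] unfolding bounded_iff by auto
  have "(\<lambda>n. exp (- \<omega> * real n)) \<longlonglongrightarrow> 0"
    by (rule filterlim_compose[OF exp_neg_mult_tendsto_0[OF \<omega>_pos] filterlim_real_sequentially])
  then have lim: "(\<lambda>n. K * c / \<omega> * exp (- \<omega> * real n)) \<longlonglongrightarrow> 0"
    by (rule tendsto_mult_right_zero)
  have "Cauchy (\<lambda>n. partial_conv g (real n) t)"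
    unfolding Cauchy_altdef2
  proof (intro allI impI)
    fix e :: real assume "e > 0"
    then have "\<forall>\<^sub>F n in sequentially. K * c / \<omega> * exp (- \<omega> * real n) < e"
      by (intro order_tendstoD(2)[OF lim])
    then obtain N where N: "K * c / \<omega> * exp (- \<omega> * real N) < e"
      by (auto simp: eventually_sequentially)
    have "dist (partial_conv g (real n) t) (partial_conv g (real N) t) < e" if "n \<ge> N" for n
      using partial_conv_tail[OF g c, of "real N" "real n" t] that N by (simp add: dist_norm)
    then show "\<exists>N. \<forall>n\<ge>N. dist (partial_conv g (real n) t) (partial_conv g (real N) t) < e" by blast
  qed
  then show ?thesis
    unfolding full_conv_def by (intro convergent_LIMSEQ_iff[THEN iffD1] Cauchy_convergent)
qed

text \<open>N = 0 bounds \<open>full_conv g\<close>, and N = t bounds its distance from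
  \<open>conv g\<close>.\<close>

lemma full_conv_tail:
  assumes g: "g \<in> AA X" and c: "\<And>t. norm (g t) \<le> c" and N: "0 \<le> N"
  shows "norm (full_conv g t - partial_conv g N t) \<le> K * c / \<omega> * exp (- \<omega> * N)"
proof (rule Lim_norm_ubound[OF _ tendsto_diff[OF partial_conv_LIMSEQ[OF g] tendsto_const]])
  have "\<forall>\<^sub>F n in sequentially. real n \<ge> N"
    using filterlim_real_sequentially by (simp add: filterlim_at_top)
  then show "\<forall>\<^sub>F n in sequentially. norm (partial_conv g (real n) t - partial_conv g N t) \<le> K * c / \<omega> * exp (- \<omega> * N)"
    by eventually_elim (rule partial_conv_tail[OF g c N])
qed simp

text \<open>At each cutoff the norm is moved under the integral by linearity of R, and the resulting
  real integral is bounded uniformly in the cutoff.\<close>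

lemma full_conv_diff_bound:
  assumes g: "g \<in> AA X"
  shows "norm (full_conv g t1 - full_conv g t2) \<le> K * exp_weighted \<omega> (\<lambda>s. norm (g (t1 - s) - g (t2 - s)))"
proof (rule Lim_norm_ubound[OF _ tendsto_diff[OF partial_conv_LIMSEQ[OF g] partial_conv_LIMSEQ[OF g]]])
  let ?h = "\<lambda>s. norm (g (t1 - s) - g (t2 - s))"
  obtain c where c: "\<And>t. norm (g t) \<le> c"
    using AAD(3)[OF g] unfolding bounded_iff by auto
  have h: "?h s \<le> c + c" for s
    using norm_triangle_ineq4[of "g (t1 - s)" "g (t2 - s)"] c[of "t1 - s"] c[of "t2 - s"] by linarith
  have gc: "continuous_on A (\<lambda>s. g (t - s))" for t A
    by (rule continuous_on_compose2[OF AAD(2)[OF g]]) (auto intro!: continuous_intros)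
  have "norm (partial_conv g (real n) t1 - partial_conv g (real n) t2) \<le> K * exp_weighted \<omega> ?h" for n
  proof -
    have int: "(\<lambda>s. K * (exp (- \<omega> * s) * ?h s)) integrable_on {0..real n}"
      by (intro integrable_continuous_interval continuous_intros gc)
    have "partial_conv g (real n) t1 - partial_conv g (real n) t2
        = integral {0..real n} (\<lambda>s. R s (g (t1 - s)) - R s (g (t2 - s)))"
      unfolding partial_conv_def
      by (rule Henstock_Kurzweil_Integration.integral_diff[symmetric]) (auto intro: translate_integrable[OF g])
    also have "norm \<dots> \<le> integral {0..real n} (\<lambda>s. K * (exp (- \<omega> * s) * ?h s))"
    proof (rule integral_norm_bound_integral[OF _ int])
      show "(\<lambda>s. R s (g (t1 - s)) - R s (g (t2 - s))) integrable_on {0..real n}"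
        by (intro Henstock_Kurzweil_Integration.integrable_diff translate_integrable[OF g]) auto
      show "norm (R s (g (t1 - s)) - R s (g (t2 - s))) \<le> K * (exp (- \<omega> * s) * ?h s)" if "s \<in> {0..real n}" for s
        using that R_bound[OF _ subspace_diff[OF subspace_X AAD(1)[OF g] AAD(1)[OF g]], of s "t1 - s" "t2 - s"]
        by (simp add: R_diff AAD(1)[OF g] mult.assoc)
    qed
    also have "\<dots> = K * integral {0..real n} (\<lambda>s. exp (- \<omega> * s) * ?h s)" by simp
    also have "\<dots> \<le> K * exp_weighted \<omega> ?h"
      by (intro mult_left_mono[OF _ K_nonneg] integral_le_exp_weighted[OF \<omega>_pos _ _ h] continuous_intros gc) auto
    finally show ?thesis .
  qed
  then show "\<forall>\<^sub>F n in sequentially. norm (partial_conv g (real n) t1 - partial_conv g (real n) t2) \<le> K * exp_weighted \<omega> ?h"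
    by simp
qed simp

lemma full_conv_in:
  assumes g: "g \<in> AA X"
  shows "full_conv g t \<in> X"
proof (rule closed_sequentially[OF closed_X _ partial_conv_LIMSEQ[OF g]])
  show "partial_conv g (real n) t \<in> X" for n
    unfolding partial_conv_def using AAD(1)[OF g]
    by (intro integral_in_closed_subspace[OF closed_X subspace_X translate_integrable[OF g]] R_in) auto
qed

text \<open>The pointwise limits of translates of \<open>g\<close> need not be continuous. Therefore the translates of
  \<open>full_conv g\<close> are compared only through the real integrals of \<open>full_conv_diff_bound\<close>, to which
  dominated convergence applies.\<close>

lemma full_conv_AA:
  assumes g: "g \<in> AA X"
  shows "full_conv g \<in> AA X"
proof (rule AAI)
  obtain c where c: "\<And>t. norm (g t) \<le> c"
    using AAD(3)[OF g] unfolding bounded_iff by auto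
  have gm [measurable]: "(\<lambda>s. norm (g (t1 - s) - g (t2 - s))) \<in> borel_measurable borel" for t1 t2
    by (intro borel_measurable_continuous_onI continuous_intros continuous_on_compose2[OF AAD(2)[OF g]]) auto
  have dist_c: "\<bar>norm (x - y)\<bar> \<le> 2 * c" if "norm x \<le> c" "norm y \<le> c" for x y :: 'x
    using that norm_triangle_ineq4[of x y] by simp
  have W0: "exp_weighted \<omega> (\<lambda>_. 0) = 0" by (simp add: exp_weighted_def)
  show "full_conv g t \<in> X" for t by (rule full_conv_in[OF g])
  show "continuous_on UNIV (full_conv g)"
  proof (intro continuous_at_imp_continuous_on ballI continuous_at_sequentiallyI)
    fix t and u :: "nat \<Rightarrow> real" assume u: "u \<longlonglongrightarrow> t"
    have "(\<lambda>n. exp_weighted \<omega> (\<lambda>s. norm (g (u n - s) - g (t - s)))) \<longlonglongrightarrow> exp_weighted \<omega> (\<lambda>_. 0)"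
    proof (rule exp_weighted_tendsto[OF \<omega>_pos _ _ dist_c[OF c c]])
      fix s
      have "(\<lambda>n. g (u n - s)) \<longlonglongrightarrow> g (t - s)"
        by (rule continuous_on_tendsto_compose[OF AAD(2)[OF g]]) (auto intro!: tendsto_intros u)
      then show "(\<lambda>n. norm (g (u n - s) - g (t - s))) \<longlonglongrightarrow> 0"
        by (intro tendsto_norm_zero LIM_zero)
    qed auto
    then have "(\<lambda>n. K * exp_weighted \<omega> (\<lambda>s. norm (g (u n - s) - g (t - s)))) \<longlonglongrightarrow> 0"
      unfolding W0 by (rule tendsto_mult_right_zero)
    then have "(\<lambda>n. full_conv g (u n) - full_conv g t) \<longlonglongrightarrow> 0"
      by (rule Lim_null_comparison[rotated]) (simp add: full_conv_diff_bound[OF g])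
    then show "(\<lambda>n. full_conv g (u n)) \<longlonglongrightarrow> full_conv g t"
      by (simp add: LIM_zero_iff)
  qed
  have "norm (full_conv g t) \<le> K * c / \<omega>" for t
    using full_conv_tail[OF g c, of 0 t] by (simp add: partial_conv_def)
  then show "bounded (range (full_conv g))" unfolding bounded_iff by blast
  fix \<sigma> :: "nat \<Rightarrow> real"
  obtain r g' where r: "strict_mono r" and "\<And>t. g' t \<in> X"
    and lim: "\<And>t. (\<lambda>n. g (t + \<sigma> (r n))) \<longlonglongrightarrow> g' t" "\<And>t. (\<lambda>n. g' (t - \<sigma> (r n))) \<longlonglongrightarrow> g t"
    using AA_subseqE[OF g] by metis
  define \<tau> where "\<tau> n = \<sigma> (r n)" for n
  note lim = lim[folded \<tau>_def]
  have c': "norm (g' t) \<le> c" for t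
    by (rule Lim_norm_ubound[OF _ lim(1)]) (simp_all add: c)
  have lim_diff: "(\<lambda>n. norm (g (t1 + \<tau> n - s) - y)) \<longlonglongrightarrow> norm (g' (t1 - s) - y)" for t1 s y
    using lim(1)[of "t1 - s"] by (intro tendsto_intros) (simp add: algebra_simps)
  \<comment> \<open>Only these real functions are shown to be measurable, as pointwise limits of
    continuous ones; no integral of the vector-valued g' is formed.\<close>
  have g'm [measurable]: "(\<lambda>s. norm (g' (t1 - s) - g (t2 - s))) \<in> borel_measurable borel" for t1 t2
    by (rule borel_measurable_LIMSEQ_real[where u = "\<lambda>n s. norm (g (t1 + \<tau> n - s) - g (t2 - s))"])
      (auto intro: lim_diff)
  define D where "D t n = (\<lambda>s. norm (g' (t - s) - g (t + \<tau> n - s)))" for t n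
  have D0: "(\<lambda>n. exp_weighted \<omega> (D t n)) \<longlonglongrightarrow> 0" for t
  proof -
    have "(\<lambda>n. exp_weighted \<omega> (D t n)) \<longlonglongrightarrow> exp_weighted \<omega> (\<lambda>_. 0)"
      unfolding D_def
    proof (rule exp_weighted_tendsto[OF \<omega>_pos _ _ dist_c[OF c' c]])
      show "(\<lambda>n. norm (g' (t - s) - g (t + \<tau> n - s))) \<longlonglongrightarrow> 0" for s
        using lim_diff[of t s "g' (t - s)"] by (simp add: norm_minus_commute)
    qed auto
    then show ?thesis unfolding W0 .
  qed
  \<comment> \<open>The limit of the translates is defined directly rather than as a convolution
    with g', whose integral might not exist; it exists by the Cauchy criterion, with g' as
    intermediary inside the norms.\<close>
  define G where "G t = lim (\<lambda>n. full_conv g (t + \<tau> n))" for t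
  have G: "(\<lambda>n. full_conv g (t + \<tau> n)) \<longlonglongrightarrow> G t" for t
  proof -
    have bound: "norm (full_conv g (t + \<tau> m) - full_conv g (t + \<tau> n))
        \<le> K * (exp_weighted \<omega> (D t m) + exp_weighted \<omega> (D t n))" for m n
    proof -
      have "exp_weighted \<omega> (\<lambda>s. norm (g (t + \<tau> m - s) - g (t + \<tau> n - s)))
          \<le> exp_weighted \<omega> (D t m) + exp_weighted \<omega> (D t n)"
      proof (rule exp_weighted_triangle[OF \<omega>_pos])
        show "norm (g (t + \<tau> m - s) - g (t + \<tau> n - s)) \<le> D t m s + D t n s" for s
          unfolding D_def using norm_triangle_ineq[of "g (t + \<tau> m - s) - g' (t - s)" "g' (t - s) - g (t + \<tau> n - s)"]
          by (simp add: norm_minus_commute)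
      qed (auto simp only: D_def intro: dist_c[OF c' c] gm g'm norm_ge_zero)
      then show ?thesis
        using full_conv_diff_bound[OF g, of "t + \<tau> m" "t + \<tau> n"] K_nonneg
        by (meson mult_left_mono order_trans)
    qed
    have "Cauchy (\<lambda>n. full_conv g (t + \<tau> n))"
    proof (rule metric_CauchyI)
      fix e :: real assume "e > 0"
      have "(\<lambda>n. K * exp_weighted \<omega> (D t n)) \<longlonglongrightarrow> 0"
        by (rule tendsto_mult_right_zero[OF D0])
      then have "\<forall>\<^sub>F n in sequentially. K * exp_weighted \<omega> (D t n) < e / 2"
        using \<open>e > 0\<close> by (intro order_tendstoD(2)) auto
      then obtain N where N: "\<And>n. n \<ge> N \<Longrightarrow> K * exp_weighted \<omega> (D t n) < e / 2"
        by (auto simp: eventually_sequentially)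
      have "dist (full_conv g (t + \<tau> m)) (full_conv g (t + \<tau> n)) < e" if "m \<ge> N" "n \<ge> N" for m n
        using bound[of m n] N[OF that(1)] N[OF that(2)] by (simp add: dist_norm distrib_left)
      then show "\<exists>N. \<forall>m\<ge>N. \<forall>n\<ge>N. dist (full_conv g (t + \<tau> m)) (full_conv g (t + \<tau> n)) < e" by blast
    qed
    then show ?thesis
      unfolding G_def by (intro convergent_LIMSEQ_iff[THEN iffD1] Cauchy_convergent)
  qed
  have G_in: "G t \<in> X" for t
    by (rule closed_sequentially[OF closed_X _ G]) (rule full_conv_in[OF g])
  have "(\<lambda>m. G (t - \<tau> m)) \<longlonglongrightarrow> full_conv g t" for t
  proof -
    \<comment> \<open>With m fixed, letting n tend to infinity turns the translates of g into g' on
      the right and those of \<open>full_conv g\<close> into G on the left.\<close>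
    have bound: "norm (G (t - \<tau> m) - full_conv g t) \<le> K * exp_weighted \<omega> (\<lambda>s. norm (g' (t - \<tau> m - s) - g (t - s)))" for m
    proof (rule LIMSEQ_le)
      show "(\<lambda>n. norm (full_conv g (t - \<tau> m + \<tau> n) - full_conv g t)) \<longlonglongrightarrow> norm (G (t - \<tau> m) - full_conv g t)"
        by (intro tendsto_intros G)
      show "(\<lambda>n. K * exp_weighted \<omega> (\<lambda>s. norm (g (t - \<tau> m + \<tau> n - s) - g (t - s))))
          \<longlonglongrightarrow> K * exp_weighted \<omega> (\<lambda>s. norm (g' (t - \<tau> m - s) - g (t - s)))"
        by (intro tendsto_mult_left exp_weighted_tendsto[OF \<omega>_pos _ _ dist_c[OF c c]] lim_diff) auto
      show "\<exists>N. \<forall>n\<ge>N. norm (full_conv g (t - \<tau> m + \<tau> n) - full_conv g t)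
          \<le> K * exp_weighted \<omega> (\<lambda>s. norm (g (t - \<tau> m + \<tau> n - s) - g (t - s)))"
        using full_conv_diff_bound[OF g] by blast
    qed
    have "(\<lambda>m. exp_weighted \<omega> (\<lambda>s. norm (g' (t - \<tau> m - s) - g (t - s)))) \<longlonglongrightarrow> exp_weighted \<omega> (\<lambda>_. 0)"
    proof (rule exp_weighted_tendsto[OF \<omega>_pos _ _ dist_c[OF c' c]])
      fix s
      have "(\<lambda>m. g' (t - \<tau> m - s)) \<longlonglongrightarrow> g (t - s)"
        using lim(2)[of "t - s"] by (simp add: algebra_simps)
      then show "(\<lambda>m. norm (g' (t - \<tau> m - s) - g (t - s))) \<longlonglongrightarrow> 0"
        by (intro tendsto_norm_zero LIM_zero)
    qed auto
    then have "(\<lambda>m. K * exp_weighted \<omega> (\<lambda>s. norm (g' (t - \<tau> m - s) - g (t - s)))) \<longlonglongrightarrow> 0"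
      unfolding W0 by (rule tendsto_mult_right_zero)
    then have "(\<lambda>m. G (t - \<tau> m) - full_conv g t) \<longlonglongrightarrow> 0"
      by (rule Lim_null_comparison[rotated]) (simp add: bound)
    then show ?thesis by (simp add: LIM_zero_iff)
  qed
  then show "\<exists>r G. strict_mono r \<and> (\<forall>t. G t \<in> X) \<and> (\<forall>t. (\<lambda>n. full_conv g (t + \<sigma> (r n))) \<longlonglongrightarrow> G t) \<and>
             (\<forall>t. (\<lambda>n. G (t - \<sigma> (r n))) \<longlonglongrightarrow> full_conv g t)"
    using r G_in G unfolding \<tau>_def by blast
qed

lemma conv_AAA:
  assumes u: "u \<in> AAA X"
  shows "conv u \<in> AAA X"
proof -
  obtain g \<phi> where g: "g \<in> AA X" and \<phi>: "\<phi> \<in> C0_half_line X" and u': "\<And>t. t \<ge> 0 \<Longrightarrow> u t = g t + \<phi> t"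
    using AAA_E[OF u] by metis
  have gC: "g \<in> C_half_line X"
    using AAD[OF g] by (auto simp: C_half_line_def intro: continuous_on_subset)
  have \<phi>C: "\<phi> \<in> C_half_line X" using \<phi> by (simp add: C0_half_line_def)
  obtain c where c: "\<And>t. norm (g t) \<le> c"
    using AAD(3)[OF g] unfolding bounded_iff by auto
  \<comment> \<open>After reflection, \<open>conv g t\<close> is the integral over the whole past
    cut off at delay t; the part cut off decays exponentially.\<close>
  have eq: "conv g t = partial_conv g t t" for t
  proof -
    have "(\<lambda>s. R s (g (t - s))) integrable_on {0..t}" by (rule translate_integrable[OF g]) simp
    from integral_reflect_interval[OF this] show ?thesis by (simp add: conv_def partial_conv_def)
  qed
  define \<psi> where "\<psi> t = conv g t - full_conv g t" for t
  have "\<psi> \<in> C0_half_line X"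
  proof (rule C0_half_lineI)
    show "continuous_on {0..} \<psi>"
      unfolding \<psi>_def using AAD(2)[OF full_conv_AA[OF g]]
      by (intro continuous_on_diff conv_continuous[OF gC]) (auto intro: continuous_on_subset)
    show "\<psi> t \<in> X" for t
      unfolding \<psi>_def by (intro subspace_diff[OF subspace_X] conv_in[OF gC] full_conv_in[OF g])
    show "(\<psi> \<longlongrightarrow> 0) at_top"
    proof (rule Lim_null_comparison)
      show "\<forall>\<^sub>F t in at_top. norm (\<psi> t) \<le> K * c / \<omega> * exp (- \<omega> * t)"
        using eventually_ge_at_top[of 0]
      proof eventually_elim
        case (elim t)
        then show ?case using full_conv_tail[OF g c elim, of t] by (simp add: \<psi>_def eq norm_minus_commute)
      qed
      show "((\<lambda>t. K * c / \<omega> * exp (- \<omega> * t)) \<longlongrightarrow> 0) at_top"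
        by (intro tendsto_mult_right_zero exp_neg_mult_tendsto_0 \<omega>_pos)
    qed
  qed
  then have conv_g: "conv g \<in> AAA X"
    unfolding AAA_iff using full_conv_AA[OF g] by (intro bexI[of _ "full_conv g"] bexI[of _ \<psi>]) (auto simp: \<psi>_def)
  have "(\<lambda>t. conv g t + conv \<phi> t) \<in> AAA X"
    by (intro AAA_add conv_g C0_half_line_subset_AAA conv_C0 \<phi> subspace_X)
  moreover have "conv u t = conv g t + conv \<phi> t" for t
  proof -
    have "conv u t = conv (\<lambda>s. g s + \<phi> s) t" by (rule conv_cong) (simp add: u')
    then show ?thesis by (simp add: conv_add[OF gC \<phi>C])
  qed
  ultimately show ?thesis by (auto intro: AAA_cong)
qed

end

section \<open>The fixed point\<close>

lemma state_norm_nonneg: "0 \<le> state_norm u"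
  by (simp add: state_norm_def le_max_iff_disj)

lemma state_norm_zero_iff: "state_norm u = 0 \<longleftrightarrow> u = 0"
  by (cases u) (auto simp: state_norm_def max_def zero_prod_def)

lemma state_norm_zero [simp]: "state_norm 0 = 0"
  by (simp add: state_norm_zero_iff)

lemma state_norm_triangle: "state_norm (u + v) \<le> state_norm u + state_norm v"
  using norm_triangle_ineq[of "fst u" "fst v"] norm_triangle_ineq[of "snd u" "snd v"]
  by (auto simp: state_norm_def max_def)

lemma state_norm_minus_commute: "state_norm (u - v) = state_norm (v - u)"
  by (simp add: state_norm_def norm_minus_commute)

lemma state_norm_diff_triangle: "state_norm (u - w) \<le> state_norm (u - v) + state_norm (v - w)"
  using state_norm_triangle[of "u - v" "v - w"] by simp

lemma state_norm_le_norm: "state_norm u \<le> norm u"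
  using norm_fst_le[of "fst u" "snd u"] norm_snd_le[of "snd u" "fst u"] by (simp add: state_norm_def)

lemma norm_le_state_norm: "norm u \<le> 2 * state_norm u"
  using norm_Pair_le[of "fst u" "snd u"] by (auto simp: state_norm_def max_def)

lemma continuous_on_state_norm: "continuous_on S u \<Longrightarrow> continuous_on S (\<lambda>t. state_norm (u t))"
  unfolding state_norm_def by (intro continuous_intros)

lemma tendsto_state_norm: "(u \<longlongrightarrow> l) F \<Longrightarrow> ((\<lambda>t. state_norm (u t)) \<longlongrightarrow> state_norm l) F"
  unfolding state_norm_def by (intro tendsto_intros)

text \<open>The integral commutes with both projections, so no constant is lost; a detour through
  the product norm would cost a factor.\<close>

lemma state_norm_integral_le:
  fixes g :: "real \<Rightarrow> state"
  assumes g: "g integrable_on S" and k: "k integrable_on S" and le: "\<And>s. s \<in> S \<Longrightarrow> state_norm (g s) \<le> k s"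
  shows "state_norm (integral S g) \<le> integral S k"
proof -
  have "norm (fst (integral S g)) = norm (integral S (fst \<circ> g))"
    by (simp add: integral_linear[OF g bounded_linear_fst])
  also have "\<dots> \<le> integral S k"
    using le by (intro integral_norm_bound_integral integrable_linear[OF g bounded_linear_fst] k)
      (auto simp: state_norm_def)
  finally have 1: "norm (fst (integral S g)) \<le> integral S k" .
  have "norm (snd (integral S g)) = norm (integral S (snd \<circ> g))"
    by (simp add: integral_linear[OF g bounded_linear_snd])
  also have "\<dots> \<le> integral S k"
    using le by (intro integral_norm_bound_integral integrable_linear[OF g bounded_linear_snd] k)
      (auto simp: state_norm_def)
  finally show ?thesis using 1 by (simp add: state_norm_def)
qed

text \<open>The supremum in \<open>onorm_on\<close> bounds the quotients only if they are bounded
  above, which follows from boundedness of A in the equivalent product norm. At the origin the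
  quotient is 0 by the convention on division by 0.\<close>

lemma state_norm_le_onorm_on:
  assumes X: "subspace X" and A: "bounded_linear_on X A" and x: "x \<in> X"
  shows "state_norm (A x) \<le> onorm_on state_norm state_norm X A * state_norm x"
proof (cases "x = 0")
  case True
  \<comment> \<open>A is linear on X only, so A 0 = 0 is read off from homogeneity there.\<close>
  have "A (0 *\<^sub>R x) = 0 *\<^sub>R A x"
    using A x unfolding bounded_linear_on_def by blast
  then show ?thesis using True by (simp add: state_norm_zero_iff)
next
  case False
  obtain K where K: "\<And>x. x \<in> X \<Longrightarrow> norm (A x) \<le> K * norm x"
    using A unfolding bounded_linear_on_def by blast
  have "state_norm (A y) / state_norm y \<le> 2 * \<bar>K\<bar>" if "y \<in> X" for y
  proof (cases "y = 0")
    case False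
    have "state_norm (A y) \<le> K * norm y" using state_norm_le_norm[of "A y"] K[OF that] by linarith
    also have "\<dots> \<le> \<bar>K\<bar> * (2 * state_norm y)"
      using norm_le_state_norm[of y] by (intro mult_mono) auto
    finally show ?thesis
      using False state_norm_nonneg[of y] state_norm_zero_iff[of y] by (simp add: field_simps)
  qed simp
  then have "bdd_above ((\<lambda>y. state_norm (A y) / state_norm y) ` X)"
    by (intro bdd_aboveI2)
  then have "state_norm (A x) / state_norm x \<le> onorm_on state_norm state_norm X A"
    unfolding onorm_on_def using x by (rule cSUP_upper2[OF _ _ order_refl])
  then show ?thesis
    using False state_norm_nonneg[of x] state_norm_zero_iff[of x] by (simp add: field_simps)
qed

lemma state_norm_le_sup_norm:
  assumes "bounded (u ` {0..})" "t \<ge> 0"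
  shows "state_norm (u t) \<le> sup_norm u"
  unfolding sup_norm_def
proof (rule cSUP_upper)
  obtain c where "\<And>t. t \<ge> 0 \<Longrightarrow> norm (u t) \<le> c"
    using assms(1) unfolding bounded_iff by auto
  then show "bdd_above ((\<lambda>t. state_norm (u t)) ` {0..})"
    by (intro bdd_aboveI2[of _ _ c]) (auto intro: order_trans[OF state_norm_le_norm])
qed (use assms in simp)

lemma sup_norm_le:
  assumes "\<And>t. t \<ge> 0 \<Longrightarrow> state_norm (u t) \<le> c"
  shows "sup_norm u \<le> c"
  unfolding sup_norm_def using assms by (intro cSUP_least) auto

lemma AAA_state_norm_bounded:
  assumes "u \<in> AAA X"
  obtains c where "\<And>t. t \<ge> 0 \<Longrightarrow> state_norm (u t) \<le> c"
  using state_norm_le_sup_norm[OF AAA_bounded[OF assms]] by blast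

text \<open>Banach's iteration is written out because the distance is only a pseudometric: values at
  negative times are ignored, and the fixed point equation is asserted on the half-line
  alone.\<close>

lemma AAA_contraction_fixed_point:
  fixes X :: "state set"
  assumes X: "closed X" "subspace X" and \<Phi>: "\<And>y. y \<in> AAA X \<Longrightarrow> \<Phi> y \<in> AAA X"
    and k: "0 \<le> k" "k < 1" and y0: "y0 \<in> AAA X"
    and contr: "\<And>y z d t. y \<in> AAA X \<Longrightarrow> z \<in> AAA X \<Longrightarrow> (\<And>t. t \<ge> 0 \<Longrightarrow> state_norm (y t - z t) \<le> d) \<Longrightarrow>
      t \<ge> 0 \<Longrightarrow> state_norm (\<Phi> y t - \<Phi> z t) \<le> k * d"
  shows "\<exists>y\<in>AAA X. \<forall>t\<ge>0. \<Phi> y t = y t"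
proof -
  define Y where "Y n = (\<Phi> ^^ n) y0" for n
  have Y0: "Y 0 = y0" and YS: "Y (Suc n) = \<Phi> (Y n)" for n by (simp_all add: Y_def)
  have Y: "Y n \<in> AAA X" for n
    by (induction n) (simp_all add: Y0 YS y0 \<Phi>)
  obtain B where B: "\<And>t. t \<ge> 0 \<Longrightarrow> state_norm (Y 1 t - Y 0 t) \<le> B"
    using AAA_state_norm_bounded[OF AAA_diff[OF Y Y X(2)]] by metis
  have step: "state_norm (Y (Suc n) t - Y n t) \<le> k ^ n * B" if "t \<ge> 0" for n t
    using that
  proof (induction n arbitrary: t)
    case 0
    then show ?case using B by simp
  next
    case (Suc n)
    have "state_norm (\<Phi> (Y (Suc n)) t - \<Phi> (Y n) t) \<le> k * (k ^ n * B)"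
      by (rule contr[OF Y Y Suc.IH Suc.prems])
    then show ?case by (simp add: YS mult.assoc)
  qed
  have "B \<ge> 0" using B[of 0] state_norm_nonneg order_trans by blast
  \<comment> \<open>The sum of the geometric series of step sizes; C (1 - k) = B makes the partial
    sums telescope in \<open>geo\<close>.\<close>
  define C where "C = B / (1 - k)"
  have C: "C \<ge> 0" "C * (1 - k) = B" using \<open>B \<ge> 0\<close> k by (simp_all add: C_def)
  have geo: "state_norm (Y (n + j) t - Y n t) \<le> C * (k ^ n - k ^ (n + j))" if "t \<ge> 0" for n j t
  proof (induction j)
    case 0
    then show ?case by simp
  next
    case (Suc j)
    have "state_norm (Y (n + Suc j) t - Y n t) \<le> state_norm (Y (Suc (n + j)) t - Y (n + j) t) + state_norm (Y (n + j) t - Y n t)"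
      using state_norm_diff_triangle by simp
    also have "\<dots> \<le> k ^ (n + j) * (C * (1 - k)) + C * (k ^ n - k ^ (n + j))"
      using step[OF that, of "n + j"] Suc unfolding C(2) by linarith
    also have "\<dots> = C * (k ^ n - k ^ (n + Suc j))" by (simp add: algebra_simps)
    finally show ?case .
  qed
  have tail: "state_norm (Y m t - Y n t) \<le> C * k ^ n" if "t \<ge> 0" "n \<le> m" for m n t
  proof -
    have "C * (k ^ n - k ^ m) \<le> C * k ^ n" using C(1) k(1) by (intro mult_left_mono) auto
    then show ?thesis using geo[OF that(1), of n "m - n"] that(2) by simp
  qed
  have lim0: "(\<lambda>n. c * k ^ n) \<longlonglongrightarrow> 0" for c
    using k by (intro tendsto_mult_right_zero LIMSEQ_power_zero) simp
  have "uniformly_Cauchy_on {0..} Y"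
  proof (rule uniformly_Cauchy_onI')
    fix e :: real assume "e > 0"
    then have "\<forall>\<^sub>F n in sequentially. (2 * C) * k ^ n < e"
      by (intro order_tendstoD(2)[OF lim0])
    then obtain N where N: "\<And>n. n \<ge> N \<Longrightarrow> (2 * C) * k ^ n < e"
      by (auto simp: eventually_sequentially)
    \<comment> \<open>Uniform convergence is measured in the product norm, hence the factor 2 in
      front of C.\<close>
    have "dist (Y m t) (Y n t) < e" if "t \<ge> 0" "m \<ge> N" "n > m" for m n t
      using norm_le_state_norm[of "Y n t - Y m t"] tail[OF that(1), of m n] N[OF that(2)] that(3)
      by (simp add: dist_norm norm_minus_commute)
    then show "\<exists>M. \<forall>x\<in>{0..}. \<forall>m\<ge>M. \<forall>n>m. dist (Y m x) (Y n x) < e"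
      by (meson atLeast_iff)
  qed
  then obtain y where lim: "uniform_limit {0..} Y y sequentially"
    using Cauchy_uniformly_convergent unfolding uniformly_convergent_on_def by blast
  have y: "y \<in> AAA X" by (rule AAA_uniform_limit[OF Y lim X])
  have y_tail: "state_norm (y t - Y n t) \<le> C * k ^ n" if "t \<ge> 0" for n t
  proof (rule tendsto_upperbound)
    have "(\<lambda>m. Y m t) \<longlonglongrightarrow> y t" by (rule tendsto_uniform_limitI[OF lim]) (simp add: that)
    then show "(\<lambda>m. state_norm (Y m t - Y n t)) \<longlonglongrightarrow> state_norm (y t - Y n t)"
      by (intro tendsto_state_norm tendsto_intros)
    show "\<forall>\<^sub>F m in sequentially. state_norm (Y m t - Y n t) \<le> C * k ^ n"
      using eventually_ge_at_top[of n] by eventually_elim (rule tail[OF that])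
  qed simp
  have "\<Phi> y t = y t" if "t \<ge> 0" for t
  proof -
    have "state_norm (\<Phi> y t - y t) \<le> (2 * C) * k ^ n" for n
    proof -
      have "state_norm (\<Phi> y t - Y (Suc n) t) \<le> k * (C * k ^ n)"
        unfolding YS by (rule contr[OF y Y y_tail that])
      moreover have "state_norm (Y (Suc n) t - y t) \<le> C * k ^ Suc n"
        using y_tail[OF that, of "Suc n"] by (simp add: state_norm_minus_commute)
      moreover have "C * k ^ Suc n \<le> C * k ^ n"
        using C(1) k by (intro mult_left_mono power_decreasing) auto
      ultimately show ?thesis
        using state_norm_diff_triangle[of "\<Phi> y t" "y t" "Y (Suc n) t"] by (simp add: mult_ac)
    qed
    then have "state_norm (\<Phi> y t - y t) \<le> 0"
      by (intro tendsto_lowerbound[OF lim0[of "2 * C"]]) auto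
    then show ?thesis
      using state_norm_nonneg[of "\<Phi> y t - y t"] state_norm_zero_iff[of "\<Phi> y t - y t"] by simp
  qed
  then show ?thesis using y by blast
qed

text \<open>The nonlinearity is the pair of a and y composed with a map that multiplies b by an
  unbounded scalar, so it is only locally Lipschitz even though b is globally so.\<close>

lemma AAA_scaled_superposition:
  fixes b :: "'z::real_normed_vector \<Rightarrow> 'v::real_normed_vector"
  assumes a: "a \<in> AAA UNIV" and y: "y \<in> AAA (Z \<times> W)" and b: "b ` Z \<subseteq> V" "L-lipschitz_on Z b"
    and sub: "subspace Z" "subspace W" "subspace V" "subspace U"
  shows "(\<lambda>t. (0, a t *\<^sub>R b (fst (y t)))) \<in> AAA (U \<times> V)"
proof -
  let ?F = "\<lambda>p :: real \<times> 'z \<times> 'w. (0, fst p *\<^sub>R b (fst (snd p)))"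
  have L: "L \<ge> 0" by (rule lipschitz_on_nonneg[OF b(2)])
  have "locally_lipschitz (UNIV \<times> Z \<times> W) ?F"
  proof (rule locally_lipschitzI)
    fix r
    \<comment> \<open>The product rule on the ball of radius r: |r| bounds the scalar factor and L
      the increment of b, while \<open>norm (b 0) + L * \<bar>r\<bar>\<close> bounds b against the
      increment of the scalar.\<close>
    let ?L = "\<bar>r\<bar> * L + (norm (b 0) + L * \<bar>r\<bar>)"
    have "norm (?F p - ?F q) \<le> ?L * norm (p - q)"
      if pq: "p \<in> UNIV \<times> Z \<times> W" "q \<in> UNIV \<times> Z \<times> W" "norm p \<le> r" "norm q \<le> r" for p q
    proof -
      obtain \<alpha> \<theta> \<eta> \<alpha>' \<theta>' \<eta>' where p: "p = (\<alpha>, \<theta>, \<eta>)" and q: "q = (\<alpha>', \<theta>', \<eta>')" by (metis prod.exhaust)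
      have Z: "\<theta> \<in> Z" "\<theta>' \<in> Z" "0 \<in> Z" using pq p q subspace_0[OF sub(1)] by auto
      have small: "\<bar>\<alpha>\<bar> \<le> \<bar>r\<bar>" "norm \<theta>' \<le> \<bar>r\<bar>"
        using pq(3,4) norm_fst_le[of \<alpha> "(\<theta>, \<eta>)"] norm_snd_le[of "(\<theta>', \<eta>')" \<alpha>'] norm_fst_le[of \<theta>' \<eta>']
        unfolding p q by auto
      have diff: "\<bar>\<alpha> - \<alpha>'\<bar> \<le> norm (p - q)" "norm (\<theta> - \<theta>') \<le> norm (p - q)"
        using norm_fst_le[of "\<alpha> - \<alpha>'" "(\<theta> - \<theta>', \<eta> - \<eta>')"] norm_snd_le[of "(\<theta> - \<theta>', \<eta> - \<eta>')" "\<alpha> - \<alpha>'"]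
          norm_fst_le[of "\<theta> - \<theta>'" "\<eta> - \<eta>'"]
        unfolding p q by auto
      have b1: "norm (b \<theta> - b \<theta>') \<le> L * norm (p - q)"
        using lipschitz_on_normD[OF b(2) Z(1,2)] mult_left_mono[OF diff(2) L] by linarith
      have "norm (b \<theta>' - b 0) \<le> L * \<bar>r\<bar>"
        using lipschitz_on_normD[OF b(2) Z(2,3)] mult_left_mono[OF small(2) L] by simp
      then have b2: "norm (b \<theta>') \<le> norm (b 0) + L * \<bar>r\<bar>"
        using norm_triangle_sub[of "b \<theta>'" "b 0"] by linarith
      have "norm (?F p - ?F q) = norm (\<alpha> *\<^sub>R (b \<theta> - b \<theta>') + (\<alpha> - \<alpha>') *\<^sub>R b \<theta>')"
        by (simp add: p q norm_Pair algebra_simps)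
      also have "\<dots> \<le> \<bar>\<alpha>\<bar> * norm (b \<theta> - b \<theta>') + \<bar>\<alpha> - \<alpha>'\<bar> * norm (b \<theta>')"
        using norm_triangle_ineq[of "\<alpha> *\<^sub>R (b \<theta> - b \<theta>')" "(\<alpha> - \<alpha>') *\<^sub>R b \<theta>'"] by simp
      also have "\<dots> \<le> \<bar>r\<bar> * (L * norm (p - q)) + norm (p - q) * (norm (b 0) + L * \<bar>r\<bar>)"
        by (intro add_mono mult_mono small diff b1 b2) (use L in auto)
      finally show ?thesis by (simp add: algebra_simps)
    qed
    then show "\<exists>L\<ge>0. \<forall>p\<in>UNIV \<times> Z \<times> W. \<forall>q\<in>UNIV \<times> Z \<times> W. norm p \<le> r \<longrightarrow> norm q \<le> r \<longrightarrow>
        norm (?F p - ?F q) \<le> L * norm (p - q)"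
      using L by (intro exI[of _ ?L]) simp
  qed
  moreover have "?F ` (UNIV \<times> Z \<times> W) \<subseteq> U \<times> V"
    using b(1) subspace_0[OF sub(4)] subspace_scale[OF sub(3)] by auto
  ultimately have "(\<lambda>t. ?F (a t, y t)) \<in> AAA (U \<times> V)"
    by (intro AAA_compose[OF AAA_Pair[OF a y]] subspace_Times sub subspace_UNIV)
  then show ?thesis by simp
qed

lemma sup_lipschitz_onD:
  assumes "sup_lipschitz_on L Z g" "u \<in> C_half_line Z" "v \<in> C_half_line Z" "\<And>t. t \<ge> 0 \<Longrightarrow> norm (u t - v t) \<le> d"
  shows "norm (g u - g v) \<le> L * d"
proof -
  have "bounded ((\<lambda>t. u t - v t) ` {0..})" using assms(4) unfolding bounded_iff by auto
  then have "norm (g u - g v) \<le> L * (SUP t\<in>{0..}. norm (u t - v t))"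
    using assms unfolding sup_lipschitz_on_def by blast
  also have "\<dots> \<le> L * d"
    using assms unfolding sup_lipschitz_on_def by (intro mult_left_mono cSUP_least) auto
  finally show ?thesis .
qed

theorem theorem6p1:
  fixes \<Omega> :: "(real^3) set"
    and \<alpha> \<alpha>' \<alpha>'' \<beta> \<beta>' \<beta>'' a :: "real \<Rightarrow> real"
    and M \<gamma> p q \<rho> :: real
    and T R :: "real \<Rightarrow> state \<Rightarrow> state"
    and b :: "h1r3 \<Rightarrow> l2r3"
    and f :: "real \<Rightarrow> state \<Rightarrow> state"
    and u0 :: state
    and h1 :: "(real \<Rightarrow> h1r3) \<Rightarrow> h1r3"
    and h2 :: "(real \<Rightarrow> l2r3) \<Rightarrow> l2r3"
    and h :: "(real \<Rightarrow> state) \<Rightarrow> state"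
    and y0 :: "real \<Rightarrow> state"
  assumes domain: "open \<Omega>" "connected \<Omega>" "bounded \<Omega>" "smooth_boundary \<Omega>"
    and alpha: "\<And>t. t \<ge> 0 \<Longrightarrow> (\<alpha> has_real_derivative \<alpha>' t) (at t within {0..})"
      "\<And>t. t \<ge> 0 \<Longrightarrow> (\<alpha>' has_real_derivative \<alpha>'' t) (at t within {0..})"
      "continuous_on {0..} \<alpha>''" "\<alpha> 0 > 0"
    and beta: "\<And>t. t \<ge> 0 \<Longrightarrow> (\<beta> has_real_derivative \<beta>' t) (at t within {0..})"
      "\<And>t. t \<ge> 0 \<Longrightarrow> (\<beta>' has_real_derivative \<beta>'' t) (at t within {0..})"
      "continuous_on {0..} \<beta>''" "\<beta> 0 > 0"
    and semigroup: "C0_semigroup (state_space \<Omega>) T"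
      "is_generator (state_space \<Omega>) T (wave_dom \<Omega>) (wave_A \<Omega> (\<alpha> 0) (\<beta> 0))"
      "M > 0" "\<gamma> > 0"
      "\<And>t. t \<ge> 0 \<Longrightarrow>
        onorm_on state_norm state_norm (state_space \<Omega>) (T t) \<le> M * exp (- \<gamma> * t)"
    and R1: "\<And>g. g \<in> {\<alpha>', \<alpha>'', \<beta>', \<beta>''} \<Longrightarrow> bounded ((\<lambda>t. g t * exp (\<gamma> * t)) ` {0..}) \<and>
        uniformly_continuous_on {0..} (\<lambda>t. g t * exp (\<gamma> * t))"
    and pq: "p > 1" "q > 1" "1 / p + 1 / q = 1"
    and R2: "\<And>t. t \<ge> 0 \<Longrightarrow>
        max (onorm_on norm norm (H01 \<Omega>) (F21 (\<alpha> 0) (\<beta> 0) (\<alpha>' t) (\<beta>' t)))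
            (onorm_on norm norm (L2 \<Omega>) (F22 (\<alpha> 0) (\<alpha>' t)))
          \<le> \<gamma> * exp (- \<gamma> * t) / (p * M)"
      "\<And>t. t \<ge> 0 \<Longrightarrow>
        max (onorm_on norm norm (H01 \<Omega>) (F21 (\<alpha> 0) (\<beta> 0) (\<alpha>'' t) (\<beta>'' t)))
            (onorm_on norm norm (L2 \<Omega>) (F22 (\<alpha> 0) (\<alpha>'' t)))
          \<le> \<gamma>\<^sup>2 * exp (- \<gamma> * t) / (p * M)\<^sup>2"
    and resolvent: "resolvent_operator (state_space \<Omega>) (wave_dom \<Omega>)
        (wave_A \<Omega> (\<alpha> 0) (\<beta> 0)) (wave_B \<Omega> \<alpha>' \<beta>') R"
      "\<And>t. t \<ge> 0 \<Longrightarrow>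
        onorm_on state_norm state_norm (state_space \<Omega>) (R t) \<le> M * exp (- \<gamma> * t / q)"
    and a: "a \<in> AAA UNIV"
    and b: "b ` H01 \<Omega> \<subseteq> L2 \<Omega>"
    and f: "\<And>t \<theta> \<eta>. f t (\<theta>, \<eta>) = (0, a t *\<^sub>R b \<theta>)"
    and u0: "u0 \<in> state_space \<Omega>"
    and h1: "h1 ` C_half_line (H01 \<Omega>) \<subseteq> H01 \<Omega>"
    and h2: "h2 ` C_half_line (L2 \<Omega>) \<subseteq> L2 \<Omega>"
    and h: "\<And>u. h u = (h1 (\<lambda>t. fst (u t)), h2 (\<lambda>t. snd (u t)))"
    and y0: "\<And>t. y0 t = R t (u0 + h (\<lambda>_. 0)) + integral {0..t} (\<lambda>s. R (t - s) (f s 0))"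
    and rho: "\<rho> > 0"
      "\<rho> \<ge> M * (state_norm u0 + state_norm (h (\<lambda>_. 0)) + q / \<gamma> * AAA_norm UNIV a * norm (b 0))"
    and h1_lipschitz: "sup_lipschitz_on (\<rho> / (p * M * (\<rho> + sup_norm y0))) (H01 \<Omega>) h1"
    and h2_lipschitz: "sup_lipschitz_on (\<rho> / (p * M * (\<rho> + sup_norm y0))) (L2 \<Omega>) h2"
    and b_lipschitz:
      "(\<gamma> * \<rho> / (q * M * AAA_norm UNIV a * (\<rho> + sup_norm y0)))-lipschitz_on (H01 \<Omega>) b"
  shows "\<exists>y. (mild_solution (state_space \<Omega>) R u0 h f y \<and> y \<in> AAA (state_space \<Omega>) \<and>
            sup_norm (\<lambda>t. y t - y0 t) \<le> \<rho>) \<and>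
          (\<forall>z. mild_solution (state_space \<Omega>) R u0 h f z \<and> z \<in> AAA (state_space \<Omega>) \<and>
            sup_norm (\<lambda>t. z t - y0 t) \<le> \<rho> \<longrightarrow> (\<forall>t\<ge>0. z t = y t))"
proof -
  define X where "X = state_space \<Omega>"
  define \<omega> where "\<omega> = \<gamma> / q"
  define N where "N = sup_norm y0"
  define k where "k = \<rho> / (\<rho> + N)"
  define Lh where "Lh = \<rho> / (p * M * (\<rho> + N))"
  define Lb where "Lb = \<gamma> * \<rho> / (q * M * AAA_norm UNIV a * (\<rho> + N))"
  have M: "M > 0" and \<omega>: "\<omega> > 0" and p: "p > 1"
    using semigroup(3,4) pq by (simp_all add: \<omega>_def)
  have closed_X: "closed X" and sub_X: "subspace X"
    unfolding X_def using domain(1) by (auto intro: closed_state_space subspace_state_space)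
  have R: "\<And>t. t \<ge> 0 \<Longrightarrow> R t ` X \<subseteq> X" "\<And>t. t \<ge> 0 \<Longrightarrow> bounded_linear_on X (R t)"
    "\<And>x. x \<in> X \<Longrightarrow> continuous_on {0..} (\<lambda>t. R t x)"
    using resolvent(1) unfolding resolvent_operator_def X_def by blast+
  have R_state: "state_norm (R t x) \<le> M * exp (- \<omega> * t) * state_norm x" if "t \<ge> 0" "x \<in> X" for t x
  proof -
    have "state_norm (R t x) \<le> onorm_on state_norm state_norm X (R t) * state_norm x"
      by (rule state_norm_le_onorm_on[OF sub_X R(2)[OF that(1)] that(2)])
    also have "\<dots> \<le> M * exp (- \<gamma> * t / q) * state_norm x"
      using resolvent(2)[OF that(1)] state_norm_nonneg unfolding X_def by (intro mult_right_mono) auto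
    finally show ?thesis by (simp add: \<omega>_def)
  qed
  \<comment> \<open>The decay with constant M holds in \<open>state_norm\<close>; the factor 2 pays
    for the product norm and enters only qualitative conclusions.\<close>
  interpret exp_stable_family X R "2 * M" \<omega>
  proof
    fix t :: real and x y :: state and c :: real
    show "norm (R t x) \<le> 2 * M * exp (- \<omega> * t) * norm x" if t: "t \<ge> 0" "x \<in> X"
    proof -
      have "norm (R t x) \<le> 2 * (M * exp (- \<omega> * t) * state_norm x)"
        using norm_le_state_norm[of "R t x"] R_state[OF t] by linarith
      also have "\<dots> \<le> 2 * (M * exp (- \<omega> * t) * norm x)"
        using M state_norm_le_norm[of x] by (intro mult_left_mono) auto
      finally show ?thesis by simp
    qed
    show "R t x \<in> X" if "t \<ge> 0" "x \<in> X" using R(1) that by blast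
    show "R t (x + y) = R t x + R t y" if "t \<ge> 0" "x \<in> X" "y \<in> X"
      using R(2)[OF that(1)] that unfolding bounded_linear_on_def by blast
    show "R t (c *\<^sub>R x) = c *\<^sub>R R t x" if "t \<ge> 0" "x \<in> X"
      using R(2)[OF that(1)] that unfolding bounded_linear_on_def by blast
    show "continuous_on {0..} (\<lambda>t. R t x)" if "x \<in> X" by (rule R(3)[OF that])
  qed (use closed_X sub_X M \<omega> in auto)

  \<comment> \<open>The integral operator \<open>\<Phi>\<close> on \<open>AAA X\<close>\<close>
  have f_eq: "f t u = (0, a t *\<^sub>R b (fst u))" for t u
    using f[of t "fst u" "snd u"] by simp
  have b_lip: "Lb-lipschitz_on (H01 \<Omega>) b"
    using b_lipschitz by (simp add: Lb_def N_def)
  have h_lip: "sup_lipschitz_on Lh (H01 \<Omega>) h1" "sup_lipschitz_on Lh (L2 \<Omega>) h2"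
    using h1_lipschitz h2_lipschitz by (simp_all add: Lh_def N_def)
  have f_AAA: "(\<lambda>t. f t (y t)) \<in> AAA X" if "y \<in> AAA X" for y
    unfolding f_eq X_def state_space_def
    by (rule AAA_scaled_superposition[OF a that[unfolded X_def state_space_def] b b_lip
        subspace_H01 subspace_L2 subspace_L2 subspace_H01])
  have comps: "(\<lambda>t. fst (y t)) \<in> C_half_line (H01 \<Omega>)" "(\<lambda>t. snd (y t)) \<in> C_half_line (L2 \<Omega>)"
    if "y \<in> AAA X" for y
    using AAA_C_half_line[OF that sub_X] unfolding X_def state_space_def C_half_line_def
    by (auto intro: continuous_on_fst continuous_on_snd simp: mem_Times_iff)
  have h_in: "h y \<in> X" if "y \<in> AAA X" for y
    using comps[OF that] h1 h2 unfolding h X_def state_space_def by auto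
  have zero_AAA: "(\<lambda>_. 0) \<in> AAA X"
    using sub_X by (intro C0_half_line_subset_AAA C0_half_lineI) (auto simp: subspace_0)

  define \<Phi> where "\<Phi> y t = R t (u0 + h y) + conv (\<lambda>s. f s (y s)) t" for y t
  have y0_eq: "y0 = \<Phi> (\<lambda>_. 0)"
    unfolding \<Phi>_def conv_def using y0 by auto
  have \<Phi>_AAA: "\<Phi> y \<in> AAA X" if "y \<in> AAA X" for y
    unfolding \<Phi>_def using u0[folded X_def] h_in[OF that]
    by (intro AAA_add C0_half_line_subset_AAA R_C0 conv_AAA f_AAA that sub_X subspace_add[OF sub_X])
  have y0_AAA: "y0 \<in> AAA X" unfolding y0_eq by (rule \<Phi>_AAA[OF zero_AAA])
  have y0_le: "state_norm (y0 t) \<le> N" if "t \<ge> 0" for t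
    unfolding N_def by (rule state_norm_le_sup_norm[OF AAA_bounded[OF y0_AAA] that])
  have N: "N \<ge> 0" using y0_le[of 0] state_norm_nonneg[of "y0 0"] by linarith
  have k: "0 \<le> k" "k \<le> 1" using rho(1) N by (simp_all add: k_def)
  have MLh: "M * Lh = k / p" using M by (simp add: Lh_def k_def)
  have Lb_nonneg: "Lb \<ge> 0" by (rule lipschitz_on_nonneg[OF b_lip])
  have a_le: "\<bar>a t\<bar> \<le> AAA_norm UNIV a" if "t \<ge> 0" for t
    using norm_le_AAA_norm[OF a subspace_UNIV that] by simp
  \<comment> \<open>If the norm of a vanishes, both sides are evaluated without the formula for
    \<open>Lb\<close>, whose denominator is then 0; otherwise equality holds.\<close>
  have MLb: "M * AAA_norm UNIV a * Lb \<le> k * \<omega>"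
  proof (cases "AAA_norm UNIV a = 0")
    case False
    then show ?thesis using M by (simp add: Lb_def k_def \<omega>_def mult.commute)
  qed (use k \<omega> in simp)

  \<comment> \<open>Two bounds on y - z are kept apart: h depends on the whole half-line and is
    controlled by d, while the integral up to t sees only [0, t] and is controlled by e. Only the
    term with d carries the factor 1 / p.\<close>
  have key: "state_norm (\<Phi> y t - \<Phi> z t) \<le> exp (- \<omega> * t) * k * d / p + k * (1 - exp (- \<omega> * t)) * e"
    if y: "y \<in> AAA X" and z: "z \<in> AAA X" and d: "\<And>t. t \<ge> 0 \<Longrightarrow> state_norm (y t - z t) \<le> d"
      and t: "t \<ge> 0" and e: "\<And>s. 0 \<le> s \<Longrightarrow> s \<le> t \<Longrightarrow> state_norm (y s - z s) \<le> e" for y z t d e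
  proof -
    have e0: "e \<ge> 0" using e[of 0] t state_norm_nonneg[of "y 0 - z 0"] by linarith
    have "norm (h1 (\<lambda>t. fst (y t)) - h1 (\<lambda>t. fst (z t))) \<le> Lh * d"
      using d by (intro sup_lipschitz_onD[OF h_lip(1) comps(1)[OF y] comps(1)[OF z]]) (simp add: state_norm_def)
    moreover have "norm (h2 (\<lambda>t. snd (y t)) - h2 (\<lambda>t. snd (z t))) \<le> Lh * d"
      using d by (intro sup_lipschitz_onD[OF h_lip(2) comps(2)[OF y] comps(2)[OF z]]) (simp add: state_norm_def)
    ultimately have h_diff: "state_norm (h y - h z) \<le> Lh * d" by (simp add: h state_norm_def)
    have C: "(\<lambda>s. f s (y s)) \<in> C_half_line X" "(\<lambda>s. f s (z s)) \<in> C_half_line X"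
      by (intro AAA_C_half_line f_AAA y z sub_X)+
    have "\<Phi> y t - \<Phi> z t = R t ((u0 + h y) - (u0 + h z)) + conv (\<lambda>s. f s (y s) - f s (z s)) t"
      unfolding \<Phi>_def conv_diff[OF C]
      by (subst R_diff[OF t]) (use u0[folded X_def] h_in y z in \<open>auto intro: subspace_add[OF sub_X]\<close>)
    then have split: "\<Phi> y t - \<Phi> z t = R t (h y - h z) + conv (\<lambda>s. f s (y s) - f s (z s)) t" by simp
    have "state_norm (R t (h y - h z)) \<le> M * exp (- \<omega> * t) * state_norm (h y - h z)"
      by (intro R_state t subspace_diff[OF sub_X] h_in y z)
    also have "\<dots> \<le> M * exp (- \<omega> * t) * (Lh * d)"
      using M by (intro mult_left_mono h_diff) auto
    also have "\<dots> = exp (- \<omega> * t) * (M * Lh) * d" by simp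
    also have "\<dots> = exp (- \<omega> * t) * k * d / p" unfolding MLh by simp
    finally have R_part: "state_norm (R t (h y - h z)) \<le> exp (- \<omega> * t) * k * d / p" .
    have hi: "((\<lambda>s. k * \<omega> * e * exp (- \<omega> * (t - s))) has_integral k * \<omega> * e * ((1 - exp (- \<omega> * t)) / \<omega>)) {0..t}"
      by (intro has_integral_mult_right has_integral_exp_shift \<omega> t)
    have Cd: "(\<lambda>s. f s (y s) - f s (z s)) \<in> C_half_line X"
      using AAA_C_half_line[OF AAA_diff[OF f_AAA[OF y] f_AAA[OF z] sub_X] sub_X] .
    have "state_norm (conv (\<lambda>s. f s (y s) - f s (z s)) t) \<le> integral {0..t} (\<lambda>s. k * \<omega> * e * exp (- \<omega> * (t - s)))"
      unfolding conv_def
    proof (rule state_norm_integral_le[OF conv_integrable[OF Cd] has_integral_integrable[OF hi]])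
      fix s assume s: "s \<in> {0..t}"
      have "fst (y s) \<in> H01 \<Omega>" "fst (z s) \<in> H01 \<Omega>"
        using C_half_lineD(2)[OF comps(1)[OF y]] C_half_lineD(2)[OF comps(1)[OF z]] s by auto
      then have "norm (b (fst (y s)) - b (fst (z s))) \<le> Lb * norm (fst (y s) - fst (z s))"
        by (rule lipschitz_on_normD[OF b_lip])
      also have "\<dots> \<le> Lb * e"
        using e[of s] s by (intro mult_left_mono Lb_nonneg) (auto simp: state_norm_def)
      finally have b_diff: "norm (b (fst (y s)) - b (fst (z s))) \<le> Lb * e" .
      have "state_norm (f s (y s) - f s (z s)) = \<bar>a s\<bar> * norm (b (fst (y s)) - b (fst (z s)))"
        by (simp add: f_eq state_norm_def flip: scaleR_diff_right)
      also have "\<dots> \<le> AAA_norm UNIV a * (Lb * e)"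
        using a_le[of s] s by (intro mult_mono b_diff) auto
      finally have f_diff: "state_norm (f s (y s) - f s (z s)) \<le> AAA_norm UNIV a * (Lb * e)" .
      have "state_norm (R (t - s) (f s (y s) - f s (z s))) \<le> M * exp (- \<omega> * (t - s)) * state_norm (f s (y s) - f s (z s))"
        using s C_half_lineD(2)[OF Cd, of s] by (intro R_state) auto
      also have "\<dots> \<le> M * exp (- \<omega> * (t - s)) * (AAA_norm UNIV a * (Lb * e))"
        using M by (intro mult_left_mono f_diff) auto
      also have "\<dots> = (M * AAA_norm UNIV a * Lb) * (e * exp (- \<omega> * (t - s)))" by simp
      also have "\<dots> \<le> (k * \<omega>) * (e * exp (- \<omega> * (t - s)))"
        using e0 by (intro mult_right_mono MLb) auto
      finally show "state_norm (R (t - s) (f s (y s) - f s (z s))) \<le> k * \<omega> * e * exp (- \<omega> * (t - s))" by simp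
    qed
    also have "\<dots> = k * (1 - exp (- \<omega> * t)) * e"
      unfolding integral_unique[OF hi] using \<omega> by simp
    finally show ?thesis
      unfolding split using R_part state_norm_triangle[of "R t (h y - h z)" "conv (\<lambda>s. f s (y s) - f s (z s)) t"]
      by linarith
  qed

  have contr: "state_norm (\<Phi> y t - \<Phi> z t) \<le> k * d"
    if y: "y \<in> AAA X" and z: "z \<in> AAA X" and d: "\<And>t. t \<ge> 0 \<Longrightarrow> state_norm (y t - z t) \<le> d" and t: "t \<ge> 0" for y z d t
  proof -
    have "d \<ge> 0" using d[of 0] state_norm_nonneg[of "y 0 - z 0"] by linarith
    then have "0 \<le> exp (- \<omega> * t) * k * d" using k by simp
    then have "exp (- \<omega> * t) * k * d / p \<le> exp (- \<omega> * t) * k * d / 1"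
      using p by (intro divide_left_mono) auto
    \<comment> \<open>Taking e = d loses only the factor 1 / p, after which the weights exp
      (-\<omega> t) and 1 - exp (-\<omega> t) add up to 1.\<close>
    moreover have "state_norm (\<Phi> y t - \<Phi> z t) \<le> exp (- \<omega> * t) * k * d / p + k * (1 - exp (- \<omega> * t)) * d"
      using d by (intro key y z t) auto
    moreover have "exp (- \<omega> * t) * k * d + k * (1 - exp (- \<omega> * t)) * d = k * d" by (simp add: algebra_simps)
    ultimately show ?thesis by simp
  qed

  have unique: "z t = y t"
    if y: "y \<in> AAA X" and z: "z \<in> AAA X" and fy: "\<And>t. t \<ge> 0 \<Longrightarrow> \<Phi> y t = y t" and fz: "\<And>t. t \<ge> 0 \<Longrightarrow> \<Phi> z t = z t"
      and t: "t \<ge> 0" for y z t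
  proof -
    define d where "d = sup_norm (\<lambda>t. y t - z t)"
    have d: "state_norm (y t - z t) \<le> d" if "t \<ge> 0" for t
      unfolding d_def by (rule state_norm_le_sup_norm[OF AAA_bounded[OF AAA_diff[OF y z sub_X]] that])
    have "d \<ge> 0" using d[of 0] state_norm_nonneg[of "y 0 - z 0"] by linarith
    have "state_norm (y t - z t) \<le> d / p" if t: "t \<ge> 0" for t
    proof -
      have "continuous_on {0..t} (\<lambda>s. state_norm (y s - z s))"
        using C_half_lineD(1)[OF AAA_C_half_line[OF y sub_X]] C_half_lineD(1)[OF AAA_C_half_line[OF z sub_X]]
        by (intro continuous_on_state_norm continuous_on_diff) (auto intro: continuous_on_subset)
      \<comment> \<open>On a compact interval the maximum is attained, so the value at r can serve
        as e and reappears on the left of the estimate. Its part with weight 1 - exp (-\<omega> r)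
        then cancels.\<close>
      then obtain r where r: "r \<in> {0..t}" and r_max: "\<And>s. s \<in> {0..t} \<Longrightarrow> state_norm (y s - z s) \<le> state_norm (y r - z r)"
        using continuous_attains_sup[of "{0..t}" "\<lambda>s. state_norm (y s - z s)"] t by auto
      let ?e = "state_norm (y r - z r)" and ?x = "exp (- \<omega> * r)"
      have "r \<ge> 0" using r by simp
      have "?e = state_norm (\<Phi> y r - \<Phi> z r)" using fy fz \<open>r \<ge> 0\<close> by simp
      also have "\<dots> \<le> ?x * k * d / p + k * (1 - ?x) * ?e"
        using r by (intro key y z d r_max \<open>r \<ge> 0\<close>) auto
      also have "\<dots> \<le> ?x * 1 * d / p + 1 * (1 - ?x) * ?e"
        using k p \<omega> \<open>d \<ge> 0\<close> \<open>r \<ge> 0\<close> state_norm_nonneg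
        by (intro add_mono divide_right_mono mult_right_mono mult_left_mono) auto
      finally have "?x * ?e \<le> ?x * (d / p)" by (simp add: algebra_simps)
      then have "?e \<le> d / p" by (simp only: mult_le_cancel_left_pos exp_gt_zero)
      then show ?thesis using r_max[of t] t by simp
    qed
    then have "d \<le> d / p" unfolding d_def by (intro sup_norm_le)
    then have "d * p \<le> d" using p by (simp add: le_divide_eq)
    then have "d * (p - 1) \<le> 0" by (simp add: algebra_simps)
    then have "d \<le> 0" using p by (simp add: mult_le_0_iff)
    then show ?thesis
      using d[OF t] state_norm_nonneg[of "y t - z t"] state_norm_zero_iff[of "y t - z t"] by simp
  qed

  have exists: "\<exists>y\<in>AAA X. (\<forall>t\<ge>0. \<Phi> y t = y t) \<and> sup_norm (\<lambda>t. y t - y0 t) \<le> \<rho>"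
  proof (cases "N = 0")
    case True
    have "\<Phi> y0 t = y0 t" if "t \<ge> 0" for t
    proof -
      \<comment> \<open>y0 agrees with 0 on the half-line but perhaps not elsewhere; the estimate
        with d = 0 shows that \<open>\<Phi>\<close> does not see the difference.\<close>
      have "state_norm (\<Phi> y0 t - \<Phi> (\<lambda>_. 0) t) \<le> k * 0"
        using y0_le True by (intro contr y0_AAA zero_AAA that) auto
      then show ?thesis
        using state_norm_nonneg[of "\<Phi> y0 t - y0 t"] state_norm_zero_iff[of "\<Phi> y0 t - y0 t"]
        by (simp flip: y0_eq)
    qed
    moreover have "sup_norm (\<lambda>t. y0 t - y0 t) \<le> \<rho>"
      using rho(1) by (intro sup_norm_le) simp
    ultimately show ?thesis using y0_AAA by blast
  next
    case False
    then have "k < 1" using N rho(1) by (simp add: k_def)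
    have "\<exists>y\<in>AAA X. \<forall>t\<ge>0. \<Phi> y t = y t"
    proof (rule AAA_contraction_fixed_point[OF closed_X sub_X \<Phi>_AAA k(1) \<open>k < 1\<close> y0_AAA])
      show "state_norm (\<Phi> y t - \<Phi> z t) \<le> k * d"
        if "y \<in> AAA X" "z \<in> AAA X" "\<And>t. t \<ge> 0 \<Longrightarrow> state_norm (y t - z t) \<le> d" "t \<ge> 0" for y z d t
        by (rule contr[OF that])
    qed
    then obtain y where y: "y \<in> AAA X" and fix_y: "\<And>t. t \<ge> 0 \<Longrightarrow> \<Phi> y t = y t" by blast
    define d where "d = sup_norm (\<lambda>t. y t - y0 t)"
    have d: "state_norm (y t - y0 t) \<le> d" if "t \<ge> 0" for t
      unfolding d_def by (rule state_norm_le_sup_norm[OF AAA_bounded[OF AAA_diff[OF y y0_AAA sub_X]] that])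
    have "state_norm (y t - y0 t) \<le> k * (d + N)" if "t \<ge> 0" for t
    proof -
      have "state_norm (\<Phi> y t - \<Phi> (\<lambda>_. 0) t) \<le> k * (d + N)"
      proof (intro contr y zero_AAA that)
        show "state_norm (y s - 0) \<le> d + N" if "s \<ge> 0" for s
          using state_norm_triangle[of "y s - y0 s" "y0 s"] d[OF that] y0_le[OF that] by simp
      qed
      then show ?thesis using fix_y[OF that] by (simp flip: y0_eq)
    qed
    then have "d \<le> k * (d + N)" unfolding d_def by (intro sup_norm_le)
    \<comment> \<open>The denominator \<rho> + N in k is made for this: d \<rho> cancels, and
      division by N > 0 leaves the radius \<rho>.\<close>
    then have "d * (\<rho> + N) \<le> \<rho> * (d + N)" using rho(1) N by (simp add: k_def field_simps)
    then have "d * N \<le> \<rho> * N" by (simp add: algebra_simps)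
    then have "d \<le> \<rho>" using N False by simp
    then show ?thesis using y fix_y unfolding d_def by blast
  qed

  \<comment> \<open>Continuity and values in X, also demanded of a mild solution, come with
    membership in \<open>AAA X\<close>.\<close>
  have mild_iff: "mild_solution (state_space \<Omega>) R u0 h f y \<longleftrightarrow> (\<forall>t\<ge>0. \<Phi> y t = y t)" if "y \<in> AAA X" for y
    using AAA_C_half_line[OF that sub_X] unfolding mild_solution_def X_def[symmetric] \<Phi>_def conv_def by auto
  obtain y where y: "y \<in> AAA X" "\<And>t. t \<ge> 0 \<Longrightarrow> \<Phi> y t = y t" "sup_norm (\<lambda>t. y t - y0 t) \<le> \<rho>"
    using exists by blast
  show ?thesis
  proof (intro exI[of _ y] conjI allI impI)
    show "mild_solution (state_space \<Omega>) R u0 h f y" using y(2) by (simp add: mild_iff[OF y(1)])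
    show "y \<in> AAA (state_space \<Omega>)" using y(1) by (simp add: X_def)
    fix z and t :: real
    assume z: "mild_solution (state_space \<Omega>) R u0 h f z \<and> z \<in> AAA (state_space \<Omega>) \<and>
      sup_norm (\<lambda>t. z t - y0 t) \<le> \<rho>" and t: "0 \<le> t"
    then have zX: "z \<in> AAA X" by (simp add: X_def)
    have "\<Phi> z s = z s" if "s \<ge> 0" for s using mild_iff[OF zX] z that by blast
    from unique[OF y(1) zX y(2) this t] show "z t = y t" .
  qed (rule y(3))
qed

end
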